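(* Let $X\in\{F,A\}$. The correlated coherence $C^a_{X,cc}$ is a measure of quantum correlation for bipartite states $\rho^{ab}$ on $\mathcal H_a\otimes\mathcal H_b$, in the following sense: (1) $C^a_{X,cc}(\rho^{ab})\ge0$, with equality iff $\rho^{ab}=\sum_ip_i|\alpha_i\rangle\langle\alpha_i|\otimes\sigma_i$ for some orthonormal basis $\{|\alpha_i\rangle\}$ of $\mathcal H_a$, probabilities $p_i$ and states $\sigma_i$ on $\mathcal H_b$; (2) $C^a_{X,cc}\big((U_a\otimes U_b)\rho^{ab}(U_a\otimes U_b)^\dagger\big)=C^a_{X,cc}(\rho^{ab})$ for all unitaries $U_a,U_b$; (3) $C^a_{X,cc}\big((I^a\otimes\Phi^b)(\rho^{ab})\big)\le C^a_{X,cc}(\rho^{ab})$ for every CPTP map $\Phi^b$ on system $b$; (4) on pure states it is an entanglement monotone: if a pure state $|\psi\rangle$ can be transformed into a pure state $|\phi\rangle$ by LOCC, then $C^a_{X,cc}(|\psi\rangle)\ge C^a_{X,cc}(|\phi\rangle)$.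
   Context: $F(\rho,\sigma)=\mathrm{Tr}\sqrt{\sqrt\sigma\rho\sqrt\sigma}$, $A(\rho,\sigma)=\mathrm{Tr}(\sqrt\rho\sqrt\sigma)$, $d_X=1-X^2$. For an orthonormal basis $\mathcal B=\{|\alpha_i\rangle\}$ of $\mathcal H_a$, $C^a_X(\rho^{ab};\mathcal B)=\min d_X(\rho^{ab},\sigma)$ over states $\sigma=\sum_ip_i|\alpha_i\rangle\langle\alpha_i|\otimes\sigma_i$. The correlated coherence is $C^a_{X,cc}(\rho^{ab})=\min_{\mathcal B}C^a_X(\rho^{ab};\mathcal B)$, the minimum over orthonormal bases $\mathcal B$ of $\mathcal H_a$ consisting of eigenvectors of $\rho^a=\mathrm{Tr}_b\rho^{ab}$. *)

theory Defs
  imports Complex_Main "Jordan_Normal_Form.Matrix"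
begin

definition adj :: "complex mat \<Rightarrow> complex mat" where
  "adj A = mat (dim_col A) (dim_row A) (\<lambda>(i,j). cnj (A $$ (j,i)))"

definition mtrace :: "complex mat \<Rightarrow> complex" where
  "mtrace A = (\<Sum>i<dim_row A. A $$ (i,i))"

definition cinner :: "complex vec \<Rightarrow> complex vec \<Rightarrow> complex" where
  "cinner u v = (\<Sum>i<dim_vec u. cnj (u $ i) * v $ i)"

text \<open>Positive semidefinite n x n matrices (over C this implies Hermitian).\<close>
definition psd :: "nat \<Rightarrow> complex mat \<Rightarrow> bool" where
  "psd n A \<longleftrightarrow> A \<in> carrier_mat n n \<and>
     (\<forall>v \<in> carrier_vec n. cinner v (A *\<^sub>v v) \<in> \<real> \<and> 0 \<le> Re (cinner v (A *\<^sub>v v)))"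

definition density :: "nat \<Rightarrow> complex mat \<Rightarrow> bool" where
  "density n \<rho> \<longleftrightarrow> psd n \<rho> \<and> mtrace \<rho> = 1"

definition unitary :: "nat \<Rightarrow> complex mat \<Rightarrow> bool" where
  "unitary n U \<longleftrightarrow> U \<in> carrier_mat n n \<and> adj U * U = 1\<^sub>m n"

definition msqrt :: "complex mat \<Rightarrow> complex mat" where
  "msqrt A = (THE B. psd (dim_row A) B \<and> B * B = A)"

text \<open>Kronecker (tensor) product; index (i,k) of the composite system is i * dim + k.\<close>
definition kron :: "complex mat \<Rightarrow> complex mat \<Rightarrow> complex mat" where
  "kron A B = mat (dim_row A * dim_row B) (dim_col A * dim_col B)
     (\<lambda>(i,j). A $$ (i div dim_row B, j div dim_col B) * B $$ (i mod dim_row B, j mod dim_col B))"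

definition proj :: "complex vec \<Rightarrow> complex mat" where
  "proj v = mat (dim_vec v) (dim_vec v) (\<lambda>(i,j). v $ i * cnj (v $ j))"

definition msum :: "nat \<Rightarrow> ('i \<Rightarrow> complex mat) \<Rightarrow> 'i set \<Rightarrow> complex mat" where
  "msum n f I = mat n n (\<lambda>(r,c). \<Sum>i\<in>I. f i $$ (r,c))"

definition ptrace_b :: "nat \<Rightarrow> nat \<Rightarrow> complex mat \<Rightarrow> complex mat" where
  "ptrace_b da db \<rho> = mat da da (\<lambda>(i,j). \<Sum>k<db. \<rho> $$ (i * db + k, j * db + k))"

definition onb :: "nat \<Rightarrow> (nat \<Rightarrow> complex vec) \<Rightarrow> bool" where
  "onb d \<alpha> \<longleftrightarrow> (\<forall>i<d. \<alpha> i \<in> carrier_vec d) \<and>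
     (\<forall>i<d. \<forall>j<d. cinner (\<alpha> i) (\<alpha> j) = (if i = j then 1 else 0))"

definition eigenbasis :: "nat \<Rightarrow> complex mat \<Rightarrow> (nat \<Rightarrow> complex vec) \<Rightarrow> bool" where
  "eigenbasis d A \<alpha> \<longleftrightarrow> onb d \<alpha> \<and> (\<forall>i<d. \<exists>c. A *\<^sub>v \<alpha> i = c \<cdot>\<^sub>v \<alpha> i)"

definition prob_vec :: "nat \<Rightarrow> (nat \<Rightarrow> real) \<Rightarrow> bool" where
  "prob_vec d p \<longleftrightarrow> (\<forall>i<d. 0 \<le> p i) \<and> (\<Sum>i<d. p i) = 1"

definition cq_states :: "nat \<Rightarrow> nat \<Rightarrow> (nat \<Rightarrow> complex vec) \<Rightarrow> complex mat set" where
  "cq_states da db \<alpha> = {msum (da * db) (\<lambda>i. complex_of_real (p i) \<cdot>\<^sub>m kron (proj (\<alpha> i)) (\<sigma> i)) {..<da}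
      | p \<sigma>. prob_vec da p \<and> (\<forall>i<da. density db (\<sigma> i))}"

definition fidelity :: "complex mat \<Rightarrow> complex mat \<Rightarrow> real" where
  "fidelity \<rho> \<sigma> = Re (mtrace (msqrt (msqrt \<sigma> * \<rho> * msqrt \<sigma>)))"

definition affinity :: "complex mat \<Rightarrow> complex mat \<Rightarrow> real" where
  "affinity \<rho> \<sigma> = Re (mtrace (msqrt \<rho> * msqrt \<sigma>))"

definition dist_X :: "(complex mat \<Rightarrow> complex mat \<Rightarrow> real) \<Rightarrow> complex mat \<Rightarrow> complex mat \<Rightarrow> real" where
  "dist_X X \<rho> \<sigma> = 1 - (X \<rho> \<sigma>)\<^sup>2"

definition coh_basis :: "(complex mat \<Rightarrow> complex mat \<Rightarrow> real) \<Rightarrow> nat \<Rightarrow> nat \<Rightarrow> complex mat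
    \<Rightarrow> (nat \<Rightarrow> complex vec) \<Rightarrow> real" where
  "coh_basis X da db \<rho> \<alpha> = Inf {dist_X X \<rho> \<sigma> | \<sigma>. \<sigma> \<in> cq_states da db \<alpha>}"

definition corr_coh :: "(complex mat \<Rightarrow> complex mat \<Rightarrow> real) \<Rightarrow> nat \<Rightarrow> nat \<Rightarrow> complex mat \<Rightarrow> real" where
  "corr_coh X da db \<rho> = Inf {coh_basis X da db \<rho> \<alpha> | \<alpha>. eigenbasis da (ptrace_b da db \<rho>) \<alpha>}"

definition block :: "nat \<Rightarrow> nat \<Rightarrow> nat \<Rightarrow> complex mat \<Rightarrow> complex mat" where
  "block db i j \<rho> = mat db db (\<lambda>(k,l). \<rho> $$ (i * db + k, j * db + l))"

definition id_tensor :: "nat \<Rightarrow> nat \<Rightarrow> nat \<Rightarrow> (complex mat \<Rightarrow> complex mat) \<Rightarrow> complex mat \<Rightarrow> complex mat" where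
  "id_tensor k db db' \<Phi> \<rho> = mat (k * db') (k * db')
     (\<lambda>(r,c). \<Phi> (block db (r div db') (c div db') \<rho>) $$ (r mod db', c mod db'))"

definition cptp :: "nat \<Rightarrow> nat \<Rightarrow> (complex mat \<Rightarrow> complex mat) \<Rightarrow> bool" where
  "cptp d d' \<Phi> \<longleftrightarrow>
     (\<forall>A \<in> carrier_mat d d. \<Phi> A \<in> carrier_mat d' d') \<and>
     (\<forall>A \<in> carrier_mat d d. \<forall>B \<in> carrier_mat d d. \<Phi> (A + B) = \<Phi> A + \<Phi> B) \<and>
     (\<forall>A \<in> carrier_mat d d. \<forall>c. \<Phi> (c \<cdot>\<^sub>m A) = c \<cdot>\<^sub>m \<Phi> A) \<and>
     (\<forall>A \<in> carrier_mat d d. mtrace (\<Phi> A) = mtrace A) \<and>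
     (\<forall>k \<rho>. psd (k * d) \<rho> \<longrightarrow> psd (k * d') (id_tensor k d d' \<Phi> \<rho>))"

definition kraus_complete :: "nat \<Rightarrow> complex mat list \<Rightarrow> bool" where
  "kraus_complete d Ks \<longleftrightarrow> (\<forall>K \<in> set Ks. K \<in> carrier_mat d d) \<and>
     msum d (\<lambda>i. adj (Ks ! i) * Ks ! i) {..<length Ks} = 1\<^sub>m d"

definition local_instr :: "nat \<Rightarrow> nat \<Rightarrow> complex mat list \<Rightarrow> bool" where
  "local_instr da db Ls \<longleftrightarrow>
     (\<exists>As. kraus_complete da As \<and> Ls = map (\<lambda>A. kron A (1\<^sub>m db)) As) \<or>
     (\<exists>Bs. kraus_complete db Bs \<and> Ls = map (\<lambda>B. kron (1\<^sub>m da) B) Bs)"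

text \<open>Kraus operators (one per leaf of the protocol tree) of a finite-round LOCC protocol:
  starting from the identity, in each round, on every branch (depending on all previous
  classical outcomes) one party performs a local instrument.\<close>
inductive LOCC_ops :: "nat \<Rightarrow> nat \<Rightarrow> complex mat list \<Rightarrow> bool" for da db where
  init: "LOCC_ops da db [1\<^sub>m (da * db)]"
| round: "LOCC_ops da db Ms \<Longrightarrow> length Ls = length Ms \<Longrightarrow>
          (\<forall>k < length Ms. local_instr da db (Ls ! k)) \<Longrightarrow>
          LOCC_ops da db (concat (map (\<lambda>k. map (\<lambda>L. L * Ms ! k) (Ls ! k)) [0..<length Ms]))"

definition apply_ops :: "nat \<Rightarrow> complex mat list \<Rightarrow> complex mat \<Rightarrow> complex mat" where
  "apply_ops n Ms \<rho> = msum n (\<lambda>i. Ms ! i * \<rho> * adj (Ms ! i)) {..<length Ms}"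

definition pure_state :: "nat \<Rightarrow> complex vec \<Rightarrow> bool" where
  "pure_state n \<psi> \<longleftrightarrow> \<psi> \<in> carrier_vec n \<and> cinner \<psi> \<psi> = 1"

definition LOCC_transformable :: "nat \<Rightarrow> nat \<Rightarrow> complex vec \<Rightarrow> complex vec \<Rightarrow> bool" where
  "LOCC_transformable da db \<psi> \<phi> \<longleftrightarrow>
     (\<exists>Ms. LOCC_ops da db Ms \<and> apply_ops (da * db) Ms (proj \<psi>) = proj \<phi>)"

end

theory Submission
  imports Defs "HOL-Analysis.L2_Norm" "Jordan_Normal_Form.Spectral_Radius"
begin

text \<open>
  Fidelity and affinity are handled through positive block matrices
  \<open>[[\<rho>, Y], [Y\<^sup>*, \<sigma>]]\<close>. Such a matrix with \<open>Re (Tr Y)\<close> close to 1 forces \<open>\<rho>\<close> and \<open>\<sigma>\<close> to be close, so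
  by compactness of the set of classical-quantum states a vanishing coherence is attained.
  Since \<open>F\<close> is the maximum of \<open>Re (Tr Y)\<close>, applying a channel to the whole block matrix gives its data
  processing inequality. For the affinity \<open>\<langle>1, \<rho>\<^sup>1\<^sup>/\<^sup>2 1 \<sigma>\<^sup>1\<^sup>/\<^sup>2\<rangle>\<close> one uses instead that
  \<open>C \<mapsto> \<rho>\<^sup>1\<^sup>/\<^sup>2 C \<sigma>\<^sup>1\<^sup>/\<^sup>2\<close> is the geometric mean of the commuting operators \<open>C \<mapsto> \<rho>C\<close> and \<open>C \<mapsto> C\<sigma>\<close>, hence
  the largest Hermitian form \<open>w\<close> with \<open>|w(C, D)|\<^sup>2 \<le> Tr (C\<^sup>*\<rho>C) Tr (D\<sigma>D\<^sup>*)\<close>, and pulls this form back along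
  the dual channel. A channel or unitary that respects the eigenbasis condition maps
  classical-quantum states to classical-quantum states, so (2) and (3) follow.

  For a pure state with coefficient matrix \<open>M\<close> the coherence is \<open>1 - \<parallel>M\<parallel>\<^sup>2\<close> (operator norm) for \<open>F\<close> and
  \<open>1 - \<parallel>M\<^sup>*M\<parallel>\<^sup>2\<close> (Frobenius norm) for \<open>A\<close>. Both \<open>\<parallel>M\<parallel>\<^sup>2\<close> and \<open>\<parallel>M\<^sup>*M\<parallel>\<close> are invariant under transposition
  and satisfy \<open>g(M) \<le> \<Sum>\<^sub>l g(A\<^sub>l M)\<close> for Kraus operators \<open>A\<^sub>l\<close>, which gives monotonicity under LOCC.
\<close>

section \<open>Matrices and the complex inner product\<close>

text \<open>The definitions use \<open>Inf\<close> where the theorem has minima, so (2) and (3) are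
  proved by mapping competitors to competitors, without choosing a minimiser. For the same reason
  zero coherence only yields a minimising sequence. Its eigenbases may vary when the reduced state
  is degenerate, so the limit is taken jointly over bases, weights and states; the limit basis is
  only asked to be orthonormal, which is all that (1) demands. The two overlaps part company at data
  processing. A coupling sent through a channel bounds the output fidelity from below, but the
  output affinity can be smaller than the output fidelity, so the affinity needs a variational
  description of its own. In (4) every branch of a protocol started in a pure state is again pure,
  and if the branches sum to the projection onto \<phi> then each branch vector is a multiple of
  \<phi>, with squared weights summing to 1. Since the two functions of the coefficient matrix scale
  quadratically, their sum over the unnormalised branches is then exactly their value at
  \<phi>.\<close>

lemma mat_mult_assoc:
  fixes A B C :: "complex mat"
  assumes "dim_col A = dim_row B" "dim_col B = dim_row C"
  shows "A * B * C = A * (B * C)"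
  by (rule assoc_mult_mat[of _ "dim_row A" "dim_col A" _ "dim_col B" _ "dim_col C"]) (use assms in auto)

lemma mat_mult_vec_assoc:
  fixes A B :: "complex mat"
  assumes "dim_col A = dim_row B" "dim_col B = dim_vec v"
  shows "A * B *\<^sub>v v = A *\<^sub>v (B *\<^sub>v v)"
  by (rule assoc_mult_mat_vec[of _ "dim_row A" "dim_col A" _ "dim_col B"]) (use assms in auto)

lemma mat_vec_carrier [simp]: "dim_row A = n \<Longrightarrow> A *\<^sub>v v \<in> carrier_vec n"
  by (auto simp: carrier_vecI)

lemma mat_mult_index:
  fixes A B :: "complex mat"
  assumes "i < dim_row A" "j < dim_col B" "dim_col A = dim_row B"
  shows "(A * B) $$ (i, j) = (\<Sum>k<dim_row B. A $$ (i, k) * B $$ (k, j))"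
  using assms by (auto simp: scalar_prod_def atLeast0LessThan intro!: sum.cong)

lemma mat_vec_index:
  fixes A :: "complex mat"
  assumes "i < dim_row A" "dim_col A = dim_vec v"
  shows "(A *\<^sub>v v) $ i = (\<Sum>k<dim_vec v. A $$ (i, k) * v $ k)"
  using assms by (auto simp: scalar_prod_def atLeast0LessThan intro!: sum.cong)

lemma adj_dim [simp]: "dim_row (adj A) = dim_col A" "dim_col (adj A) = dim_row A"
  by (auto simp: adj_def)

lemma adj_carrier [simp]: "A \<in> carrier_mat m n \<Longrightarrow> adj A \<in> carrier_mat n m"
  by (auto simp: adj_def)

lemma adj_index [simp]: "i < dim_col A \<Longrightarrow> j < dim_row A \<Longrightarrow> adj A $$ (i, j) = cnj (A $$ (j, i))"
  by (auto simp: adj_def)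

lemma adj_adj [simp]: "adj (adj A) = A"
  by (rule eq_matI) auto

lemma adj_one [simp]: "adj (1\<^sub>m n) = 1\<^sub>m n"
  by (rule eq_matI) auto

lemma adj_mult:
  assumes "dim_col A = dim_row B"
  shows "adj (A * B) = adj B * adj A"
  by (rule eq_matI)
    (use assms in \<open>auto simp: mat_mult_index mult.commute simp del: index_mult_mat(1) intro!: sum.cong\<close>)

lemma mtrace_comm:
  assumes "dim_col A = dim_row B" "dim_col B = dim_row A"
  shows "mtrace (A * B) = mtrace (B * A)"
proof -
  have "mtrace (A * B) = (\<Sum>i<dim_row A. \<Sum>k<dim_row B. A $$ (i, k) * B $$ (k, i))"
    using assms by (auto simp: mtrace_def mat_mult_index simp del: index_mult_mat(1) intro!: sum.cong)
  also have "\<dots> = (\<Sum>k<dim_row B. \<Sum>i<dim_row A. B $$ (k, i) * A $$ (i, k))"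
    by (subst sum.swap) (simp add: mult.commute)
  also have "\<dots> = mtrace (B * A)"
    using assms by (auto simp: mtrace_def mat_mult_index simp del: index_mult_mat(1) intro!: sum.cong)
  finally show ?thesis .
qed

lemma mtrace_smult: "dim_row A = dim_col A \<Longrightarrow> mtrace (c \<cdot>\<^sub>m A) = c * mtrace A"
  by (auto simp: mtrace_def sum_distrib_left)

section \<open>Squared norm, sesquilinear inner product and Cauchy-Schwarz\<close>

definition nrm2 :: "complex vec \<Rightarrow> real" where
  "nrm2 v = (\<Sum>i<dim_vec v. (cmod (v $ i))\<^sup>2)"

lemma nrm2_ge0 [simp]: "0 \<le> nrm2 v"
  by (simp add: nrm2_def sum_nonneg)

lemma cinner_self: "cinner v v = of_real (nrm2 v)"
  by (simp add: cinner_def nrm2_def mult.commute[of "cnj _"] complex_norm_square[symmetric] flip: of_real_power)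

lemma nrm2_eq0: "nrm2 v = 0 \<Longrightarrow> v = 0\<^sub>v (dim_vec v)"
  by (rule eq_vecI) (auto simp: nrm2_def sum_nonneg_eq_0_iff)

lemma nrm2_zero [simp]: "nrm2 (0\<^sub>v n) = 0"
  by (simp add: nrm2_def)

lemma nrm2_smult: "nrm2 (c \<cdot>\<^sub>v v) = (cmod c)\<^sup>2 * nrm2 v"
  by (simp add: nrm2_def sum_distrib_left norm_mult power_mult_distrib)

lemma cinner_smult_left: "cinner (c \<cdot>\<^sub>v u) v = cnj c * cinner u v"
  by (simp add: cinner_def sum_distrib_left algebra_simps)

lemma cinner_smult_right: "dim_vec u = dim_vec v \<Longrightarrow> cinner u (c \<cdot>\<^sub>v v) = c * cinner u v"
  by (simp add: cinner_def sum_distrib_left algebra_simps)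

lemma cinner_add_left: "dim_vec u = dim_vec w \<Longrightarrow> cinner (u + w) v = cinner u v + cinner w v"
  by (simp add: cinner_def sum.distrib algebra_simps)

lemma cinner_add_right: "dim_vec u = dim_vec v \<Longrightarrow> dim_vec v = dim_vec w \<Longrightarrow>
    cinner u (v + w) = cinner u v + cinner u w"
  by (simp add: cinner_def sum.distrib algebra_simps)

lemma cinner_diff_left: "dim_vec u = dim_vec w \<Longrightarrow> cinner (u - w) v = cinner u v - cinner w v"
  by (simp add: cinner_def sum_subtractf algebra_simps)

lemma cinner_diff_right: "dim_vec u = dim_vec v \<Longrightarrow> dim_vec v = dim_vec w \<Longrightarrow>
    cinner u (v - w) = cinner u v - cinner u w"
  by (simp add: cinner_def sum_subtractf algebra_simps)

lemma cinner_cnj: "dim_vec u = dim_vec v \<Longrightarrow> cnj (cinner u v) = cinner v u"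
  by (simp add: cinner_def mult.commute)

lemma cinner_adj:
  assumes "dim_vec u = dim_row A" "dim_vec v = dim_col A"
  shows "cinner u (A *\<^sub>v v) = cinner (adj A *\<^sub>v u) v"
proof -
  have "cinner u (A *\<^sub>v v) = (\<Sum>i<dim_row A. \<Sum>k<dim_col A. cnj (u $ i) * (A $$ (i, k) * v $ k))"
    using assms by (auto simp: cinner_def mat_vec_index sum_distrib_left simp del: index_mult_mat_vec intro!: sum.cong)
  also have "\<dots> = (\<Sum>k<dim_col A. \<Sum>i<dim_row A. cnj (u $ i) * (A $$ (i, k) * v $ k))"
    by (rule sum.swap)
  also have "\<dots> = cinner (adj A *\<^sub>v u) v"
    using assms by (auto simp: cinner_def mat_vec_index sum_distrib_right sum_distrib_left mult_ac simp del: index_mult_mat_vec intro!: sum.cong)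
  finally show ?thesis .
qed

lemma cinner_gram:
  assumes "dim_vec u = dim_col A" "dim_vec v = dim_col A"
  shows "cinner u (adj A * A *\<^sub>v v) = cinner (A *\<^sub>v u) (A *\<^sub>v v)"
  using assms by (simp add: mat_mult_vec_assoc cinner_adj[of u "adj A"])

lemma cauchy_schwarz:
  assumes "dim_vec u = dim_vec v"
  shows "(cmod (cinner u v))\<^sup>2 \<le> nrm2 u * nrm2 v"
proof -
  let ?f = "\<lambda>i. cmod (u $ i)" and ?g = "\<lambda>i. cmod (v $ i)" and ?A = "{..<dim_vec v}"
  have "cmod (cinner u v) \<le> (\<Sum>i\<in>?A. cmod (cnj (u $ i) * v $ i))"
    unfolding cinner_def assms by (rule norm_sum)
  also have "\<dots> = (\<Sum>i\<in>?A. \<bar>?f i\<bar> * \<bar>?g i\<bar>)" by (simp add: norm_mult)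
  also have "\<dots> \<le> L2_set ?f ?A * L2_set ?g ?A" by (rule L2_set_mult_ineq)
  finally have "(cmod (cinner u v))\<^sup>2 \<le> (L2_set ?f ?A * L2_set ?g ?A)\<^sup>2"
    by (intro power_mono) auto
  also have "\<dots> = nrm2 u * nrm2 v"
    by (simp add: L2_set_def nrm2_def assms power_mult_distrib sum_nonneg)
  finally show ?thesis .
qed

lemma Re_cinner_le:
  assumes "dim_vec u = dim_vec v"
  shows "Re (cinner u v) \<le> sqrt (nrm2 u) * sqrt (nrm2 v)"
proof -
  have "Re (cinner u v) \<le> cmod (cinner u v)" by (rule complex_Re_le_cmod)
  also have "\<dots> = sqrt ((cmod (cinner u v))\<^sup>2)" by simp
  also have "\<dots> \<le> sqrt (nrm2 u * nrm2 v)" using cauchy_schwarz[OF assms] by (rule real_sqrt_le_mono)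
  finally show ?thesis by (simp add: real_sqrt_mult)
qed

lemma cinner_unit_left:
  assumes "i < n" "v \<in> carrier_vec n"
  shows "cinner (unit_vec n i) v = v $ i"
proof -
  have "cinner (unit_vec n i) v = (\<Sum>k<n. if k = i then v $ k else 0)"
    unfolding cinner_def by (rule sum.cong) (use assms in \<open>auto simp: unit_vec_def\<close>)
  then show ?thesis using assms by simp
qed

lemma mat_vec_unit:
  fixes A :: "complex mat"
  assumes "A \<in> carrier_mat m n" "j < n"
  shows "A *\<^sub>v unit_vec n j = col A j"
proof (rule eq_vecI)
  fix i assume i: "i < dim_vec (col A j)"
  have "(A *\<^sub>v unit_vec n j) $ i = (\<Sum>k<n. if k = j then A $$ (i, k) else 0)"
    using i assms by (auto simp: mat_vec_index unit_vec_def if_distrib[of "\<lambda>x. _ * x"] cong: if_cong simp del: index_mult_mat_vec intro!: sum.cong)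
  then show "(A *\<^sub>v unit_vec n j) $ i = col A j $ i" using assms i by simp
qed (use assms in auto)

lemma cinner_unit_mat:
  assumes "A \<in> carrier_mat n n" "i < n" "j < n"
  shows "cinner (unit_vec n i) (A *\<^sub>v unit_vec n j) = A $$ (i, j)"
  using assms by (simp add: mat_vec_unit cinner_unit_left carrier_vecI)

lemma nrm2_unit [simp]: "i < n \<Longrightarrow> nrm2 (unit_vec n i) = 1"
  using cinner_self[of "unit_vec n i"] cinner_unit_left[of i n "unit_vec n i"]
  by (metis index_unit_vec(2) of_real_eq_1_iff unit_vec_carrier)

lemma cinner_zero_left [simp]: "cinner (0\<^sub>v n) v = 0"
  by (simp add: cinner_def)

lemma cinner_zero_right [simp]: "dim_vec v = n \<Longrightarrow> cinner v (0\<^sub>v n) = 0"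
  by (auto simp: cinner_def)

lemma mat_vec_zero: "dim_col A = n \<Longrightarrow> A *\<^sub>v 0\<^sub>v n = (0\<^sub>v (dim_row A) :: complex vec)"
  by (rule eq_vecI) (auto simp: mat_vec_index simp del: index_mult_mat_vec)

lemma cinner_uminus_left: "dim_vec u = dim_vec v \<Longrightarrow> cinner (- u) v = - cinner u v"
  by (simp add: cinner_def sum_negf)

lemma cinner_uminus_right: "dim_vec u = dim_vec v \<Longrightarrow> cinner u (- v) = - cinner u v"
  by (simp add: cinner_def sum_negf)

lemma mat_vec_uminus: "dim_vec v = dim_col A \<Longrightarrow> A *\<^sub>v (- v) = - (A *\<^sub>v v :: complex vec)"
  by (rule eq_vecI) (auto simp: mat_vec_index sum_negf simp del: index_mult_mat_vec)

section \<open>Spectral theorem and square roots\<close>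

text \<open>The operator sum_k c_k |e_k><e_k|. With the basis fixed and the coefficients real this
  is a functional calculus for Hermitian matrices: products, roots and pseudo-inverses act on
  \<open>c\<close> alone.\<close>

definition spec :: "nat \<Rightarrow> (nat \<Rightarrow> complex vec) \<Rightarrow> (nat \<Rightarrow> real) \<Rightarrow> complex mat" where
  "spec n e c = mat n n (\<lambda>(i, j). \<Sum>k<n. of_real (c k) * e k $ i * cnj (e k $ j))"

lemma spec_carrier [simp]: "spec n e c \<in> carrier_mat n n"
  and spec_dim [simp]: "dim_row (spec n e c) = n" "dim_col (spec n e c) = n"
  by (auto simp: spec_def)

lemma spec_adj [simp]: "adj (spec n e c) = spec n e c"
  by (rule eq_matI) (auto simp: spec_def mult_ac)

lemma onb_dim: "onb n e \<Longrightarrow> k < n \<Longrightarrow> dim_vec (e k) = n"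
  by (auto simp: onb_def)

lemma onb_cinner: "onb n e \<Longrightarrow> k < n \<Longrightarrow> l < n \<Longrightarrow> cinner (e k) (e l) = (if k = l then 1 else 0)"
  by (auto simp: onb_def)

lemma onb_nrm2: "onb n e \<Longrightarrow> k < n \<Longrightarrow> nrm2 (e k) = 1"
  using onb_cinner[of n e k k] by (simp add: cinner_self)

lemma onb_sum:
  assumes "onb n e" "k < n" "l < n"
  shows "(\<Sum>i<n. cnj (e k $ i) * e l $ i) = (if k = l then 1 else 0)"
  using onb_cinner[OF assms] onb_dim[OF assms(1,2)] by (simp add: cinner_def)

text \<open>Orthonormality says U* U = 1 for the matrix with columns e_k. A left inverse of a square
  matrix is a right inverse, and the entries of U U* give the resolution of the identity.\<close>

lemma onb_complete:
  assumes e: "onb n e" and "i < n" "j < n"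
  shows "(\<Sum>k<n. e k $ i * cnj (e k $ j)) = (if i = j then 1 else 0)"
proof -
  define U where "U = mat n n (\<lambda>(i, k). e k $ i)"
  have U: "U \<in> carrier_mat n n" by (simp add: U_def)
  have "adj U * U = 1\<^sub>m n"
    by (rule eq_matI) (auto simp: U_def mat_mult_index onb_sum[OF e] simp del: index_mult_mat(1))
  then have "U * adj U = 1\<^sub>m n" by (rule mat_mult_left_right_inverse[rotated 2]) (use U in auto)
  then have "(U * adj U) $$ (i, j) = (if i = j then 1 else 0)" using assms by simp
  then show ?thesis using assms U by (auto simp: U_def mat_mult_index simp del: index_mult_mat(1))
qed

lemma spec_one: "onb n e \<Longrightarrow> spec n e (\<lambda>_. 1) = 1\<^sub>m n"
  by (rule eq_matI) (auto simp: spec_def onb_complete)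

lemma spec_cong: "(\<And>k. k < n \<Longrightarrow> c k = d k) \<Longrightarrow> spec n e c = spec n e d"
  by (rule eq_matI) (auto simp: spec_def)

lemma spec_mult:
  assumes e: "onb n e"
  shows "spec n e c * spec n e d = spec n e (\<lambda>k. c k * d k)"
proof (rule eq_matI)
  fix i j assume "i < dim_row (spec n e (\<lambda>k. c k * d k))" "j < dim_col (spec n e (\<lambda>k. c k * d k))"
  then have ij: "i < n" "j < n" by auto
  have "(spec n e c * spec n e d) $$ (i, j) = (\<Sum>x<n. (\<Sum>k<n. of_real (c k) * e k $ i * cnj (e k $ x)) *
      (\<Sum>l<n. of_real (d l) * e l $ x * cnj (e l $ j)))"
    using ij by (auto simp: mat_mult_index simp del: index_mult_mat(1) intro!: sum.cong) (simp add: spec_def)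
  also have "\<dots> = (\<Sum>x<n. \<Sum>k<n. \<Sum>l<n. of_real (c k) * e k $ i * of_real (d l) * cnj (e l $ j) * (cnj (e k $ x) * e l $ x))"
    by (simp add: sum_product mult_ac)
  also have "\<dots> = (\<Sum>k<n. \<Sum>l<n. \<Sum>x<n. of_real (c k) * e k $ i * of_real (d l) * cnj (e l $ j) * (cnj (e k $ x) * e l $ x))"
    by (subst sum.swap) (intro sum.cong refl sum.swap)
  also have "\<dots> = (\<Sum>k<n. \<Sum>l<n. if k = l then of_real (c k) * e k $ i * of_real (d l) * cnj (e l $ j) else 0)"
    by (intro sum.cong refl) (auto simp: sum_distrib_left[symmetric] onb_sum[OF e])
  also have "\<dots> = spec n e (\<lambda>k. c k * d k) $$ (i, j)"
    using ij by (simp add: spec_def mult_ac)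
  finally show "(spec n e c * spec n e d) $$ (i, j) = spec n e (\<lambda>k. c k * d k) $$ (i, j)" .
qed auto

lemma spec_apply:
  assumes e: "onb n e" and l: "l < n"
  shows "spec n e c *\<^sub>v e l = of_real (c l) \<cdot>\<^sub>v e l"
proof (rule eq_vecI)
  fix i assume "i < dim_vec (of_real (c l) \<cdot>\<^sub>v e l)"
  then have i: "i < n" using onb_dim[OF e l] by simp
  have "(spec n e c *\<^sub>v e l) $ i = (\<Sum>x<n. \<Sum>k<n. of_real (c k) * e k $ i * (cnj (e k $ x) * e l $ x))"
    using i onb_dim[OF e l] by (auto simp: mat_vec_index sum_distrib_right mult.assoc simp del: index_mult_mat_vec intro!: sum.cong)
      (simp add: spec_def sum_distrib_right mult.assoc)
  also have "\<dots> = (\<Sum>k<n. if k = l then of_real (c k) * e k $ i else 0)"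
    by (subst sum.swap) (auto simp: sum_distrib_left[symmetric] onb_sum[OF e] l if_distrib[of "\<lambda>x. _ * x"] cong: if_cong intro!: sum.cong)
  finally show "(spec n e c *\<^sub>v e l) $ i = (of_real (c l) \<cdot>\<^sub>v e l) $ i"
    using i l onb_dim[OF e l] by simp
qed (use onb_dim[OF e l] in auto)

lemma spec_trace:
  assumes e: "onb n e"
  shows "mtrace (spec n e c) = of_real (\<Sum>k<n. c k)"
proof -
  have "mtrace (spec n e c) = (\<Sum>i<n. \<Sum>k<n. of_real (c k) * (cnj (e k $ i) * e k $ i))"
    by (simp add: mtrace_def) (simp add: spec_def mult_ac)
  also have "\<dots> = (\<Sum>k<n. of_real (c k))"
    by (subst sum.swap) (auto simp: sum_distrib_left[symmetric] onb_sum[OF e] intro!: sum.cong)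
  finally show ?thesis by simp
qed

lemma spec_form:
  assumes "v \<in> carrier_vec n" "u \<in> carrier_vec n" "onb n e"
  shows "cinner u (spec n e c *\<^sub>v v) = (\<Sum>k<n. of_real (c k) * (cinner u (e k) * cinner (e k) v))"
proof -
  have "cinner u (spec n e c *\<^sub>v v) = (\<Sum>i<n. \<Sum>j<n. \<Sum>k<n. of_real (c k) * ((cnj (u $ i) * e k $ i) * (cnj (e k $ j) * v $ j)))"
    using assms by (auto simp: cinner_def mat_vec_index sum_distrib_left simp del: index_mult_mat_vec intro!: sum.cong)
     (simp add: spec_def sum_distrib_left sum_distrib_right mult_ac)
  also have "\<dots> = (\<Sum>i<n. \<Sum>k<n. \<Sum>j<n. of_real (c k) * ((cnj (u $ i) * e k $ i) * (cnj (e k $ j) * v $ j)))"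
    by (intro sum.cong refl sum.swap)
  also have "\<dots> = (\<Sum>k<n. \<Sum>i<n. \<Sum>j<n. of_real (c k) * ((cnj (u $ i) * e k $ i) * (cnj (e k $ j) * v $ j)))"
    by (rule sum.swap)
  also have "\<dots> = (\<Sum>k<n. of_real (c k) * (cinner u (e k) * cinner (e k) v))"
    using assms onb_dim[OF assms(3)] by (simp add: cinner_def sum_product sum_distrib_left[symmetric])
  finally show ?thesis .
qed

lemma spec_quad:
  assumes "v \<in> carrier_vec n" "onb n e"
  shows "cinner v (spec n e c *\<^sub>v v) = of_real (\<Sum>k<n. c k * (cmod (cinner (e k) v))\<^sup>2)"
proof -
  have "cinner v (e k) * cinner (e k) v = of_real ((cmod (cinner (e k) v))\<^sup>2)" if "k < n" for k
    using cinner_cnj[of "e k" v] onb_dim[OF assms(2) that] assms(1)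
    by (simp add: complex_norm_square mult.commute flip: of_real_power)
  then show ?thesis
    using assms by (simp add: spec_form)
qed

lemma parseval:
  assumes "v \<in> carrier_vec n" "onb n e"
  shows "(\<Sum>k<n. (cmod (cinner (e k) v))\<^sup>2) = nrm2 v"
  using spec_quad[OF assms, of "\<lambda>_. 1"] assms by (simp add: spec_one cinner_self del: of_real_sum of_real_power)

lemma trace_onb:
  assumes A: "A \<in> carrier_mat n n" and e: "onb n e"
  shows "mtrace A = (\<Sum>k<n. cinner (e k) (A *\<^sub>v e k))"
proof -
  have "(\<Sum>k<n. cinner (e k) (A *\<^sub>v e k)) = (\<Sum>k<n. \<Sum>i<n. \<Sum>j<n. A $$ (i, j) * (e k $ j * cnj (e k $ i)))"
    using A onb_dim[OF e] by (auto simp: cinner_def mat_vec_index sum_distrib_left mult_ac simp del: index_mult_mat_vec intro!: sum.cong)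
  also have "\<dots> = (\<Sum>i<n. \<Sum>j<n. \<Sum>k<n. A $$ (i, j) * (e k $ j * cnj (e k $ i)))"
    by (subst sum.swap) (intro sum.cong refl sum.swap)
  also have "\<dots> = (\<Sum>i<n. \<Sum>j<n. if j = i then A $$ (i, j) else 0)"
    by (intro sum.cong refl) (auto simp: sum_distrib_left[symmetric] onb_complete[OF e])
  also have "\<dots> = mtrace A" using A by (auto simp: mtrace_def)
  finally show ?thesis by simp
qed

lemma cscalar_cinner: "dim_vec u = dim_vec v \<Longrightarrow> v \<bullet>c u = cinner u v"
  by (auto simp: scalar_prod_def cinner_def mult.commute atLeast0LessThan intro!: sum.cong)

text \<open>Gram-Schmidt leaves the head of the list unchanged, so orthogonalising a basis
  completion of \<open>v\<close> and normalising keeps the direction of \<open>v\<close> in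
  front.\<close>

lemma onb_extend:
  assumes v: "v \<in> carrier_vec n" "v \<noteq> 0\<^sub>v n" and n: "0 < n"
  shows "\<exists>w c. onb n w \<and> w 0 = c \<cdot>\<^sub>v v"
proof -
  interpret cof_vec_space n "TYPE(complex)" .
  define b where "b = basis_completion v"
  from basis_completion[OF v, folded b_def]
  have b: "distinct b" "\<not> lin_dep (set b)" "set b \<subseteq> carrier_vec n" "hd b = v" "length b = n" by auto
  obtain vs where bv: "b = v # vs" using b n by (cases b) auto
  define ws where "ws = gram_schmidt n b"
  from gram_schmidt_result[OF b(3,1,2) refl, folded ws_def]
  have ws: "set ws \<subseteq> carrier_vec n" "corthogonal ws" "length ws = n" using b by auto
  have hdws: "hd ws = v" unfolding ws_def bv by (rule gram_schmidt_hd[OF v(1)])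
  define w where "w i = complex_of_real (1 / sqrt (nrm2 (ws ! i))) \<cdot>\<^sub>v (ws ! i)" for i
  have car: "ws ! i \<in> carrier_vec n" if "i < n" for i using ws that by auto
  have orth: "cinner (ws ! j) (ws ! i) = 0 \<longleftrightarrow> i \<noteq> j" if "i < n" "j < n" for i j
    using corthogonalD[OF ws(2), of i j] that ws(3) cscalar_cinner[of "ws ! j" "ws ! i"] car[of i] car[of j] by auto
  have "onb n w"
    unfolding onb_def
  proof (intro conjI allI impI)
    fix i j assume ij: "i < n" "j < n"
    show "cinner (w i) (w j) = (if i = j then 1 else 0)"
    proof (cases "i = j")
      case False
      then show ?thesis using orth[of j i] ij car[of i] car[of j]
        by (simp add: w_def cinner_smult_left cinner_smult_right)
    next
      case True
      have "nrm2 (ws ! i) \<noteq> 0" using orth[of i i] ij by (simp add: cinner_self)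
      then have "nrm2 (w i) = 1"
        by (simp add: w_def nrm2_smult norm_divide power_divide del: of_real_divide)
      then show ?thesis using True by (simp add: cinner_self)
    qed
  qed (use car in \<open>auto simp: w_def\<close>)
  moreover have "w 0 = complex_of_real (1 / sqrt (nrm2 (ws ! 0))) \<cdot>\<^sub>v v"
    using hdws ws(3) n hd_conv_nth[of ws] by (cases ws) (auto simp: w_def)
  ultimately show ?thesis by blast
qed

section \<open>Diagonalisation of Hermitian matrices\<close>

lemma cinner_herm:
  assumes "A \<in> carrier_mat n n" "adj A = A" "u \<in> carrier_vec n" "v \<in> carrier_vec n"
  shows "cinner u (A *\<^sub>v v) = cinner (A *\<^sub>v u) v"
  using cinner_adj[of u A v] assms by simp

lemma cinner_herm_real:
  assumes "A \<in> carrier_mat n n" "adj A = A" "v \<in> carrier_vec n"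
  shows "cinner v (A *\<^sub>v v) = of_real (Re (cinner v (A *\<^sub>v v)))"
proof -
  have "cnj (cinner v (A *\<^sub>v v)) = cinner v (A *\<^sub>v v)"
    using cinner_cnj[of v "A *\<^sub>v v"] cinner_herm[OF assms(1,2,3,3)] assms by simp
  then show ?thesis by (metis complex_cnj_cancel_iff complex_is_Real_iff Reals_cnj_iff of_real_Re)
qed

text \<open>Deflation: in an orthonormal basis starting with an eigenvector the first column is (l,
  0, ..., 0), Hermiticity forces the same shape on the first row, and the induction hypothesis
  diagonalises the remaining block.\<close>

lemma hermitian_diagonalize:
  assumes "A \<in> carrier_mat n n" "adj A = A"
  shows "\<exists>U c. U \<in> carrier_mat n n \<and> adj U * U = 1\<^sub>m n \<and>
    adj U * A * U = mat n n (\<lambda>(i, j). if i = j then complex_of_real (c i) else 0)"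
  using assms
proof (induction n arbitrary: A)
  case 0
  show ?case by (rule exI[of _ "1\<^sub>m 0"]) (auto intro!: eq_matI)
next
  case (Suc m)
  let ?n = "Suc m"
  note A = Suc.prems
  obtain l where "l \<in> spectrum A" using spectrum_non_empty[OF A(1)] by auto
  then obtain v where v: "v \<in> carrier_vec ?n" "v \<noteq> 0\<^sub>v ?n" "A *\<^sub>v v = l \<cdot>\<^sub>v v"
    using A by (auto simp: spectrum_def eigenvalue_def eigenvector_def)
  obtain w c where w: "onb ?n w" "w 0 = c \<cdot>\<^sub>v v" using onb_extend[OF v(1,2)] by auto
  have wd: "w i \<in> carrier_vec ?n" if "i < ?n" for i using w that by (auto simp: onb_def)
  have Aw: "A *\<^sub>v w 0 = l \<cdot>\<^sub>v w 0"
    using A v w by (simp add: mult_mat_vec[of _ ?n ?n] smult_smult_assoc mult.commute)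
  have "cinner (w 0) (A *\<^sub>v w 0) = l"
    using onb_cinner[OF w(1), of 0 0] by (simp add: Aw cinner_smult_right)
  \<comment> \<open>The quadratic form of a Hermitian matrix is real, hence so is the
    eigenvalue.\<close>
  then obtain r where r: "l = complex_of_real r" using cinner_herm_real[OF A wd[of 0]] by auto
  define W where "W = mat ?n ?n (\<lambda>(i, k). w k $ i)"
  have W: "W \<in> carrier_mat ?n ?n" by (simp add: W_def)
  have colW: "col W k = w k" if "k < ?n" for k
    by (rule eq_vecI) (use that wd[OF that] in \<open>auto simp: W_def\<close>)
  have WW: "adj W * W = 1\<^sub>m ?n"
    by (rule eq_matI) (auto simp: W_def mat_mult_index onb_sum[OF w(1)] simp del: index_mult_mat(1) sum.lessThan_Suc)
  define A' where "A' = adj W * A * W"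
  have A': "A' \<in> carrier_mat ?n ?n" using A W by (auto simp: A'_def)
  have A'h: "adj A' = A'" using A W by (simp add: A'_def adj_mult mat_mult_assoc)
  have A'0: "A' $$ (i, 0) = (if i = 0 then l else 0)" if i: "i < ?n" for i
  proof -
    have "A' $$ (i, 0) = cinner (unit_vec ?n i) (A' *\<^sub>v unit_vec ?n 0)"
      using cinner_unit_mat[OF A' i, of 0] by simp
    also have "\<dots> = cinner (W *\<^sub>v unit_vec ?n i) (A *\<^sub>v (W *\<^sub>v unit_vec ?n 0))"
      using A W by (simp add: A'_def mat_mult_vec_assoc cinner_adj[of _ "adj W"])
    also have "\<dots> = cinner (w i) (A *\<^sub>v w 0)" using W i by (simp add: mat_vec_unit colW)
    also have "\<dots> = (if i = 0 then l else 0)"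
      using onb_cinner[OF w(1) i, of 0] wd[OF i] wd[of 0] by (simp add: Aw cinner_smult_right)
    finally show ?thesis .
  qed
  have A'0': "A' $$ (0, i) = (if i = 0 then l else 0)" if i: "i < ?n" for i
    using adj_index[of 0 A' i] A'0[OF i] A' i r unfolding A'h by auto
  define A3 where "A3 = mat m m (\<lambda>(i, j). A' $$ (Suc i, Suc j))"
  have A3: "A3 \<in> carrier_mat m m" by (simp add: A3_def)
  have "adj A3 = A3"
  proof (rule eq_matI)
    fix i j assume "i < dim_row A3" "j < dim_col A3"
    then have ij: "i < m" "j < m" by (auto simp: A3_def)
    then show "adj A3 $$ (i, j) = A3 $$ (i, j)"
      using adj_index[of "Suc i" A' "Suc j"] A' unfolding A'h by (simp add: A3_def)
  qed (auto simp: A3_def)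
  from Suc.IH[OF A3 this] obtain U c where U: "U \<in> carrier_mat m m" "adj U * U = 1\<^sub>m m"
    "adj U * A3 * U = mat m m (\<lambda>(i, j). if i = j then complex_of_real (c i) else 0)" by auto
  define L where "L = mat 1 1 (\<lambda>_. l)"
  define Z1 Z2 :: "complex mat" where Z: "Z1 = 0\<^sub>m 1 m" "Z2 = 0\<^sub>m m 1"
  have L: "L \<in> carrier_mat 1 1" and Zc: "Z1 \<in> carrier_mat 1 m" "Z2 \<in> carrier_mat m 1"
    by (auto simp: L_def Z)
  have blk: "A' = four_block_mat L Z1 Z2 A3"
  proof (rule eq_matI)
    fix i j assume "i < dim_row (four_block_mat L Z1 Z2 A3)" "j < dim_col (four_block_mat L Z1 Z2 A3)"
    then have ij: "i < ?n" "j < ?n" by (auto simp: L_def A3_def)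
    show "A' $$ (i, j) = four_block_mat L Z1 Z2 A3 $$ (i, j)"
      using ij A'0[of i] A'0'[of j] by (cases i; cases j) (auto simp: L_def A3_def Z)
  qed (use A' in \<open>auto simp: L_def A3_def\<close>)
  \<comment> \<open>The unitary that diagonalises the smaller block, extended by 1 on the
    eigenvector.\<close>
  define F where "F = four_block_mat (1\<^sub>m 1) Z1 Z2 U"
  have F: "F \<in> carrier_mat ?n ?n" using U by (auto simp: F_def)
  have adF: "adj F = four_block_mat (1\<^sub>m 1) Z1 Z2 (adj U)"
    by (rule eq_matI) (use U in \<open>auto simp: F_def Z\<close>)
  have FF: "adj F * F = 1\<^sub>m ?n"
    unfolding adF unfolding F_def
    by (subst mult_four_block_mat[of _ 1 1 _ m _ m _ _ 1 _ m]) (use U Zc in \<open>auto simp: Z\<close>)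
  have "adj F * A' = four_block_mat L Z1 Z2 (adj U * A3)"
    unfolding adF blk
    by (subst mult_four_block_mat[of _ 1 1 _ m _ m _ _ 1 _ m]) (use U Zc L A3 in \<open>auto simp: Z\<close>)
  moreover have "four_block_mat L Z1 Z2 (adj U * A3) * F = four_block_mat L Z1 Z2 (adj U * A3 * U)"
    unfolding F_def
    by (subst mult_four_block_mat[of _ 1 1 _ m _ m _ _ 1 _ m]) (use U Zc L A3 in \<open>auto simp: Z\<close>)
  ultimately have FAF: "adj F * A' * F = four_block_mat L Z1 Z2 (adj U * A3 * U)" by simp
  show ?case
  proof (intro exI conjI)
    show "W * F \<in> carrier_mat ?n ?n" using W F by auto
    have "adj (W * F) * (W * F) = adj F * (adj W * W) * F"
      using W F by (simp add: adj_mult mat_mult_assoc)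
    also have "\<dots> = 1\<^sub>m ?n" using F FF by (simp add: WW right_mult_one_mat[of _ ?n])
    finally show "adj (W * F) * (W * F) = 1\<^sub>m ?n" .
    have "adj (W * F) * A * (W * F) = adj F * A' * F"
      using W F A by (simp add: adj_mult mat_mult_assoc A'_def)
    also have "\<dots> = mat ?n ?n (\<lambda>(i, j). if i = j then complex_of_real ((\<lambda>i. case i of 0 \<Rightarrow> r | Suc k \<Rightarrow> c k) i) else 0)"
      unfolding FAF U(3)
      by (rule eq_matI) (auto simp: L_def Z r split: nat.splits)
    finally show "adj (W * F) * A * (W * F) = mat ?n ?n (\<lambda>(i, j). if i = j then complex_of_real ((\<lambda>i. case i of 0 \<Rightarrow> r | Suc k \<Rightarrow> c k) i) else 0)" .
  qed
qed

lemma spectral_theorem: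
  assumes A: "A \<in> carrier_mat n n" "adj A = A"
  shows "\<exists>e c. onb n e \<and> A = spec n e c"
proof -
  obtain U c where U: "U \<in> carrier_mat n n" "adj U * U = 1\<^sub>m n"
    "adj U * A * U = mat n n (\<lambda>(i, j). if i = j then complex_of_real (c i) else 0)" (is "_ = ?D")
    using hermitian_diagonalize[OF A] by auto
  have UU: "U * adj U = 1\<^sub>m n" using U by (intro mat_mult_left_right_inverse[of "adj U" n U]) auto
  have D: "?D \<in> carrier_mat n n" by simp
  have "A = (U * adj U) * A * (U * adj U)" using A by (simp add: UU)
  also have "\<dots> = U * (adj U * A * U) * adj U" using U(1) A by (simp add: mat_mult_assoc)
  also have "\<dots> = spec n (col U) c"
  proof (rule eq_matI)
    fix i j assume "i < dim_row (spec n (col U) c)" "j < dim_col (spec n (col U) c)"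
    then have ij: "i < n" "j < n" by auto
    have "(U * ?D) $$ (i, k) = U $$ (i, k) * of_real (c k)" if "k < n" for k
    proof -
      have "(U * ?D) $$ (i, k) = (\<Sum>x<n. if x = k then U $$ (i, x) * of_real (c x) else 0)"
        using U(1) ij that by (auto simp: mat_mult_index if_distrib[of "\<lambda>x. _ * x"] cong: if_cong simp del: index_mult_mat(1) intro!: sum.cong)
      then show ?thesis using that by simp
    qed
    then show "(U * (adj U * A * U) * adj U) $$ (i, j) = spec n (col U) c $$ (i, j)"
      unfolding U(3) using U(1) ij
      by (subst mat_mult_index) (auto simp: spec_def mult_ac intro!: sum.cong)
  qed (use U in auto)
  finally have "A = spec n (col U) c" .
  moreover have "onb n (col U)"
    unfolding onb_def
  proof (intro conjI allI impI)
    fix i j assume ij: "i < n" "j < n"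
    have "cinner (col U i) (col U j) = (adj U * U) $$ (i, j)"
      using ij U(1) by (auto simp: cinner_def mat_mult_index simp del: index_mult_mat(1) intro!: sum.cong)
    then show "cinner (col U i) (col U j) = (if i = j then 1 else 0)" using ij U(2) by simp
  qed (use U in auto)
  ultimately show ?thesis by blast
qed

section \<open>Positive semidefinite matrices and their unique positive roots\<close>

lemma psd_carrier [simp]: "psd n A \<Longrightarrow> A \<in> carrier_mat n n"
  by (simp add: psd_def)

lemma psd_dim: "psd n A \<Longrightarrow> dim_row A = n" "psd n A \<Longrightarrow> dim_col A = n"
  by (auto simp: psd_def)

lemma psd_quad: "psd n A \<Longrightarrow> v \<in> carrier_vec n \<Longrightarrow> 0 \<le> Re (cinner v (A *\<^sub>v v))"
  by (simp add: psd_def)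

text \<open>Polarization with the test vectors \<open>e\<^sub>i + e\<^sub>j\<close> and \<open>e\<^sub>i + \<i> e\<^sub>j\<close>.\<close>

lemma psd_adj [simp]:
  assumes "psd n A"
  shows "adj A = A"
proof (rule eq_matI)
  have A: "A \<in> carrier_mat n n" using assms by simp
  fix i j assume "i < dim_row A" "j < dim_col A"
  then have ij: "i < n" "j < n" using A by auto
  let ?u = "unit_vec n i" and ?v = "unit_vec n j :: complex vec"
  have R: "Im (cinner x (A *\<^sub>v x)) = 0" if "x \<in> carrier_vec n" for x
    using assms that by (auto simp: psd_def complex_is_Real_iff)
  have q: "cinner (?u + c \<cdot>\<^sub>v ?v) (A *\<^sub>v (?u + c \<cdot>\<^sub>v ?v)) =
     A $$ (i, i) + c * A $$ (i, j) + cnj c * A $$ (j, i) + cnj c * c * A $$ (j, j)" for c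
  proof -
    have "A *\<^sub>v (?u + c \<cdot>\<^sub>v ?v) = A *\<^sub>v ?u + c \<cdot>\<^sub>v (A *\<^sub>v ?v)"
      using A by (simp add: mult_add_distrib_mat_vec[of _ n n] mult_mat_vec[of _ n n])
    then show ?thesis
      using A ij by (simp add: cinner_add_left cinner_add_right cinner_smult_left cinner_smult_right
          cinner_unit_mat algebra_simps)
  qed
  have "Im (A $$ (i, i)) = 0" "Im (A $$ (j, j)) = 0"
    using R[of ?u] R[of ?v] A ij by (simp_all add: cinner_unit_mat)
  then show "adj A $$ (i, j) = A $$ (i, j)"
    using R[of "?u + 1 \<cdot>\<^sub>v ?v", unfolded q] R[of "?u + \<i> \<cdot>\<^sub>v ?v", unfolded q] ij A
    by (simp add: complex_eq_iff)
qed (use assms in \<open>auto simp: psd_dim\<close>)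

lemma psdI_herm:
  assumes "A \<in> carrier_mat n n" "adj A = A" "\<And>v. v \<in> carrier_vec n \<Longrightarrow> 0 \<le> Re (cinner v (A *\<^sub>v v))"
  shows "psd n A"
  unfolding psd_def
proof (intro conjI ballI)
  fix v :: "complex vec" assume v: "v \<in> carrier_vec n"
  show "cinner v (A *\<^sub>v v) \<in> \<real>" by (subst cinner_herm_real[OF assms(1,2) v]) simp
qed (use assms in auto)

lemma psd_gram: "A \<in> carrier_mat m n \<Longrightarrow> psd n (adj A * A)"
  unfolding psd_def by (intro conjI ballI; (subst cinner_gram)?) (auto simp: cinner_self)

lemma psd_spec: "onb n e \<Longrightarrow> (\<And>k. k < n \<Longrightarrow> 0 \<le> c k) \<Longrightarrow> psd n (spec n e c)"
  by (auto simp: psd_def spec_quad intro!: sum_nonneg simp del: of_real_sum of_real_mult)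

lemma psd_spec_nonneg:
  assumes "psd n (spec n e c)" "onb n e" "k < n"
  shows "0 \<le> c k"
proof -
  have "e k \<in> carrier_vec n" using assms by (auto simp: onb_def)
  from psd_quad[OF assms(1) this] show ?thesis
    using onb_dim[OF assms(2,3)] assms by (simp add: spec_apply cinner_smult_right onb_cinner)
qed

lemma psd_spectral:
  assumes "psd n A"
  obtains e c where "onb n e" "A = spec n e c" "\<And>k. k < n \<Longrightarrow> 0 \<le> c k"
  using spectral_theorem[of A n] assms psd_spec_nonneg by (metis psd_adj psd_carrier)

text \<open>Let v be a unit eigenvector of B - C with eigenvalue d. Equal squares give |Bv| = |Cv|;
  inserting Bv = Cv + dv yields d (2 <v,Cv> + d) = 0. If d is not 0, then <v,Bv> + <v,Cv> = 0 with
  both terms nonnegative, so both vanish and d = 0 after all.\<close>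

lemma psd_sqrt_unique:
  assumes B: "psd n B" and C: "psd n C" and eq: "B * B = C * C"
  shows "B = C"
proof -
  have c: "B \<in> carrier_mat n n" "C \<in> carrier_mat n n" "B - C \<in> carrier_mat n n" using psd_carrier[OF B] psd_carrier[OF C] by (auto simp: minus_carrier_mat)
  have "adj (B - C) = B - C"
  proof (rule eq_matI)
    fix i j assume "i < dim_row (B - C)" "j < dim_col (B - C)"
    then have ij: "i < n" "j < n" using c by auto
    then show "adj (B - C) $$ (i, j) = (B - C) $$ (i, j)"
      using c(1,2) adj_index[of i B j] adj_index[of i C j] psd_adj[OF B] psd_adj[OF C]
        adj_index[of i "B - C" j] by simp
  qed (use c in auto)
  then obtain e d where e: "onb n e" and D: "B - C = spec n e d" using spectral_theorem[OF c(3)] by auto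
  have "d k = 0" if k: "k < n" for k
  proof -
    let ?v = "e k"
    have v: "?v \<in> carrier_vec n" using e k by (auto simp: onb_def)
    have sq: "nrm2 (M *\<^sub>v ?v) = Re (cinner ?v (M * M *\<^sub>v ?v))" if "psd n M" for M
      using v cinner_herm[OF psd_carrier[OF that] psd_adj[OF that] v, of "M *\<^sub>v ?v"] psd_dim[OF that]
      by (simp add: mat_mult_vec_assoc cinner_self)
    have BC: "B *\<^sub>v ?v - C *\<^sub>v ?v = of_real (d k) \<cdot>\<^sub>v ?v"
      using spec_apply[OF e k, of d] c v minus_mult_distrib_mat_vec[of B n n C ?v] unfolding D[symmetric] by simp
    have BC1: "C *\<^sub>v ?v = B *\<^sub>v ?v - of_real (d k) \<cdot>\<^sub>v ?v"
      by (rule eq_vecI) (use BC[symmetric] c v in \<open>auto\<close>)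
    have BC2: "B *\<^sub>v ?v = C *\<^sub>v ?v + of_real (d k) \<cdot>\<^sub>v ?v"
      by (rule eq_vecI) (use BC[symmetric] c v in \<open>auto\<close>)
    have n1: "cinner ?v ?v = 1" using onb_cinner[OF e k k] by simp
    define b where "b = cinner ?v (B *\<^sub>v ?v)"
    define c' where "c' = cinner ?v (C *\<^sub>v ?v)"
    have b': "cinner (B *\<^sub>v ?v) ?v = b" and c'': "cinner (C *\<^sub>v ?v) ?v = c'"
      using cinner_herm[of _ n ?v ?v] B C v by (auto simp: b_def c'_def)
    have bc: "b = c' + d k"
      unfolding b_def BC2 c'_def using c v by (simp add: cinner_add_right cinner_smult_right n1)
    have "cinner (B *\<^sub>v ?v) (B *\<^sub>v ?v) = cinner (C *\<^sub>v ?v) (C *\<^sub>v ?v)"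
      unfolding cinner_self using sq[OF B] sq[OF C] eq by simp
    also have "cinner (B *\<^sub>v ?v) (B *\<^sub>v ?v) = cinner (C *\<^sub>v ?v) (C *\<^sub>v ?v) + 2 * of_real (d k) * c' + of_real (d k) * of_real (d k)"
      unfolding BC2 using c v by (simp add: cinner_add_right cinner_add_left cinner_smult_left cinner_smult_right n1 c'' algebra_simps flip: c'_def)
    finally have "of_real (d k) * (2 * c' + of_real (d k)) = 0" by (simp add: algebra_simps)
    then have "d k = 0 \<or> 2 * c' + of_real (d k) = 0" by (metis mult_eq_0_iff of_real_eq_0_iff)
    then have "d k = 0 \<or> 2 * Re c' + d k = 0" by (auto dest: arg_cong[where f = Re])
    moreover have "0 \<le> Re b" "0 \<le> Re c'" using psd_quad[OF B v] psd_quad[OF C v] by (auto simp: b_def c'_def)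
    ultimately show "d k = 0" using bc by auto
  qed
  then have "B - C = spec n e (\<lambda>_. 0)" unfolding D by (intro spec_cong) auto
  then have z: "(B - C) $$ (i, j) = 0" if "i < n" "j < n" for i j using that by (simp add: spec_def)
  show ?thesis
  proof (rule eq_matI)
    fix i j assume "i < dim_row C" "j < dim_col C"
    then show "B $$ (i, j) = C $$ (i, j)" using z[of i j] c by auto
  qed (use c in auto)
qed

text \<open>\<open>msqrt\<close> is a definite description, so every root is computed by exhibiting
  a positive matrix with the right square.\<close>

lemma msqrt_unique:
  assumes "psd n B" "B * B = A"
  shows "msqrt A = B"
  unfolding msqrt_def
proof (rule the_equality)
  have n: "dim_row A = n" using assms by (auto simp: psd_dim)
  show "psd (dim_row A) B \<and> B * B = A" using assms n by simp
  fix C assume "psd (dim_row A) C \<and> C * C = A"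
  then show "C = B" using psd_sqrt_unique[of n C B] assms n by simp
qed

lemma msqrt_spec:
  assumes "onb n e" "\<And>k. k < n \<Longrightarrow> 0 \<le> c k"
  shows "msqrt (spec n e c) = spec n e (\<lambda>k. sqrt (c k))"
  by (rule msqrt_unique[of n]) (use assms in \<open>auto simp: spec_mult intro!: psd_spec spec_cong\<close>)

lemma
  assumes "psd n A"
  shows psd_msqrt [simp]: "psd n (msqrt A)" and msqrt_sq [simp]: "msqrt A * msqrt A = A"
proof -
  obtain e c where e: "onb n e" "A = spec n e c" "\<And>k. k < n \<Longrightarrow> 0 \<le> c k" using psd_spectral[OF assms] by blast
  then have m: "msqrt A = spec n e (\<lambda>k. sqrt (c k))" by (simp add: msqrt_spec)
  show "psd n (msqrt A)" unfolding m using e by (intro psd_spec) auto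
  show "msqrt A * msqrt A = A" unfolding m spec_mult[OF e(1)] using e by (auto intro!: spec_cong)
qed

section \<open>Fidelity and affinity\<close>

lemma sum_lessThan_add:
  fixes f :: "nat \<Rightarrow> 'a::comm_monoid_add"
  shows "sum f {..<n + m} = sum f {..<n} + (\<Sum>i<m. f (n + i))"
  by (induction m) (auto simp: add.assoc)

lemma cinner_append:
  assumes "dim_vec x = dim_vec x'" "dim_vec y = dim_vec y'"
  shows "cinner (x @\<^sub>v y) (x' @\<^sub>v y') = cinner x x' + cinner y y'"
  using assms by (simp add: cinner_def sum_lessThan_add)

lemma four_block_form:
  assumes "A \<in> carrier_mat n n" "B \<in> carrier_mat n n" "C \<in> carrier_mat n n" "D \<in> carrier_mat n n"
    "x \<in> carrier_vec n" "y \<in> carrier_vec n" "x' \<in> carrier_vec n" "y' \<in> carrier_vec n"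
  shows "cinner (x @\<^sub>v y) (four_block_mat A B C D *\<^sub>v (x' @\<^sub>v y')) =
    cinner x (A *\<^sub>v x') + cinner x (B *\<^sub>v y') + cinner y (C *\<^sub>v x') + cinner y (D *\<^sub>v y')"
  using assms
  by (subst four_block_mat_mult_vec[of _ n n _ n _ n]) (auto simp: cinner_append cinner_add_right)

lemma psd_sqrt_form:
  assumes "psd n P" "u \<in> carrier_vec n" "v \<in> carrier_vec n"
  shows "cinner u (P *\<^sub>v v) = cinner (msqrt P *\<^sub>v u) (msqrt P *\<^sub>v v)"
proof -
  have "cinner (msqrt P *\<^sub>v u) (msqrt P *\<^sub>v v) = cinner u (adj (msqrt P) * msqrt P *\<^sub>v v)"
    by (rule cinner_gram[symmetric]) (use assms psd_dim[OF psd_msqrt[OF assms(1)]] in auto)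
  then show ?thesis using psd_adj[OF psd_msqrt[OF assms(1)]] assms by simp
qed

lemma psd_sqrt_quad:
  assumes "psd n P" "u \<in> carrier_vec n"
  shows "Re (cinner u (P *\<^sub>v u)) = nrm2 (msqrt P *\<^sub>v u)"
  using psd_sqrt_form[OF assms(1,2,2)] by (simp add: cinner_self)

lemma psd_cauchy_schwarz:
  assumes "psd n P" "u \<in> carrier_vec n" "v \<in> carrier_vec n"
  shows "(cmod (cinner u (P *\<^sub>v v)))\<^sup>2 \<le> Re (cinner u (P *\<^sub>v u)) * Re (cinner v (P *\<^sub>v v))"
  unfolding psd_sqrt_form[OF assms] psd_sqrt_quad[OF assms(1,2)] psd_sqrt_quad[OF assms(1,3)]
  by (rule cauchy_schwarz) (use psd_dim[OF psd_msqrt[OF assms(1)]] in auto)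

text \<open>Fidelity and affinity are both of the form \<open>Re (Tr Y)\<close> for some coupling \<open>Y\<close> of \<open>\<rho>\<close> and
  \<open>\<sigma>\<close>, and fidelity is the maximum over all couplings.\<close>

definition couples :: "nat \<Rightarrow> complex mat \<Rightarrow> complex mat \<Rightarrow> complex mat \<Rightarrow> bool" where
  "couples n \<rho> Y \<sigma> \<longleftrightarrow> \<rho> \<in> carrier_mat n n \<and> Y \<in> carrier_mat n n \<and> \<sigma> \<in> carrier_mat n n \<and>
     psd (n + n) (four_block_mat \<rho> Y (adj Y) \<sigma>)"

text \<open>The criterion is the quadratic form of the block matrix at (x, y). Its off-diagonal
  blocks contribute two conjugate numbers, whence the factor 2.\<close>

lemma couplesI:
  assumes "psd n \<rho>" "psd n \<sigma>" "Y \<in> carrier_mat n n"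
    "\<And>x y. x \<in> carrier_vec n \<Longrightarrow> y \<in> carrier_vec n \<Longrightarrow>
      0 \<le> Re (cinner x (\<rho> *\<^sub>v x)) + 2 * Re (cinner x (Y *\<^sub>v y)) + Re (cinner y (\<sigma> *\<^sub>v y))"
  shows "couples n \<rho> Y \<sigma>"
proof -
  let ?P = "four_block_mat \<rho> Y (adj Y) \<sigma>"
  note d = psd_dim[OF assms(1)] psd_dim[OF assms(2)]
  have "psd (n + n) ?P"
  proof (rule psdI_herm)
    show "adj ?P = ?P"
    proof (rule eq_matI)
      fix i j assume "i < dim_row ?P" "j < dim_col ?P"
      then have ij: "i < n + n" "j < n + n" using d by auto
      then show "adj ?P $$ (i, j) = ?P $$ (i, j)"
        using d assms(3) adj_index[of i \<rho> j] adj_index[of "i - n" \<sigma> "j - n"]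
          psd_adj[OF assms(1)] psd_adj[OF assms(2)] by auto
    qed (use d assms(3) in auto)
    fix v :: "complex vec" assume v: "v \<in> carrier_vec (n + n)"
    define x y where "x = vec_first v n" and "y = vec_last v n"
    have xy: "x \<in> carrier_vec n" "y \<in> carrier_vec n" "v = x @\<^sub>v y"
      using v by (auto simp: x_def y_def)
    have "Re (cinner y (adj Y *\<^sub>v x)) = Re (cinner x (Y *\<^sub>v y))"
      using cinner_adj[of y "adj Y" x] cinner_cnj[of "Y *\<^sub>v y" x, symmetric] xy assms(3) by simp
    then show "0 \<le> Re (cinner v (?P *\<^sub>v v))"
      using assms(4)[OF xy(1,2)] xy assms(1-3) by (simp add: four_block_form[of _ n])
  qed (use assms d in auto)
  then show ?thesis using assms by (simp add: couples_def)
qed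

lemma couplesD:
  assumes "couples n \<rho> Y \<sigma>"
  shows "\<rho> \<in> carrier_mat n n" "\<sigma> \<in> carrier_mat n n" "Y \<in> carrier_mat n n" "psd (n + n) (four_block_mat \<rho> Y (adj Y) \<sigma>)"
  using assms by (auto simp: couples_def)

text \<open>Cauchy-Schwarz for the positive block matrix at the vectors (x, 0) and (0, y).\<close>

lemma couples_form:
  assumes "couples n \<rho> Y \<sigma>" "x \<in> carrier_vec n" "y \<in> carrier_vec n"
  shows "(cmod (cinner x (Y *\<^sub>v y)))\<^sup>2 \<le> Re (cinner x (\<rho> *\<^sub>v x)) * Re (cinner y (\<sigma> *\<^sub>v y))"
proof -
  note c = couplesD[OF assms(1)]
  show ?thesis
    using psd_cauchy_schwarz[OF c(4), of "x @\<^sub>v 0\<^sub>v n" "0\<^sub>v n @\<^sub>v y"] assms c(1-3)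
    by (simp add: four_block_form[of _ n] mat_vec_zero)
qed

lemma density_psd [simp]: "density n \<rho> \<Longrightarrow> psd n \<rho>"
  by (simp add: density_def)

lemma psd_diag_nonneg: "psd n A \<Longrightarrow> i < n \<Longrightarrow> 0 \<le> Re (A $$ (i, i))"
  using psd_quad[of n A "unit_vec n i"] by (simp add: cinner_unit_mat)

lemma psd_diag_le_trace:
  assumes "psd n A" "i < n"
  shows "Re (A $$ (i, i)) \<le> Re (mtrace A)"
proof -
  have "Re (A $$ (i, i)) \<le> (\<Sum>k<n. Re (A $$ (k, k)))"
    by (rule member_le_sum) (use assms psd_diag_nonneg in auto)
  then show ?thesis using psd_dim[OF assms(1)] by (simp add: mtrace_def)
qed

text \<open>At the vectors (e_b, -e_b) the block form takes values \<open>q b\<close> \<ge> 0 with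
  total 2 - 2 Re Tr Y. Pairing such a vector with (e_a, 0) or (0, e_b) by Cauchy-Schwarz reads off
  entries of \<rho> - Y and of Y* - \<sigma>. The outer factor 2 comes from passing from \<rho> to
  \<sigma> through Y.\<close>

lemma couples_close:
  assumes c: "couples n \<rho> Y \<sigma>" and d: "density n \<rho>" "density n \<sigma>"
  shows "Re (mtrace Y) \<le> 1"
    and "\<And>a b. a < n \<Longrightarrow> b < n \<Longrightarrow> cmod (\<rho> $$ (a, b) - \<sigma> $$ (a, b)) \<le> 2 * sqrt (2 - 2 * Re (mtrace Y))"
proof -
  note cc = couplesD[OF c]
  let ?P = "four_block_mat \<rho> Y (adj Y) \<sigma>"
  let ?e = "\<lambda>i. unit_vec n i :: complex vec"
  define q where "q b = Re (\<rho> $$ (b, b)) - 2 * Re (Y $$ (b, b)) + Re (\<sigma> $$ (b, b))" for b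
  have q: "Re (cinner (?e b @\<^sub>v - ?e b) (?P *\<^sub>v (?e b @\<^sub>v - ?e b))) = q b" if "b < n" for b
    using that cc by (simp add: four_block_form[of _ n] mat_vec_uminus cinner_uminus_left cinner_uminus_right cinner_unit_mat q_def)
  have q0: "0 \<le> q b" if "b < n" for b
    using psd_quad[OF cc(4), of "?e b @\<^sub>v - ?e b"] q[OF that] by simp
  have tr: "(\<Sum>b<n. q b) = 2 - 2 * Re (mtrace Y)"
  proof -
    have "Re (mtrace \<rho>) = 1" "Re (mtrace \<sigma>) = 1" using d by (auto simp: density_def)
    then show ?thesis using cc by (simp add: q_def sum.distrib sum_subtractf mtrace_def sum_distrib_left)
  qed
  show "Re (mtrace Y) \<le> 1" using sum_nonneg[of "{..<n}" q] q0 tr by simp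
  have qle: "q b \<le> 2 - 2 * Re (mtrace Y)" if "b < n" for b
    unfolding tr[symmetric] using that q0 by (intro member_le_sum) auto
  fix a b assume ab: "a < n" "b < n"
  have d1: "Re (M $$ (i, i)) \<le> 1" "0 \<le> Re (M $$ (i, i))" if "density n M" "i < n" for M i
    using psd_diag_le_trace[of n M i] psd_diag_nonneg[of n M i] that by (auto simp: density_def)
  have "(cmod (\<rho> $$ (a, b) - Y $$ (a, b)))\<^sup>2 \<le> Re (\<rho> $$ (a, a)) * q b"
    using psd_cauchy_schwarz[OF cc(4), of "?e a @\<^sub>v 0\<^sub>v n" "?e b @\<^sub>v - ?e b"] ab cc(1-3)
      q[OF ab(2)]
    by (simp add: four_block_form[of _ n] mat_vec_uminus cinner_uminus_right mat_vec_zero cinner_unit_mat)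
  also have "\<dots> \<le> 1 * (2 - 2 * Re (mtrace Y))"
    using d1[OF d(1) ab(1)] qle[OF ab(2)] q0[OF ab(2)] by (intro mult_mono) auto
  finally have 1: "cmod (\<rho> $$ (a, b) - Y $$ (a, b)) \<le> sqrt (2 - 2 * Re (mtrace Y))"
    by (intro real_le_rsqrt) simp
  have "(cmod (adj Y $$ (b, a) - \<sigma> $$ (b, a)))\<^sup>2 \<le> Re (\<sigma> $$ (b, b)) * q a"
    using psd_cauchy_schwarz[OF cc(4), of "0\<^sub>v n @\<^sub>v ?e b" "?e a @\<^sub>v - ?e a"] ab cc(1-3)
      q[OF ab(1)]
    by (simp add: four_block_form[of _ n] mat_vec_uminus cinner_uminus_right mat_vec_zero cinner_unit_mat del: adj_index)
  also have "\<dots> \<le> 1 * (2 - 2 * Re (mtrace Y))"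
    using d1[OF d(2) ab(2)] qle[OF ab(1)] q0[OF ab(1)] by (intro mult_mono) auto
  finally have 2: "cmod (adj Y $$ (b, a) - \<sigma> $$ (b, a)) \<le> sqrt (2 - 2 * Re (mtrace Y))"
    by (intro real_le_rsqrt) simp
  have "\<sigma> $$ (b, a) = cnj (\<sigma> $$ (a, b))"
    using psd_adj[OF density_psd[OF d(2)]] psd_dim[OF density_psd[OF d(2)]] ab adj_index[of b \<sigma> a] by simp
  then have "adj Y $$ (b, a) - \<sigma> $$ (b, a) = cnj (Y $$ (a, b) - \<sigma> $$ (a, b))"
    using ab cc by simp
  then have 2: "cmod (Y $$ (a, b) - \<sigma> $$ (a, b)) \<le> sqrt (2 - 2 * Re (mtrace Y))"
    using 2 by (metis complex_mod_cnj)
  have "cmod (\<rho> $$ (a, b) - \<sigma> $$ (a, b)) \<le> cmod (\<rho> $$ (a, b) - Y $$ (a, b)) + cmod (Y $$ (a, b) - \<sigma> $$ (a, b))"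
    using norm_triangle_ineq[of "\<rho> $$ (a, b) - Y $$ (a, b)" "Y $$ (a, b) - \<sigma> $$ (a, b)"] by simp
  then show "cmod (\<rho> $$ (a, b) - \<sigma> $$ (a, b)) \<le> 2 * sqrt (2 - 2 * Re (mtrace Y))"
    using 1 2 by linarith
qed

lemma spec_nrm2_le:
  assumes "onb n e" "y \<in> carrier_vec n" "\<And>k. k < n \<Longrightarrow> c k \<le> 1"
  shows "Re (cinner y (spec n e c *\<^sub>v y)) \<le> nrm2 y"
  unfolding spec_quad[OF assms(2,1)] parseval[OF assms(2,1), symmetric]
  using mult_right_mono[OF assms(3)] by (auto intro!: sum_mono simp del: of_real_sum)

text \<open>With R and S the roots of \<rho> and \<sigma>, S \<rho> S is the Gram matrix of R S. The
  \<open>t k\<close> are thus the singular values of R S, and the fidelity is its trace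
  norm.\<close>

lemma fidelity_spectral:
  assumes "psd n \<rho>" "psd n \<sigma>"
  obtains e t where "onb n e" "\<And>k. k < n \<Longrightarrow> 0 \<le> t k" "fidelity \<rho> \<sigma> = (\<Sum>k<n. t k)"
    "msqrt \<sigma> * \<rho> * msqrt \<sigma> = spec n e (\<lambda>k. t k * t k)"
proof -
  define R S where RS: "R = msqrt \<rho>" "S = msqrt \<sigma>"
  have R: "psd n R" "R * R = \<rho>" and S: "psd n S" using assms by (auto simp: RS)
  have "adj (R * S) * (R * S) = S * \<rho> * S"
    using R S psd_dim[OF R(1)] psd_dim[OF S] by (simp add: adj_mult psd_adj[OF R(1)] psd_adj[OF S] mat_mult_assoc R(2)[symmetric])
  then have H: "psd n (S * \<rho> * S)"
    using psd_gram[of "R * S" n n] R S by (metis mult_carrier_mat psd_carrier)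
  obtain e t where e: "onb n e" "msqrt (S * \<rho> * S) = spec n e t" "\<And>k. k < n \<Longrightarrow> 0 \<le> t k"
    using psd_spectral[OF psd_msqrt[OF H]] by blast
  show ?thesis
  proof
    show "msqrt \<sigma> * \<rho> * msqrt \<sigma> = spec n e (\<lambda>k. t k * t k)"
      using msqrt_sq[OF H] e spec_mult[OF e(1)] by (simp add: RS)
    show "fidelity \<rho> \<sigma> = (\<Sum>k<n. t k)"
      using e by (simp add: fidelity_def RS spec_trace)
  qed (use e in auto)
qed

lemma fidelity_nonneg:
  assumes "psd n \<rho>" "psd n \<sigma>"
  shows "0 \<le> fidelity \<rho> \<sigma>"
  by (rule fidelity_spectral[OF assms]) (auto intro!: sum_nonneg)

text \<open>Polar decomposition R S = V |R S| supplies the optimal coupling Y = R V S: V is a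
  contraction, which makes Y a coupling, and cyclicity gives Tr Y = Tr (S R V) = Tr |R S|.\<close>

lemma fidelity_attained:
  assumes "psd n \<rho>" "psd n \<sigma>"
  obtains Y where "couples n \<rho> Y \<sigma>" "Re (mtrace Y) = fidelity \<rho> \<sigma>"
proof -
  define R S where RS: "R = msqrt \<rho>" "S = msqrt \<sigma>"
  have R: "psd n R" "R * R = \<rho>" and S: "psd n S" "S * S = \<sigma>" using assms by (auto simp: RS)
  note d = psd_dim[OF R(1)] psd_dim[OF S(1)] psd_dim[OF assms(1)] psd_dim[OF assms(2)]
  obtain e t where e: "onb n e" "\<And>k. k < n \<Longrightarrow> 0 \<le> t k" "fidelity \<rho> \<sigma> = (\<Sum>k<n. t k)"
    and H: "S * \<rho> * S = spec n e (\<lambda>k. t k * t k)"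
    using fidelity_spectral[OF assms] unfolding RS by blast
  \<comment> \<open>Pseudo-inverse of |R S|; since 1 / 0 = 0, the resulting V is a partial isometry
    vanishing on the kernel of R S.\<close>
  define E where "E = spec n e (\<lambda>k. 1 / t k)"
  define V where "V = R * S * E"
  define Y where "Y = R * V * S"
  have dE: "dim_row E = n" "dim_col E = n" "adj E = E" by (auto simp: E_def)
  have cV: "V \<in> carrier_mat n n" and cY: "Y \<in> carrier_mat n n" using d dE by (auto simp: V_def Y_def)
  have HRS: "S * \<rho> * S = S * R * (R * S)" using d by (simp add: R(2)[symmetric] mat_mult_assoc)
  have "adj V * V = E * (S * \<rho> * S) * E"
    using d dE R(1) S(1) by (simp add: V_def adj_mult psd_adj[of n R] psd_adj[of n S] mat_mult_assoc HRS)
  also have "\<dots> = spec n e (\<lambda>k. if t k = 0 then 0 else 1)"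
    unfolding H E_def spec_mult[OF e(1)] by (rule spec_cong) auto
  finally have VV: "adj V * V = spec n e (\<lambda>k. if t k = 0 then 0 else 1)" .
  have contr: "nrm2 (V *\<^sub>v y) \<le> nrm2 y" if y: "y \<in> carrier_vec n" for y
  proof -
    have "nrm2 (V *\<^sub>v y) = Re (cinner y (adj V * V *\<^sub>v y))"
      using cV y by (subst cinner_gram) (auto simp: cinner_self)
    also have "\<dots> \<le> nrm2 y" unfolding VV by (rule spec_nrm2_le) (use e y in auto)
    finally show ?thesis .
  qed
  have "couples n \<rho> Y \<sigma>"
  proof (rule couplesI[OF assms cY])
    fix x y :: "complex vec" assume xy: "x \<in> carrier_vec n" "y \<in> carrier_vec n"
    have Sy: "S *\<^sub>v y \<in> carrier_vec n" using d by (auto simp: carrier_vecI)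
    have "cinner x (Y *\<^sub>v y) = cinner (R *\<^sub>v x) (V *\<^sub>v (S *\<^sub>v y))"
      using xy d cV cinner_herm[of R n x "V *\<^sub>v (S *\<^sub>v y)"] R(1) by (simp add: Y_def mat_mult_vec_assoc psd_adj[of n R])
    moreover have "Re (cinner (- (R *\<^sub>v x)) (V *\<^sub>v (S *\<^sub>v y))) \<le> sqrt (nrm2 (- (R *\<^sub>v x))) * sqrt (nrm2 (V *\<^sub>v (S *\<^sub>v y)))"
      using d cV by (intro Re_cinner_le) auto
    moreover have "cinner (- (R *\<^sub>v x)) (V *\<^sub>v (S *\<^sub>v y)) = - cinner (R *\<^sub>v x) (V *\<^sub>v (S *\<^sub>v y))"
      using d cV by (intro cinner_uminus_left) simp
    moreover have "nrm2 (- (R *\<^sub>v x)) = nrm2 (R *\<^sub>v x)" by (simp add: nrm2_def del: index_mult_mat_vec)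
    moreover have "sqrt (nrm2 (R *\<^sub>v x)) * sqrt (nrm2 (V *\<^sub>v (S *\<^sub>v y))) \<le> sqrt (nrm2 (R *\<^sub>v x)) * sqrt (nrm2 (S *\<^sub>v y))"
      by (intro mult_left_mono real_sqrt_le_mono contr Sy) auto
    ultimately have "- Re (cinner x (Y *\<^sub>v y)) \<le> sqrt (nrm2 (R *\<^sub>v x)) * sqrt (nrm2 (S *\<^sub>v y))"
      by simp
    moreover have "2 * (sqrt (nrm2 (R *\<^sub>v x)) * sqrt (nrm2 (S *\<^sub>v y))) \<le> nrm2 (R *\<^sub>v x) + nrm2 (S *\<^sub>v y)"
      using sum_squares_bound[of "sqrt (nrm2 (R *\<^sub>v x))" "sqrt (nrm2 (S *\<^sub>v y))"] by (simp add: mult.assoc)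
    ultimately show "0 \<le> Re (cinner x (\<rho> *\<^sub>v x)) + 2 * Re (cinner x (Y *\<^sub>v y)) + Re (cinner y (\<sigma> *\<^sub>v y))"
      unfolding psd_sqrt_quad[OF assms(1) xy(1)] psd_sqrt_quad[OF assms(2) xy(2)] RS by linarith
  qed
  moreover have "Re (mtrace Y) = fidelity \<rho> \<sigma>"
  proof -
    have "mtrace Y = mtrace (S * (R * V))" unfolding Y_def using d cV by (intro mtrace_comm) auto
    also have "S * (R * V) = (S * \<rho> * S) * E" using d dE by (simp add: V_def HRS mat_mult_assoc)
    also have "\<dots> = spec n e t" unfolding H E_def spec_mult[OF e(1)] by (rule spec_cong) auto
    finally show ?thesis using e by (simp add: spec_trace)
  qed
  ultimately show ?thesis using that by blast
qed

text \<open>With G the pseudo-inverse of S, Tr Y = Tr (Y G S) = Tr (S Y G). In the eigenbasis e_k of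
  S \<rho> S the coupling inequality at S e_k and G e_k bounds each diagonal term: the \<rho>-form
  is t_k squared and the \<sigma>-form is at most 1.\<close>

lemma fidelity_upper:
  assumes c: "couples n \<rho> Y \<sigma>" and p: "psd n \<rho>" "psd n \<sigma>"
  shows "Re (mtrace Y) \<le> fidelity \<rho> \<sigma>"
proof -
  note cc = couplesD[OF c]
  define S where "S = msqrt \<sigma>"
  have S: "psd n S" "S * S = \<sigma>" using p by (auto simp: S_def)
  note d = psd_dim[OF S(1)] psd_dim[OF p(1)] psd_dim[OF p(2)]
  obtain f s where f: "onb n f" "S = spec n f s" "\<And>k. k < n \<Longrightarrow> 0 \<le> s k"
    using psd_spectral[OF S(1)] by blast
  obtain e t where e: "onb n e" "\<And>k. k < n \<Longrightarrow> 0 \<le> t k" "fidelity \<rho> \<sigma> = (\<Sum>k<n. t k)"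
    and H: "S * \<rho> * S = spec n e (\<lambda>k. t k * t k)"
    using fidelity_spectral[OF p] unfolding S_def by blast
  define G where "G = spec n f (\<lambda>k. 1 / s k)"
  let ?chi = "\<lambda>k. if s k = 0 then 0 else 1 :: real"
  have G: "dim_row G = n" "dim_col G = n" "adj G = G" by (auto simp: G_def)
  have GS: "G * S = spec n f ?chi"
    unfolding G_def f(2) spec_mult[OF f(1)] by (rule spec_cong) auto
  have GsG: "G * \<sigma> * G = spec n f ?chi"
    unfolding S(2)[symmetric] G_def f(2) spec_mult[OF f(1)] by (rule spec_cong) auto
  have ed: "e k \<in> carrier_vec n" if "k < n" for k using e that by (auto simp: onb_def)
  have fd: "f k \<in> carrier_vec n" if "k < n" for k using f that by (auto simp: onb_def)
  have "mtrace Y = (\<Sum>k<n. cinner (f k) (Y *\<^sub>v f k))" by (rule trace_onb[OF cc(3) f(1)])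
  \<comment> \<open>Inserting G S, the projection onto the support of \<sigma>, costs nothing: on a
    kernel vector of \<sigma> the coupling inequality already makes the diagonal entry of Y
    vanish.\<close>
  also have "\<dots> = (\<Sum>k<n. cinner (f k) (Y * (G * S) *\<^sub>v f k))"
  proof (rule sum.cong)
    fix k assume "k \<in> {..<n}"
    then have k: "k < n" by simp
    have "Y * (G * S) *\<^sub>v f k = complex_of_real (?chi k) \<cdot>\<^sub>v (Y *\<^sub>v f k)"
      unfolding GS using cc(3) fd[OF k] k spec_apply[OF f(1) k]
      by (simp add: mat_mult_vec_assoc mult_mat_vec[of _ n n])
    then have 1: "cinner (f k) (Y * (G * S) *\<^sub>v f k) = ?chi k * cinner (f k) (Y *\<^sub>v f k)"
      using cc(3) fd[OF k] by (simp add: cinner_smult_right)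
    show "cinner (f k) (Y *\<^sub>v f k) = cinner (f k) (Y * (G * S) *\<^sub>v f k)"
    proof (cases "s k = 0")
      case True
      have "Re (cinner (f k) (\<sigma> *\<^sub>v f k)) = nrm2 (S *\<^sub>v f k)"
        unfolding S_def by (rule psd_sqrt_quad[OF p(2) fd[OF k]])
      also have "\<dots> = 0" unfolding f(2) spec_apply[OF f(1) k] True by (simp add: nrm2_smult)
      finally have "cinner (f k) (Y *\<^sub>v f k) = 0"
        using couples_form[OF c fd[OF k] fd[OF k]] by simp
      then show ?thesis using 1 by simp
    qed (use 1 in auto)
  qed simp
  also have "\<dots> = mtrace (Y * (G * S))"
    by (rule trace_onb[symmetric, OF _ f(1)]) (use cc d G in auto)
  also have "\<dots> = mtrace (S * (Y * G))"
    using mtrace_comm[of "Y * G" S] cc d G by (simp add: mat_mult_assoc)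
  also have "\<dots> = (\<Sum>k<n. cinner (e k) (S * (Y * G) *\<^sub>v e k))"
    by (rule trace_onb[OF _ e(1)]) (use cc d G in auto)
  finally have "Re (mtrace Y) = (\<Sum>k<n. Re (cinner (e k) (S * (Y * G) *\<^sub>v e k)))" by simp
  also have "\<dots> \<le> (\<Sum>k<n. t k)"
  proof (rule sum_mono)
    fix k assume "k \<in> {..<n}"
    then have k: "k < n" by simp
    note ek = ed[OF k]
    have Sc: "S *\<^sub>v e k \<in> carrier_vec n" "G *\<^sub>v e k \<in> carrier_vec n" using d G by (auto simp: carrier_vecI)
    have eq: "cinner (e k) (S * (Y * G) *\<^sub>v e k) = cinner (S *\<^sub>v e k) (Y *\<^sub>v (G *\<^sub>v e k))"
      using d G cc ek cinner_herm[of S n "e k" "Y *\<^sub>v (G *\<^sub>v e k)"] S(1) by (simp add: mat_mult_vec_assoc psd_adj[of n S])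
    have "cinner (S *\<^sub>v e k) (\<rho> *\<^sub>v (S *\<^sub>v e k)) = cinner (e k) (S * \<rho> * S *\<^sub>v e k)"
      using d ek cinner_herm[of S n "e k" "\<rho> *\<^sub>v (S *\<^sub>v e k)"] S(1) by (simp add: mat_mult_vec_assoc)
    also have "\<dots> = of_real (t k * t k)"
      unfolding H spec_apply[OF e(1) k] using onb_cinner[OF e(1) k k] by (simp add: cinner_smult_right)
    finally have 1: "Re (cinner (S *\<^sub>v e k) (\<rho> *\<^sub>v (S *\<^sub>v e k))) = (t k)\<^sup>2" by (simp add: power2_eq_square)
    have "cinner (G *\<^sub>v e k) (\<sigma> *\<^sub>v (G *\<^sub>v e k)) = cinner (e k) (G * \<sigma> * G *\<^sub>v e k)"
      using d ek cinner_herm[of G n "e k" "\<sigma> *\<^sub>v (G *\<^sub>v e k)"] by (simp add: mat_mult_vec_assoc G_def)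
    also have "Re \<dots> \<le> nrm2 (e k)" unfolding GsG by (rule spec_nrm2_le[OF f(1) ek]) auto
    finally have 2: "Re (cinner (G *\<^sub>v e k) (\<sigma> *\<^sub>v (G *\<^sub>v e k))) \<le> 1" using onb_nrm2[OF e(1) k] by simp
    have "(cmod (cinner (S *\<^sub>v e k) (Y *\<^sub>v (G *\<^sub>v e k))))\<^sup>2 \<le> (t k)\<^sup>2 * 1"
      using couples_form[OF c Sc] unfolding 1 using mult_left_mono[OF 2, of "(t k)\<^sup>2"] by (metis order_trans zero_le_power2)
    then have "cmod (cinner (S *\<^sub>v e k) (Y *\<^sub>v (G *\<^sub>v e k))) \<le> t k" using power2_le_imp_le[OF _ e(2)[OF k]] by simp
    then show "Re (cinner (e k) (S * (Y * G) *\<^sub>v e k)) \<le> t k"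
      unfolding eq using complex_Re_le_cmod order_trans by blast
  qed
  finally show ?thesis using e by simp
qed

lemma fidelity_self:
  assumes "density n \<rho>"
  shows "fidelity \<rho> \<rho> = 1"
proof -
  have p: "psd n \<rho>" using assms by simp
  let ?R = "msqrt \<rho>"
  have "?R * \<rho> * ?R = ?R * (?R * ?R) * ?R" by (simp add: msqrt_sq[OF p])
  also have "\<dots> = (?R * ?R) * (?R * ?R)" using psd_dim[OF psd_msqrt[OF p]] by (simp add: mat_mult_assoc)
  finally have "?R * \<rho> * ?R = \<rho> * \<rho>" by (simp add: msqrt_sq[OF p])
  then have "msqrt (?R * \<rho> * ?R) = \<rho>" using msqrt_unique[OF p] by simp
  then show ?thesis using assms by (simp add: fidelity_def density_def)
qed

lemma affinity_self:
  assumes "density n \<rho>"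
  shows "affinity \<rho> \<rho> = 1"
  using assms by (simp add: affinity_def density_def msqrt_sq[of n])

text \<open>For roots R and S the block form with off-diagonal entry R S is the squared norm of Rx +
  Sy.\<close>

lemma affinity_attained:
  assumes "psd n \<rho>" "psd n \<sigma>"
  shows "couples n \<rho> (msqrt \<rho> * msqrt \<sigma>) \<sigma>"
proof (rule couplesI[OF assms])
  let ?R = "msqrt \<rho>" and ?S = "msqrt \<sigma>"
  note R = psd_msqrt[OF assms(1)] and S = psd_msqrt[OF assms(2)]
  show "?R * ?S \<in> carrier_mat n n" using R S by (metis mult_carrier_mat psd_carrier)
  fix x y :: "complex vec" assume xy: "x \<in> carrier_vec n" "y \<in> carrier_vec n"
  have c: "?R *\<^sub>v x \<in> carrier_vec n" "?S *\<^sub>v y \<in> carrier_vec n"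
    using psd_dim[OF R] psd_dim[OF S] by (auto simp: carrier_vecI)
  have "cinner x (?R * ?S *\<^sub>v y) = cinner (?R *\<^sub>v x) (?S *\<^sub>v y)"
    using xy psd_dim[OF R] psd_dim[OF S] cinner_herm[OF psd_carrier[OF R] psd_adj[OF R] xy(1) c(2)]
    by (simp add: mat_mult_vec_assoc)
  moreover have "cinner (?R *\<^sub>v x + ?S *\<^sub>v y) (?R *\<^sub>v x + ?S *\<^sub>v y) =
     cinner (?R *\<^sub>v x) (?R *\<^sub>v x) + cinner (?S *\<^sub>v y) (?S *\<^sub>v y) + (cinner (?R *\<^sub>v x) (?S *\<^sub>v y) + cnj (cinner (?R *\<^sub>v x) (?S *\<^sub>v y)))"
    using cinner_cnj[of "?R *\<^sub>v x" "?S *\<^sub>v y"] psd_dim[OF R] psd_dim[OF S]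
    by (simp add: cinner_add_left cinner_add_right)
  then have "nrm2 (?R *\<^sub>v x + ?S *\<^sub>v y) = nrm2 (?R *\<^sub>v x) + nrm2 (?S *\<^sub>v y) + 2 * Re (cinner (?R *\<^sub>v x) (?S *\<^sub>v y))"
    unfolding cinner_self complex_add_cnj by (metis of_real_add of_real_eq_iff)
  ultimately show "0 \<le> Re (cinner x (\<rho> *\<^sub>v x)) + 2 * Re (cinner x (?R * ?S *\<^sub>v y)) + Re (cinner y (\<sigma> *\<^sub>v y))"
    unfolding psd_sqrt_quad[OF assms(1) xy(1)] psd_sqrt_quad[OF assms(2) xy(2)]
    using nrm2_ge0[of "?R *\<^sub>v x + ?S *\<^sub>v y"] by simp
qed

text \<open>In an eigenbasis of the second root the trace is a sum of nonnegative eigenvalues times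
  diagonal entries of the first root.\<close>

lemma affinity_nonneg:
  assumes "psd n \<rho>" "psd n \<sigma>"
  shows "0 \<le> affinity \<rho> \<sigma>"
proof -
  note R = psd_msqrt[OF assms(1)] and S = psd_msqrt[OF assms(2)]
  obtain f s where f: "onb n f" "msqrt \<sigma> = spec n f s" "\<And>k. k < n \<Longrightarrow> 0 \<le> s k"
    using psd_spectral[OF S] by blast
  have fd: "f k \<in> carrier_vec n" if "k < n" for k using f that by (auto simp: onb_def)
  have "mtrace (msqrt \<rho> * msqrt \<sigma>) = (\<Sum>k<n. cinner (f k) (msqrt \<rho> * msqrt \<sigma> *\<^sub>v f k))"
    by (rule trace_onb[OF _ f(1)]) (use R S in \<open>metis mult_carrier_mat psd_carrier\<close>)
  also have "\<dots> = (\<Sum>k<n. of_real (s k) * cinner (f k) (msqrt \<rho> *\<^sub>v f k))"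
  proof (rule sum.cong)
    fix k assume "k \<in> {..<n}"
    then have k: "k < n" by simp
    have "msqrt \<rho> * msqrt \<sigma> *\<^sub>v f k = of_real (s k) \<cdot>\<^sub>v (msqrt \<rho> *\<^sub>v f k)"
      unfolding f(2) using psd_dim[OF R] fd[OF k] spec_apply[OF f(1) k] psd_carrier[OF R]
      by (simp add: mat_mult_vec_assoc mult_mat_vec[of _ n n])
    then show "cinner (f k) (msqrt \<rho> * msqrt \<sigma> *\<^sub>v f k) = of_real (s k) * cinner (f k) (msqrt \<rho> *\<^sub>v f k)"
      using psd_dim[OF R] fd[OF k] by (simp add: cinner_smult_right)
  qed simp
  finally show ?thesis
    using f(3) psd_quad[OF R fd] by (auto simp: affinity_def intro!: sum_nonneg mult_nonneg_nonneg)
qed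

section \<open>Data processing for the fidelity\<close>

text \<open>The composite index is i * n + j; this change of index reduces traces, products and
  forms on a tensor product to its factors.\<close>

lemma sum_divmod:
  fixes f :: "nat \<Rightarrow> nat \<Rightarrow> 'a::comm_monoid_add"
  shows "(\<Sum>k<m * n. f (k div n) (k mod n)) = (\<Sum>i<m. \<Sum>j<n. f i j)"
proof (cases "n = 0")
  case False
  have "(\<Sum>k<m * n. f (k div n) (k mod n)) = (\<Sum>i<m. \<Sum>k\<in>{i * n..<i * n + n}. f (k div n) (k mod n))"
    by (rule sum.nat_group[symmetric])
  also have "\<dots> = (\<Sum>i<m. \<Sum>j<n. f i j)"
  proof (rule sum.cong)
    fix i
    have "(\<Sum>k\<in>{i * n..<i * n + n}. f (k div n) (k mod n)) = (\<Sum>j<n. f ((i * n + j) div n) ((i * n + j) mod n))"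
      using sum.shift_bounds_nat_ivl[of "\<lambda>k. f (k div n) (k mod n)" 0 "i * n" n]
      by (simp add: atLeast0LessThan add.commute)
    also have "\<dots> = (\<Sum>j<n. f i j)" by (rule sum.cong) auto
    finally show "(\<Sum>k\<in>{i * n..<i * n + n}. f (k div n) (k mod n)) = (\<Sum>j<n. f i j)" .
  qed simp
  finally show ?thesis .
qed simp

lemma divmod_less: "k < m * n \<Longrightarrow> k div n < m" "k < m * n \<Longrightarrow> k mod n < (n::nat)"
  by (auto simp: less_mult_imp_div_less intro!: mod_less_divisor gr0I)

lemma idx_less: "i < m \<Longrightarrow> j < n \<Longrightarrow> i * n + j < m * (n::nat)"
proof -
  assume "i < m" "j < n"
  then have "i * n + j < Suc i * n" by simp
  also have "\<dots> \<le> m * n" using \<open>i < m\<close> by (intro mult_right_mono) auto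
  finally show ?thesis .
qed

text \<open>A channel is a function that is known to be linear only on matrices of one size.
  Induction over the set of retained entries expands it in matrix units.\<close>

lemma linear_expand:
  fixes g :: "complex mat \<Rightarrow> complex"
  assumes add: "\<And>A B. A \<in> carrier_mat m n \<Longrightarrow> B \<in> carrier_mat m n \<Longrightarrow> g (A + B) = g A + g B"
    and smult: "\<And>c A. A \<in> carrier_mat m n \<Longrightarrow> g (c \<cdot>\<^sub>m A) = c * g A"
    and B: "B \<in> carrier_mat m n"
  shows "g B = (\<Sum>i<m. \<Sum>j<n. B $$ (i, j) * g (mat m n (\<lambda>p. if p = (i, j) then 1 else 0)))"
proof -
  let ?E = "\<lambda>q. mat m n (\<lambda>p. if p = q then 1 else 0) :: complex mat"
  have "g (mat m n (\<lambda>p. if p \<in> S then B $$ p else 0)) = (\<Sum>p\<in>S. B $$ p * g (?E p))" if "finite S" for S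
    using that
  proof (induction S)
    case empty
    have "mat m n (\<lambda>p. 0) = (0::complex) \<cdot>\<^sub>m B" using B by (intro eq_matI) auto
    then show ?case using smult[OF B, of 0] by simp
  next
    case (insert q S)
    have "mat m n (\<lambda>p. if p \<in> insert q S then B $$ p else 0) =
      B $$ q \<cdot>\<^sub>m ?E q + mat m n (\<lambda>p. if p \<in> S then B $$ p else 0)"
      using insert by (intro eq_matI) auto
    then show ?case using insert by (simp add: add smult)
  qed
  from this[of "{..<m} \<times> {..<n}"]
  have "g (mat m n (\<lambda>p. if p \<in> {..<m} \<times> {..<n} then B $$ p else 0)) = (\<Sum>i<m. \<Sum>j<n. B $$ (i, j) * g (?E (i, j)))"
    by (simp add: sum.cartesian_product)
  moreover have "mat m n (\<lambda>p. if p \<in> {..<m} \<times> {..<n} then B $$ p else 0) = B"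
    using B by (intro eq_matI) auto
  ultimately show ?thesis by simp
qed

lemma psd_conj:
  assumes P: "psd n P" and V: "V \<in> carrier_mat m n"
  shows "psd m (V * P * adj V)"
  unfolding psd_def
proof (intro conjI ballI)
  note d = psd_dim[OF P] carrier_matD[OF V]
  fix v :: "complex vec" assume v: "v \<in> carrier_vec m"
  have "cinner v (V * P * adj V *\<^sub>v v) = cinner (adj V *\<^sub>v v) (P *\<^sub>v (adj V *\<^sub>v v))"
    using v d cinner_adj[of v V "P *\<^sub>v (adj V *\<^sub>v v)"] by (simp add: mat_mult_vec_assoc)
  then show "cinner v (V * P * adj V *\<^sub>v v) \<in> \<real>" "0 \<le> Re (cinner v (V * P * adj V *\<^sub>v v))"
    using P d by (auto simp: psd_def)
qed (use psd_dim[OF P] V in auto)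

lemma couples_psd:
  assumes "couples n \<rho> Y \<sigma>"
  shows "psd n \<rho>" "psd n \<sigma>"
proof -
  note c = couplesD[OF assms]
  let ?P = "four_block_mat \<rho> Y (adj Y) \<sigma>"
  have 1: "cinner (v @\<^sub>v 0\<^sub>v n) (?P *\<^sub>v (v @\<^sub>v 0\<^sub>v n)) = cinner v (\<rho> *\<^sub>v v)"
    and 2: "cinner (0\<^sub>v n @\<^sub>v v) (?P *\<^sub>v (0\<^sub>v n @\<^sub>v v)) = cinner v (\<sigma> *\<^sub>v v)" if "v \<in> carrier_vec n" for v
    using that c(1-3) by (simp_all add: four_block_form[of _ n] mat_vec_zero)
  have m: "v @\<^sub>v 0\<^sub>v n \<in> carrier_vec (n + n)" "0\<^sub>v n @\<^sub>v v \<in> carrier_vec (n + n)" if "v \<in> carrier_vec n" for v :: "complex vec"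
    using that by auto
  show "psd n \<rho>" "psd n \<sigma>"
    using c(1,2) c(4)[unfolded psd_def] m 1[symmetric] 2[symmetric]
    unfolding psd_def by (metis (no_types, lifting))+
qed

lemma trace_triple:
  assumes "A \<in> carrier_mat n n" "U \<in> carrier_mat n n" "W \<in> carrier_mat n n"
  shows "mtrace (adj U * A * W) = (\<Sum>l<n. cinner (col U l) (A *\<^sub>v col W l))"
proof -
  have "(adj U * A * W) $$ (l, l) = cinner (col U l) (A *\<^sub>v col W l)" if l: "l < n" for l
  proof -
    have "(adj U * A * W) $$ (l, l) = cinner (unit_vec n l) (adj U * A * W *\<^sub>v unit_vec n l)"
      using assms l by (subst cinner_unit_mat) auto
    also have "\<dots> = cinner (col U l) (A *\<^sub>v col W l)"
      using assms l cinner_adj[of "unit_vec n l" "adj U" "A *\<^sub>v (W *\<^sub>v unit_vec n l)"]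
      by (simp add: mat_mult_vec_assoc mat_vec_unit[OF assms(3) l] mat_vec_unit[OF assms(2) l])
    finally show ?thesis .
  qed
  then show ?thesis using assms by (simp add: mtrace_def del: index_mult_mat(1))
qed

text \<open>Positivity at (x, -y) bounds twice the cross term by the two diagonal terms; summing
  over the columns x of U and y of W gives traces.\<close>

lemma couples_trace:
  assumes "couples n A B D" "U \<in> carrier_mat n n" "W \<in> carrier_mat n n"
  shows "2 * Re (mtrace (adj U * B * W)) \<le> Re (mtrace (adj U * A * U)) + Re (mtrace (adj W * D * W))"
proof -
  note c = couplesD[OF assms(1)]
  have "2 * Re (cinner x (B *\<^sub>v y)) \<le> Re (cinner x (A *\<^sub>v x)) + Re (cinner y (D *\<^sub>v y))"
    if xy: "x \<in> carrier_vec n" "y \<in> carrier_vec n" for x y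
  proof -
    have 1: "Re (cinner y (adj B *\<^sub>v x)) = Re (cinner x (B *\<^sub>v y))"
      using cinner_adj[of y "adj B" x] cinner_cnj[of "B *\<^sub>v y" x, symmetric] xy c(3) by simp
    show ?thesis
      using psd_quad[OF c(4), of "x @\<^sub>v - y"] xy c(1-3) 1
      by (simp add: four_block_form[of _ n] mat_vec_uminus cinner_uminus_left cinner_uminus_right)
  qed
  then show ?thesis
    unfolding trace_triple[OF c(1) assms(2,2)] trace_triple[OF c(2) assms(3,3)] trace_triple[OF c(3) assms(2,3)]
    unfolding Re_sum sum_distrib_left sum.distrib[symmetric]
    by (rule sum_mono) (use assms(2,3) in \<open>auto simp: carrier_vecI\<close>)
qed

text \<open>Trace preserving 2-positive maps: nothing more of complete positivity enters the data
  processing inequalities.\<close>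

definition chan2 :: "nat \<Rightarrow> nat \<Rightarrow> (complex mat \<Rightarrow> complex mat) \<Rightarrow> bool" where
  "chan2 n n' \<Lambda> \<longleftrightarrow>
    (\<forall>A \<in> carrier_mat n n. \<Lambda> A \<in> carrier_mat n' n') \<and>
    (\<forall>A \<in> carrier_mat n n. \<forall>B \<in> carrier_mat n n. \<Lambda> (A + B) = \<Lambda> A + \<Lambda> B) \<and>
    (\<forall>A \<in> carrier_mat n n. \<forall>c. \<Lambda> (c \<cdot>\<^sub>m A) = c \<cdot>\<^sub>m \<Lambda> A) \<and>
    (\<forall>A \<in> carrier_mat n n. mtrace (\<Lambda> A) = mtrace A) \<and>
    (\<forall>A \<in> carrier_mat n n. \<forall>B \<in> carrier_mat n n. \<forall>C \<in> carrier_mat n n. \<forall>D \<in> carrier_mat n n.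
       psd (n + n) (four_block_mat A B C D) \<longrightarrow> psd (n' + n') (four_block_mat (\<Lambda> A) (\<Lambda> B) (\<Lambda> C) (\<Lambda> D)))"

lemma chan2D:
  assumes "chan2 n n' \<Lambda>"
  shows "\<And>A. A \<in> carrier_mat n n \<Longrightarrow> \<Lambda> A \<in> carrier_mat n' n'"
    "\<And>A B. A \<in> carrier_mat n n \<Longrightarrow> B \<in> carrier_mat n n \<Longrightarrow> \<Lambda> (A + B) = \<Lambda> A + \<Lambda> B"
    "\<And>A c. A \<in> carrier_mat n n \<Longrightarrow> \<Lambda> (c \<cdot>\<^sub>m A) = c \<cdot>\<^sub>m \<Lambda> A"
    "\<And>A. A \<in> carrier_mat n n \<Longrightarrow> mtrace (\<Lambda> A) = mtrace A"
    "\<And>A B C D. A \<in> carrier_mat n n \<Longrightarrow> B \<in> carrier_mat n n \<Longrightarrow> C \<in> carrier_mat n n \<Longrightarrow> D \<in> carrier_mat n n \<Longrightarrow>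
       psd (n + n) (four_block_mat A B C D) \<Longrightarrow> psd (n' + n') (four_block_mat (\<Lambda> A) (\<Lambda> B) (\<Lambda> C) (\<Lambda> D))"
proof -
  note a = assms[unfolded chan2_def]
  note a1 = a[THEN conjunct1] and a2 = a[THEN conjunct2, THEN conjunct1]
    and a3 = a[THEN conjunct2, THEN conjunct2, THEN conjunct1]
    and a4 = a[THEN conjunct2, THEN conjunct2, THEN conjunct2, THEN conjunct1]
    and a5 = a[THEN conjunct2, THEN conjunct2, THEN conjunct2, THEN conjunct2]
  fix A :: "complex mat" assume A: "A \<in> carrier_mat n n"
  show "\<Lambda> A \<in> carrier_mat n' n'" by (rule bspec[OF a1 A])
  show "\<Lambda> (A + B) = \<Lambda> A + \<Lambda> B" if "B \<in> carrier_mat n n" for B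
    by (rule bspec[OF bspec[OF a2 A] that])
  show "\<Lambda> (c \<cdot>\<^sub>m A) = c \<cdot>\<^sub>m \<Lambda> A" for c by (rule spec[OF bspec[OF a3 A]])
  show "mtrace (\<Lambda> A) = mtrace A" by (rule bspec[OF a4 A])
  show "psd (n' + n') (four_block_mat (\<Lambda> A) (\<Lambda> B) (\<Lambda> C) (\<Lambda> D))"
    if "B \<in> carrier_mat n n" "C \<in> carrier_mat n n" "D \<in> carrier_mat n n" "psd (n + n) (four_block_mat A B C D)" for B C D
    by (rule mp[OF bspec[OF bspec[OF bspec[OF bspec[OF a5 A] that(1)] that(2)] that(3)] that(4)])
qed

text \<open>That \<Lambda> commutes with \<open>adj\<close> on Y comes from positivity as well: the
  image block matrix is positive, hence Hermitian, which compares its two off-diagonal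
  blocks.\<close>

lemma chan2_couples:
  assumes L: "chan2 n n' \<Lambda>" and c: "couples n \<rho> Y \<sigma>"
  shows "couples n' (\<Lambda> \<rho>) (\<Lambda> Y) (\<Lambda> \<sigma>)"
proof -
  note cc = couplesD[OF c]
  have P: "psd (n' + n') (four_block_mat (\<Lambda> \<rho>) (\<Lambda> Y) (\<Lambda> (adj Y)) (\<Lambda> \<sigma>))" (is "psd _ ?P")
    by (rule chan2D(5)[OF L]) (use cc in auto)
  have car: "\<Lambda> \<rho> \<in> carrier_mat n' n'" "\<Lambda> Y \<in> carrier_mat n' n'" "\<Lambda> (adj Y) \<in> carrier_mat n' n'" "\<Lambda> \<sigma> \<in> carrier_mat n' n'"
    using chan2D(1)[OF L] cc by auto
  have "\<Lambda> (adj Y) = adj (\<Lambda> Y)"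
  proof (rule eq_matI)
    fix i j assume "i < dim_row (adj (\<Lambda> Y))" "j < dim_col (adj (\<Lambda> Y))"
    then have ij: "i < n'" "j < n'" using car by auto
    have "?P $$ (n' + i, j) = cnj (?P $$ (j, n' + i))"
      using adj_index[of "n' + i" ?P j] ij car unfolding psd_adj[OF P] by simp
    then show "\<Lambda> (adj Y) $$ (i, j) = adj (\<Lambda> Y) $$ (i, j)" using ij car by simp
  qed (use car in auto)
  then show ?thesis using P car by (simp add: couples_def)
qed

text \<open>Plain positivity is extracted from 2-positivity by coupling \<rho> with itself through
  the zero matrix.\<close>

lemma chan2_psd:
  assumes L: "chan2 n n' \<Lambda>" and p: "psd n \<rho>"
  shows "psd n' (\<Lambda> \<rho>)"
proof -
  have "couples n \<rho> (0\<^sub>m n n) \<rho>"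
  proof (rule couplesI[OF p p])
    fix x y :: "complex vec" assume xy: "x \<in> carrier_vec n" "y \<in> carrier_vec n"
    have "cinner x (0\<^sub>m n n *\<^sub>v y) = 0" using xy by (simp add: cinner_def)
    then show "0 \<le> Re (cinner x (\<rho> *\<^sub>v x)) + 2 * Re (cinner x (0\<^sub>m n n *\<^sub>v y)) + Re (cinner y (\<rho> *\<^sub>v y))"
      using psd_quad[OF p] xy by simp
  qed simp
  from couples_psd(1)[OF chan2_couples[OF L this]] show ?thesis .
qed

lemma chan2_density: "chan2 n n' \<Lambda> \<Longrightarrow> density n \<rho> \<Longrightarrow> density n' (\<Lambda> \<rho>)"
  using chan2_psd chan2D(4)[of n n' \<Lambda> \<rho>] by (auto simp: density_def)

lemma fidelity_chan2:
  assumes L: "chan2 n n' \<Lambda>" and p: "psd n \<rho>" "psd n \<sigma>"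
  shows "fidelity \<rho> \<sigma> \<le> fidelity (\<Lambda> \<rho>) (\<Lambda> \<sigma>)"
proof -
  obtain Y where Y: "couples n \<rho> Y \<sigma>" "Re (mtrace Y) = fidelity \<rho> \<sigma>" using fidelity_attained[OF p] .
  have "Re (mtrace (\<Lambda> Y)) \<le> fidelity (\<Lambda> \<rho>) (\<Lambda> \<sigma>)"
    by (rule fidelity_upper[OF chan2_couples[OF L Y(1)] chan2_psd[OF L p(1)] chan2_psd[OF L p(2)]])
  then show ?thesis using Y chan2D(4)[OF L couplesD(3)[OF Y(1)]] by simp
qed

text \<open>The first tensor factor is the high part of the index, so a 2 x 2 block matrix over a
  reference of dimension \<open>da\<close> is an operator over a reference of dimension
  \<open>2 * da\<close>.\<close>

lemma four_block_id_tensor: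
  assumes "A \<in> carrier_mat (da * db) (da * db)" "B \<in> carrier_mat (da * db) (da * db)"
    "C \<in> carrier_mat (da * db) (da * db)" "D \<in> carrier_mat (da * db) (da * db)"
  shows "id_tensor (2 * da) db db' \<Phi> (four_block_mat A B C D) =
    four_block_mat (id_tensor da db db' \<Phi> A) (id_tensor da db db' \<Phi> B) (id_tensor da db db' \<Phi> C) (id_tensor da db db' \<Phi> D)"
    (is "?l = ?r")
proof (rule eq_matI)
  fix i j assume "i < dim_row ?r" "j < dim_col ?r"
  then have ij: "i < 2 * da * db'" "j < 2 * da * db'" by (auto simp: id_tensor_def)
  let ?P = "four_block_mat A B C D"
  note d = divmod_less[OF ij(1)] divmod_less[OF ij(2)]
  have lt: "a < da * db' \<longleftrightarrow> a div db' < da" if "a mod db' < db'" for a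
    using that by (simp add: div_less_iff_less_mult)
  have ge: "(a - da * db') mod db' = a mod db'" "(a - da * db') div db' = a div db' - da" if "da \<le> a div db'" for a
  proof -
    have "da * db' \<le> a" using that by (metis div_times_less_eq_dividend le_trans mult_le_mono1)
    then obtain r where "a = da * db' + r" using le_Suc_ex by blast
    then show "(a - da * db') mod db' = a mod db'" "(a - da * db') div db' = a div db' - da"
      using that by (cases "db' = 0"; simp)+
  qed
  have row: "q * db + k < da * db \<longleftrightarrow> q < da" if "k < db" for q k
    using that idx_less[of q da k db] by (metis le_trans le_add1 mult_le_mono1 not_le)
  have row': "q * db + k - da * db = (q - da) * db + k" if "da \<le> q" for q k
    using that by (auto simp: le_iff_add distrib_right)
  have bnd: "q * db + k < da * db + da * db" if "k < db" "q < 2 * da" for q k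
    using idx_less[OF that(2,1)] by (simp add: mult_2 distrib_right)
  have blk: "block db p q ?P =
      (if p < da then if q < da then block db p q A else block db p (q - da) B
       else if q < da then block db (p - da) q C else block db (p - da) (q - da) D)" if "p < 2 * da" "q < 2 * da" for p q
    by (rule eq_matI) (use assms that row row' bnd in \<open>auto simp: block_def\<close>)
  show "?l $$ (i, j) = ?r $$ (i, j)"
    by (cases "i div db' < da"; cases "j div db' < da";
      use ij d lt[of i] lt[of j] ge[of i] ge[of j] in \<open>simp add: id_tensor_def blk\<close>)
qed (auto simp: id_tensor_def)

lemma id_tensor_chan2:
  assumes P: "cptp db db' \<Phi>"
  shows "chan2 (da * db) (da * db') (id_tensor da db db' \<Phi>)"
proof -
  let ?L = "id_tensor da db db' \<Phi>"
  let ?n = "da * db" and ?m = "da * db'"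
  have dm: "dim_row (\<Phi> (block db i j A)) = db'" "dim_col (\<Phi> (block db i j A)) = db'" for i j A
    using P by (auto simp: cptp_def block_def)
  have bc: "block db i j A \<in> carrier_mat db db" for i j A by (simp add: block_def)
  have car: "\<Phi> A \<in> carrier_mat db' db'" if "A \<in> carrier_mat db db" for A using P that by (simp add: cptp_def)
  have add: "\<Phi> (A + B) = \<Phi> A + \<Phi> B" if "A \<in> carrier_mat db db" "B \<in> carrier_mat db db" for A B using P that by (simp add: cptp_def)
  have smult: "\<Phi> (c \<cdot>\<^sub>m A) = c \<cdot>\<^sub>m \<Phi> A" if "A \<in> carrier_mat db db" for A c using P that by (simp add: cptp_def)
  have tr: "mtrace (\<Phi> A) = mtrace A" if "A \<in> carrier_mat db db" for A using P that by (simp add: cptp_def)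
  have pos: "psd (k * db') (id_tensor k db db' \<Phi> \<rho>)" if "psd (k * db) \<rho>" for k \<rho> using P that by (simp add: cptp_def)
  show ?thesis
    unfolding chan2_def
  proof (intro conjI ballI allI impI)
    fix A :: "complex mat" assume A: "A \<in> carrier_mat ?n ?n"
    show "?L A \<in> carrier_mat ?m ?m" by (simp add: id_tensor_def)
    show "?L (A + B) = ?L A + ?L B" if B: "B \<in> carrier_mat ?n ?n" for B
    proof (rule eq_matI)
      fix i j assume "i < dim_row (?L A + ?L B)" "j < dim_col (?L A + ?L B)"
      then have ij: "i < ?m" "j < ?m" by (auto simp: id_tensor_def)
      note d = divmod_less[OF ij(1)] divmod_less[OF ij(2)]
      have "block db (i div db') (j div db') (A + B) = block db (i div db') (j div db') A + block db (i div db') (j div db') B"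
        by (rule eq_matI) (use A B d idx_less in \<open>auto simp: block_def\<close>)
      then show "?L (A + B) $$ (i, j) = (?L A + ?L B) $$ (i, j)"
        using ij d by (simp add: id_tensor_def add[OF bc bc] dm)
    qed (auto simp: id_tensor_def)
    show "?L (c \<cdot>\<^sub>m A) = c \<cdot>\<^sub>m ?L A" for c
    proof (rule eq_matI)
      fix i j assume "i < dim_row (c \<cdot>\<^sub>m ?L A)" "j < dim_col (c \<cdot>\<^sub>m ?L A)"
      then have ij: "i < ?m" "j < ?m" by (auto simp: id_tensor_def)
      note d = divmod_less[OF ij(1)] divmod_less[OF ij(2)]
      have "block db (i div db') (j div db') (c \<cdot>\<^sub>m A) = c \<cdot>\<^sub>m block db (i div db') (j div db') A"
        by (rule eq_matI) (use A d idx_less in \<open>auto simp: block_def\<close>)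
      then show "?L (c \<cdot>\<^sub>m A) $$ (i, j) = (c \<cdot>\<^sub>m ?L A) $$ (i, j)"
        using ij d by (simp add: id_tensor_def smult[OF bc] dm)
    qed (auto simp: id_tensor_def)
    show "mtrace (?L A) = mtrace A"
    proof -
      have "mtrace (?L A) = (\<Sum>k<da * db'. \<Phi> (block db (k div db') (k div db') A) $$ (k mod db', k mod db'))"
        by (simp add: mtrace_def id_tensor_def)
      also have "\<dots> = (\<Sum>i<da. mtrace (\<Phi> (block db i i A)))"
        by (subst sum_divmod[where f = "\<lambda>i j. \<Phi> (block db i i A) $$ (j, j)"]) (simp add: mtrace_def dm)
      also have "\<dots> = (\<Sum>i<da. \<Sum>k<db. A $$ (i * db + k, i * db + k))"
        by (simp add: tr[OF bc]) (simp add: mtrace_def block_def)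
      also have "\<dots> = mtrace A"
        using A sum_divmod[where f = "\<lambda>i k. A $$ (i * db + k, i * db + k)" and m = da and n = db] by (simp add: mtrace_def)
      finally show ?thesis .
    qed
    \<comment> \<open>Complete positivity with reference dimension \<open>2 * da\<close> is
      2-positivity of the extended map.\<close>
    show "psd (?m + ?m) (four_block_mat (?L A) (?L B) (?L C) (?L D))"
      if "B \<in> carrier_mat ?n ?n" "C \<in> carrier_mat ?n ?n" "D \<in> carrier_mat ?n ?n" "psd (?n + ?n) (four_block_mat A B C D)" for B C D
      using pos[of "2 * da" "four_block_mat A B C D"] that(4) four_block_id_tensor[OF A that(1-3), of db' \<Phi>]
      by (simp add: mult_2 distrib_right)
  qed
qed

section \<open>Data processing for the affinity\<close>

lemma spec_eqI:
  assumes A: "A \<in> carrier_mat n n" and e: "onb n e"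
    and ev: "\<And>k. k < n \<Longrightarrow> A *\<^sub>v e k = of_real (c k) \<cdot>\<^sub>v e k"
  shows "A = spec n e c"
proof (rule eq_matI)
  fix i j assume "i < dim_row (spec n e c)" "j < dim_col (spec n e c)"
  then have ij: "i < n" "j < n" by auto
  have "A $$ (i, j) = (\<Sum>x<n. if x = j then A $$ (i, x) else 0)" using ij by simp
  also have "\<dots> = (\<Sum>x<n. \<Sum>k<n. A $$ (i, x) * e k $ x * cnj (e k $ j))"
    using ij by (intro sum.cong refl) (simp add: onb_complete[OF e] mult.assoc flip: sum_distrib_left)
  also have "\<dots> = (\<Sum>k<n. \<Sum>x<n. A $$ (i, x) * e k $ x * cnj (e k $ j))" by (rule sum.swap)
  also have "\<dots> = (\<Sum>k<n. (A *\<^sub>v e k) $ i * cnj (e k $ j))"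
    using ij A onb_dim[OF e] by (simp add: mat_vec_index sum_distrib_right del: index_mult_mat_vec)
  also have "\<dots> = spec n e c $$ (i, j)"
    using ij onb_dim[OF e] by (simp add: ev spec_def)
  finally show "A $$ (i, j) = spec n e c $$ (i, j)" .
qed (use A in auto)

text \<open>A Hermitian \<open>W\<close> with \<open>|\<langle>x, W y\<rangle>|\<^sup>2 \<le> \<langle>x, P x\<rangle> \<langle>y, Q y\<rangle>\<close> lies below the geometric mean of the
  commuting operators \<open>P\<close> and \<open>Q\<close>: the hypothesis says \<open>K\<^sup>2 \<le> D\<^sup>2\<close> for \<open>K = P\<^sup>-\<^sup>1\<^sup>/\<^sup>2 W P\<^sup>-\<^sup>1\<^sup>/\<^sup>2\<close> and
  \<open>D = (Q/P)\<^sup>1\<^sup>/\<^sup>2\<close>, and an eigenvector of \<open>D - K\<close> with negative eigenvalue would violate this.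
  Inverses of zero eigenvalues are \<open>0\<close>.\<close>

lemma geometric_mean_upper:
  assumes b: "onb m b" and pq: "\<And>k. k < m \<Longrightarrow> 0 \<le> p k" "\<And>k. k < m \<Longrightarrow> 0 \<le> q k"
    and W: "W \<in> carrier_mat m m" "adj W = W"
    and le: "\<And>x y. x \<in> carrier_vec m \<Longrightarrow> y \<in> carrier_vec m \<Longrightarrow>
      (cmod (cinner x (W *\<^sub>v y)))\<^sup>2 \<le> Re (cinner x (spec m b p *\<^sub>v x)) * Re (cinner y (spec m b q *\<^sub>v y))"
    and x: "x \<in> carrier_vec m"
  shows "Re (cinner x (W *\<^sub>v x)) \<le> Re (cinner x (spec m b (\<lambda>k. sqrt (p k) * sqrt (q k)) *\<^sub>v x))"
proof -
  define J where "J = spec m b (\<lambda>k. 1 / sqrt (p k))"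
  define D where "D = spec m b (\<lambda>k. sqrt (q k) * (1 / sqrt (p k)))"
  define R where "R = spec m b (\<lambda>k. sqrt (p k))"
  define K where "K = J * W * J"
  let ?chi = "\<lambda>k. if p k = 0 then 0 else 1 :: real"
  have d: "J \<in> carrier_mat m m" "D \<in> carrier_mat m m" "R \<in> carrier_mat m m" "adj J = J" "adj D = D" "adj R = R"
    by (auto simp: J_def D_def R_def)
  note dd = carrier_matD[OF d(1)] carrier_matD[OF d(2)] carrier_matD[OF d(3)] carrier_matD[OF W(1)]
  have K: "K \<in> carrier_mat m m" "adj K = K"
    using d dd W by (auto simp: K_def adj_mult mat_mult_assoc)
  note dd = dd carrier_matD[OF K(1)]
  have JPJ: "J * spec m b p * J = spec m b ?chi"
    unfolding J_def spec_mult[OF b] by (rule spec_cong) (use pq in \<open>auto simp: field_simps\<close>)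
  have JQJ: "J * spec m b q * J = D * D"
    unfolding J_def D_def spec_mult[OF b] by (rule spec_cong) (use pq in \<open>auto simp: field_simps\<close>)
  have JR: "J * R = spec m b ?chi"
    unfolding J_def R_def spec_mult[OF b] by (rule spec_cong) (use pq in \<open>auto simp: field_simps\<close>)
  have RDR: "R * D * R = spec m b (\<lambda>k. sqrt (p k) * sqrt (q k))"
    unfolding D_def R_def spec_mult[OF b] by (rule spec_cong) (use pq in \<open>auto simp: field_simps\<close>)
  have conj_form: "cinner (M *\<^sub>v u) (A *\<^sub>v (M *\<^sub>v v)) = cinner u (M * A * M *\<^sub>v v)"
    if "M \<in> carrier_mat m m" "adj M = M" "A \<in> carrier_mat m m" "u \<in> carrier_vec m" "v \<in> carrier_vec m" for M A u v
    using that cinner_herm[OF that(1,2,4), of "A *\<^sub>v (M *\<^sub>v v)"] by (simp add: mat_mult_vec_assoc)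
  \<comment> \<open>The hypothesis is used at x = J K v and y = J v: its left side becomes the
    fourth power of |Kv|, its right side at most |Kv|^2 |Dv|^2. Dividing gives K^2 \<le>
    D^2.\<close>
  have KD: "nrm2 (K *\<^sub>v v) \<le> nrm2 (D *\<^sub>v v)" if v: "v \<in> carrier_vec m" for v
  proof -
    let ?u = "K *\<^sub>v v"
    have u: "?u \<in> carrier_vec m" using dd by simp
    have "cinner (J *\<^sub>v ?u) (W *\<^sub>v (J *\<^sub>v v)) = of_real (nrm2 ?u)"
      unfolding conj_form[OF d(1,4) W(1) u v] K_def[symmetric] by (rule cinner_self)
    then have "(nrm2 ?u)\<^sup>2 = (cmod (cinner (J *\<^sub>v ?u) (W *\<^sub>v (J *\<^sub>v v))))\<^sup>2" by simp
    also have "\<dots> \<le> Re (cinner (J *\<^sub>v ?u) (spec m b p *\<^sub>v (J *\<^sub>v ?u))) * Re (cinner (J *\<^sub>v v) (spec m b q *\<^sub>v (J *\<^sub>v v)))"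
      by (rule le) (use dd in auto)
    also have "\<dots> = Re (cinner ?u (spec m b ?chi *\<^sub>v ?u)) * Re (cinner v (D * D *\<^sub>v v))"
      using conj_form[OF d(1,4) _ u u, of "spec m b p"] conj_form[OF d(1,4) _ v v, of "spec m b q"]
      by (simp add: JPJ JQJ)
    also have "Re (cinner v (D * D *\<^sub>v v)) = nrm2 (D *\<^sub>v v)"
      using cinner_gram[of v D v] v dd d(5) by (simp add: cinner_self)
    also have "Re (cinner ?u (spec m b ?chi *\<^sub>v ?u)) * nrm2 (D *\<^sub>v v) \<le> nrm2 ?u * nrm2 (D *\<^sub>v v)"
      by (intro mult_right_mono spec_nrm2_le[OF b u]) auto
    finally have "nrm2 ?u * nrm2 ?u \<le> nrm2 ?u * nrm2 (D *\<^sub>v v)" by (simp add: power2_eq_square)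
    then show ?thesis
      by (cases "nrm2 ?u = 0") (auto simp: mult_le_cancel_left order.not_eq_order_implies_strict)
  qed
  have DKc: "D - K \<in> carrier_mat m m" using d K by (simp add: minus_carrier_mat)
  have "adj (D - K) = D - K"
  proof (rule eq_matI)
    fix i j assume "i < dim_row (D - K)" "j < dim_col (D - K)"
    then have ij: "i < m" "j < m" using dd by auto
    then show "adj (D - K) $$ (i, j) = (D - K) $$ (i, j)"
      using dd adj_index[of i D j] adj_index[of i K j] adj_index[of i "D - K" j] d K by simp
  qed (use dd in auto)
  then obtain e c where e: "onb m e" and S: "D - K = spec m e c" using spectral_theorem[OF DKc] by auto
  \<comment> \<open>If (D - K) v = c v with c < 0 and |v| = 1, then |Kv|^2 = |Dv|^2 - 2 c <v,Dv> +
    c^2, which exceeds |Dv|^2 because D is positive.\<close>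
  have c0: "0 \<le> c k" if k: "k < m" for k
  proof (rule ccontr)
    assume neg: "\<not> 0 \<le> c k"
    let ?v = "e k"
    have v: "?v \<in> carrier_vec m" using e k by (auto simp: onb_def)
    have DK: "D *\<^sub>v ?v - K *\<^sub>v ?v = of_real (c k) \<cdot>\<^sub>v ?v"
      using spec_apply[OF e k, of c] minus_mult_distrib_mat_vec[of D m m K ?v] d K v unfolding S[symmetric] by simp
    have Kv: "K *\<^sub>v ?v = D *\<^sub>v ?v - of_real (c k) \<cdot>\<^sub>v ?v"
      by (rule eq_vecI) (use DK[symmetric] dd v in auto)
    have n1: "cinner ?v ?v = 1" using onb_cinner[OF e k k] by simp
    have h: "cinner (D *\<^sub>v ?v) ?v = cinner ?v (D *\<^sub>v ?v)" using cinner_herm[OF d(2,5) v v] by simp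
    have "cinner (K *\<^sub>v ?v) (K *\<^sub>v ?v) = cinner (D *\<^sub>v ?v) (D *\<^sub>v ?v) - 2 * of_real (c k) * cinner ?v (D *\<^sub>v ?v) + of_real (c k) * of_real (c k)"
      unfolding Kv using dd v
      by (simp add: cinner_diff_left cinner_diff_right cinner_smult_left cinner_smult_right n1 h algebra_simps)
    then have "nrm2 (K *\<^sub>v ?v) = nrm2 (D *\<^sub>v ?v) - 2 * c k * Re (cinner ?v (D *\<^sub>v ?v)) + c k * c k"
      unfolding cinner_self by (auto dest: arg_cong[where f = Re])
    moreover have "0 \<le> Re (cinner ?v (D *\<^sub>v ?v))"
      by (rule psd_quad[OF _ v]) (use b pq in \<open>auto simp: D_def intro!: psd_spec\<close>)
    then have "c k * Re (cinner ?v (D *\<^sub>v ?v)) \<le> 0" using neg by (simp add: mult_nonpos_nonneg)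
    moreover have "0 < c k * c k" using neg by (simp add: mult_neg_neg)
    ultimately show False using KD[OF v] by simp
  qed
  have pDK: "psd m (D - K)" unfolding S using e c0 by (rule psd_spec)
  \<comment> \<open>\<open>?w\<close> is x projected onto the support of P. The pseudo-inverses only
    see this part, so W has to be shown to ignore the rest.\<close>
  let ?z = "R *\<^sub>v x"
  let ?w = "J *\<^sub>v ?z"
  have zc: "?z \<in> carrier_vec m" "?w \<in> carrier_vec m" using dd by auto
  have w: "?w = spec m b ?chi *\<^sub>v x" using dd x by (simp add: mat_mult_vec_assoc[symmetric] JR)
  have "spec m b ?chi * spec m b p = spec m b p" "spec m b p * spec m b ?chi = spec m b p"
    unfolding spec_mult[OF b] by (auto intro!: spec_cong)
  then have pw: "spec m b p *\<^sub>v ?w = spec m b p *\<^sub>v x"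
    unfolding w using x by (simp flip: mat_mult_vec_assoc)
  have "spec m b p *\<^sub>v (x - ?w) = 0\<^sub>v m"
    using mult_minus_distrib_mat_vec[of "spec m b p" m m x ?w] x zc pw by simp
  moreover have xw: "x - ?w \<in> carrier_vec m" using x zc by auto
  then have "cinner (x - ?w) (0\<^sub>v m) = 0" by (intro cinner_zero_right carrier_vecD)
  ultimately have p0: "Re (cinner (x - ?w) (spec m b p *\<^sub>v (x - ?w))) = 0" by simp
  \<comment> \<open>The P-form vanishes at x - w, so the hypothesis forces W to vanish against
    it.\<close>
  have W0: "cinner (x - ?w) (W *\<^sub>v y) = 0" if "y \<in> carrier_vec m" for y
    using le[OF xw that] p0 by simp
  have e1: "cinner x (W *\<^sub>v y) = cinner ?w (W *\<^sub>v y)" if "y \<in> carrier_vec m" for y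
    using W0[OF that] x zc that dd by (simp add: cinner_diff_left)
  have "cinner x (W *\<^sub>v x) = cinner ?w (W *\<^sub>v x)" by (rule e1[OF x])
  also have "\<dots> = cnj (cinner x (W *\<^sub>v ?w))"
    using cinner_herm[OF W zc(2) x] cinner_cnj[of x "W *\<^sub>v ?w"] x dd by simp
  also have "\<dots> = cnj (cinner ?w (W *\<^sub>v ?w))" using e1[OF zc(2)] by simp
  finally have "Re (cinner x (W *\<^sub>v x)) = Re (cinner ?w (W *\<^sub>v ?w))" by simp
  also have "cinner ?w (W *\<^sub>v ?w) = cinner ?z (K *\<^sub>v ?z)"
    unfolding K_def by (rule conj_form[OF d(1,4) W(1) zc(1) zc(1)])
  also have "Re \<dots> \<le> Re (cinner ?z (D *\<^sub>v ?z))"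
    using psd_quad[OF pDK zc(1)] minus_mult_distrib_mat_vec[of D m m K ?z] d K zc dd
    by (simp add: cinner_diff_right)
  also have "cinner ?z (D *\<^sub>v ?z) = cinner x (R * D * R *\<^sub>v x)"
    by (rule conj_form[OF d(3,6,2) x x])
  finally show ?thesis unfolding RDR .
qed

section \<open>Matrices as vectors and two-sided multiplication as an operator\<close>

definition vecm :: "nat \<Rightarrow> complex mat \<Rightarrow> complex vec" where
  "vecm n A = vec (n * n) (\<lambda>k. A $$ (k div n, k mod n))"

definition matv :: "nat \<Rightarrow> complex vec \<Rightarrow> complex mat" where
  "matv n v = mat n n (\<lambda>(i, j). v $ (i * n + j))"

lemma vecm_carrier [simp]: "vecm n A \<in> carrier_vec (n * n)" "dim_vec (vecm n A) = n * n"
  by (auto simp: vecm_def)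

lemma matv_carrier [simp]: "matv n v \<in> carrier_mat n n" "dim_row (matv n v) = n" "dim_col (matv n v) = n"
  by (auto simp: matv_def)

lemma vecm_matv: "v \<in> carrier_vec (n * n) \<Longrightarrow> vecm n (matv n v) = v"
  by (rule eq_vecI) (auto simp: vecm_def matv_def divmod_less)

lemma cinner_vecm:
  assumes "A \<in> carrier_mat n n" "B \<in> carrier_mat n n"
  shows "cinner (vecm n A) (vecm n B) = mtrace (adj A * B)"
proof -
  have "cinner (vecm n A) (vecm n B) = (\<Sum>k<n * n. cnj (A $$ (k div n, k mod n)) * B $$ (k div n, k mod n))"
    by (simp add: cinner_def vecm_def)
  also have "\<dots> = (\<Sum>i<n. \<Sum>j<n. cnj (A $$ (i, j)) * B $$ (i, j))" by (rule sum_divmod)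
  also have "\<dots> = (\<Sum>j<n. \<Sum>i<n. cnj (A $$ (i, j)) * B $$ (i, j))" by (rule sum.swap)
  also have "\<dots> = mtrace (adj A * B)"
    using assms by (auto simp: mtrace_def mat_mult_index simp del: index_mult_mat(1) intro!: sum.cong)
  finally show ?thesis .
qed

text \<open>The matrix of \<open>C \<mapsto> R C S\<close> in the coordinates \<open>vecm\<close>.\<close>

definition supop :: "nat \<Rightarrow> complex mat \<Rightarrow> complex mat \<Rightarrow> complex mat" where
  "supop n R S = mat (n * n) (n * n) (\<lambda>(r, c). R $$ (r div n, c div n) * S $$ (c mod n, r mod n))"

lemma supop_carrier [simp]: "supop n R S \<in> carrier_mat (n * n) (n * n)"
  "dim_row (supop n R S) = n * n" "dim_col (supop n R S) = n * n"
  by (auto simp: supop_def)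

lemma supop_vecm:
  assumes "R \<in> carrier_mat n n" "S \<in> carrier_mat n n" "C \<in> carrier_mat n n"
  shows "supop n R S *\<^sub>v vecm n C = vecm n (R * C * S)"
proof (rule eq_vecI)
  fix r assume "r < dim_vec (vecm n (R * C * S))"
  then have r: "r < n * n" by simp
  note d = divmod_less[OF r]
  have "(supop n R S *\<^sub>v vecm n C) $ r = (\<Sum>c<n * n. R $$ (r div n, c div n) * S $$ (c mod n, r mod n) * C $$ (c div n, c mod n))"
    using r by (simp add: mat_vec_index supop_def vecm_def del: index_mult_mat_vec)
  also have "\<dots> = (\<Sum>i<n. \<Sum>j<n. R $$ (r div n, i) * S $$ (j, r mod n) * C $$ (i, j))"
    by (rule sum_divmod[where f = "\<lambda>i j. R $$ (r div n, i) * S $$ (j, r mod n) * C $$ (i, j)"])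
  also have "\<dots> = (\<Sum>j<n. \<Sum>i<n. R $$ (r div n, i) * S $$ (j, r mod n) * C $$ (i, j))" by (rule sum.swap)
  also have "\<dots> = (\<Sum>j<n. (R * C) $$ (r div n, j) * S $$ (j, r mod n))"
    using assms d by (auto simp: mat_mult_index sum_distrib_left mult_ac simp del: index_mult_mat(1) intro!: sum.cong)
  also have "\<dots> = vecm n (R * C * S) $ r"
    unfolding vecm_def using assms d r by (simp add: mat_mult_index[of _ "R * C" _ S] del: index_mult_mat(1) assoc_mult_mat)
  finally show "(supop n R S *\<^sub>v vecm n C) $ r = vecm n (R * C * S) $ r" .
qed simp

lemma supop_adj:
  assumes "R \<in> carrier_mat n n" "S \<in> carrier_mat n n" "adj R = R" "adj S = S"
  shows "adj (supop n R S) = supop n R S"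
proof (rule eq_matI)
  fix i j assume "i < dim_row (supop n R S)" "j < dim_col (supop n R S)"
  then have ij: "i < n * n" "j < n * n" by auto
  note d = divmod_less[OF ij(1)] divmod_less[OF ij(2)]
  show "adj (supop n R S) $$ (i, j) = supop n R S $$ (i, j)"
    using ij d assms adj_index[of "i div n" R "j div n"] adj_index[of "j mod n" S "i mod n"]
    by (simp add: supop_def)
qed auto

text \<open>The matrices |e_i><f_j|, enumerated by k = i * n + j to match the row-major order of
  \<open>vecm\<close>.\<close>

definition outb :: "nat \<Rightarrow> (nat \<Rightarrow> complex vec) \<Rightarrow> (nat \<Rightarrow> complex vec) \<Rightarrow> nat \<Rightarrow> complex mat" where
  "outb n e f k = mat n n (\<lambda>(i, j). e (k div n) $ i * cnj (f (k mod n) $ j))"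

lemma onb_outb:
  assumes e: "onb n e" and f: "onb n f"
  shows "onb (n * n) (\<lambda>k. vecm n (outb n e f k))"
  unfolding onb_def
proof (intro conjI allI impI)
  fix k l assume kl: "k < n * n" "l < n * n"
  note d = divmod_less[OF kl(1)] divmod_less[OF kl(2)]
  have "cinner (vecm n (outb n e f k)) (vecm n (outb n e f l)) =
    (\<Sum>r<n * n. (\<lambda>i j. (cnj (e (k div n) $ i) * e (l div n) $ i) * (cnj (f (l mod n) $ j) * f (k mod n) $ j)) (r div n) (r mod n))"
    by (simp add: cinner_def vecm_def outb_def divmod_less mult_ac)
  also have "\<dots> = (\<Sum>i<n. cnj (e (k div n) $ i) * e (l div n) $ i) * (\<Sum>j<n. cnj (f (l mod n) $ j) * f (k mod n) $ j)"
    by (subst sum_divmod) (simp add: sum_product)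
  also have "\<dots> = (if k div n = l div n then 1 else 0) * (if l mod n = k mod n then 1 else 0)"
    using d by (simp add: onb_sum[OF e] onb_sum[OF f])
  also have "\<dots> = (if k = l then 1 else 0)"
    by (auto, metis div_mult_mod_eq)
  finally show "cinner (vecm n (outb n e f k)) (vecm n (outb n e f l)) = (if k = l then 1 else 0)" .
qed simp

text \<open>R |e_i><f_j| S = r_i s_j |e_i><f_j|, so left and right multiplications are diagonal in
  one common basis.\<close>

lemma supop_spec:
  assumes e: "onb n e" and f: "onb n f"
  shows "supop n (spec n e r) (spec n f s) = spec (n * n) (\<lambda>k. vecm n (outb n e f k)) (\<lambda>k. r (k div n) * s (k mod n))"
proof (rule spec_eqI[OF _ onb_outb[OF e f]])
  fix k assume k: "k < n * n"
  note d = divmod_less[OF k]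
  let ?R = "spec n e r" and ?S = "spec n f s" and ?E = "outb n e f k"
  have E: "?E \<in> carrier_mat n n" by (simp add: outb_def)
  have "?R * ?E * ?S = of_real (r (k div n) * s (k mod n)) \<cdot>\<^sub>m ?E"
  proof (rule eq_matI)
    fix i j assume "i < dim_row (of_real (r (k div n) * s (k mod n)) \<cdot>\<^sub>m ?E)" "j < dim_col (of_real (r (k div n) * s (k mod n)) \<cdot>\<^sub>m ?E)"
    then have ij: "i < n" "j < n" by (auto simp: outb_def)
    have "(?R *\<^sub>v e (k div n)) $ i = of_real (r (k div n)) * e (k div n) $ i"
      using spec_apply[OF e d(1)] ij onb_dim[OF e d(1)] by simp
    then have 1: "(\<Sum>a<n. ?R $$ (i, a) * e (k div n) $ a) = of_real (r (k div n)) * e (k div n) $ i"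
      using ij onb_dim[OF e d(1)] by (simp add: mat_vec_index del: index_mult_mat_vec)
    have "(?S *\<^sub>v f (k mod n)) $ j = of_real (s (k mod n)) * f (k mod n) $ j"
      using spec_apply[OF f d(2)] ij onb_dim[OF f d(2)] by simp
    then have "(\<Sum>a<n. ?S $$ (j, a) * f (k mod n) $ a) = of_real (s (k mod n)) * f (k mod n) $ j"
      using ij onb_dim[OF f d(2)] by (simp add: mat_vec_index del: index_mult_mat_vec)
    then have "cnj (\<Sum>a<n. ?S $$ (j, a) * f (k mod n) $ a) = of_real (s (k mod n)) * cnj (f (k mod n) $ j)"
      by simp
    \<comment> \<open>S multiplies from the right while f enters conjugated; Hermiticity turns the
      conjugated row of S into the column that the product needs.\<close>
    moreover have "cnj (?S $$ (j, a)) = ?S $$ (a, j)" if "a < n" for a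
      using adj_index[of a ?S j] that ij by simp
    ultimately have 2: "(\<Sum>a<n. ?S $$ (a, j) * cnj (f (k mod n) $ a)) = of_real (s (k mod n)) * cnj (f (k mod n) $ j)"
      by simp
    have RE: "(?R * ?E) $$ (i, b) = of_real (r (k div n)) * e (k div n) $ i * cnj (f (k mod n) $ b)" if "b < n" for b
    proof -
      have "(?R * ?E) $$ (i, b) = (\<Sum>a<n. ?R $$ (i, a) * e (k div n) $ a) * cnj (f (k mod n) $ b)"
        using ij that E by (simp add: mat_mult_index sum_distrib_right mult.assoc del: index_mult_mat(1)) (simp add: outb_def)
      then show ?thesis unfolding 1 .
    qed
    have "(?R * ?E * ?S) $$ (i, j) = (\<Sum>b<n. (?R * ?E) $$ (i, b) * ?S $$ (b, j))"
      using ij E by (subst mat_mult_index) auto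
    also have "\<dots> = of_real (r (k div n)) * e (k div n) $ i * (\<Sum>a<n. ?S $$ (a, j) * cnj (f (k mod n) $ a))"
      by (simp add: RE sum_distrib_left mult_ac del: index_mult_mat(1))
    also have "\<dots> = (of_real (r (k div n) * s (k mod n)) \<cdot>\<^sub>m ?E) $$ (i, j)"
      unfolding 2 using ij by (simp add: outb_def)
    finally show "(?R * ?E * ?S) $$ (i, j) = (of_real (r (k div n) * s (k mod n)) \<cdot>\<^sub>m ?E) $$ (i, j)" .
  qed (auto simp: outb_def)
  then show "supop n ?R ?S *\<^sub>v vecm n ?E = of_real (r (k div n) * s (k mod n)) \<cdot>\<^sub>v vecm n ?E"
    using E by (simp add: supop_vecm) (auto simp: vecm_def outb_def divmod_less intro!: eq_vecI)
qed simp

section \<open>Trace pairing and the Hilbert-Schmidt adjoint of a channel\<close>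

lemma trace_cauchy_schwarz:
  assumes "A \<in> carrier_mat n n" "B \<in> carrier_mat n n"
  shows "(cmod (mtrace (adj A * B)))\<^sup>2 \<le> Re (mtrace (adj A * A)) * Re (mtrace (adj B * B))"
  using cauchy_schwarz[of "vecm n A" "vecm n B"] assms
  by (simp add: cinner_vecm[symmetric] cinner_self)

text \<open>Column (i, j) of the matrix of \<Lambda> is the image of the matrix unit at (i, j); this
  is the conjugate transpose of that matrix, in the \<open>vecm\<close> coordinates.\<close>

definition dualmat :: "nat \<Rightarrow> nat \<Rightarrow> (complex mat \<Rightarrow> complex mat) \<Rightarrow> complex mat" where
  "dualmat n n' \<Lambda> = mat (n * n) (n' * n') (\<lambda>(r, c).
     cnj (\<Lambda> (mat n n (\<lambda>p. if p = (r div n, r mod n) then 1 else 0)) $$ (c div n', c mod n')))"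

definition dual :: "nat \<Rightarrow> nat \<Rightarrow> (complex mat \<Rightarrow> complex mat) \<Rightarrow> complex mat \<Rightarrow> complex mat" where
  "dual n n' \<Lambda> Z = matv n (dualmat n n' \<Lambda> *\<^sub>v vecm n' Z)"

lemma dualmat_carrier [simp]: "dualmat n n' \<Lambda> \<in> carrier_mat (n * n) (n' * n')"
  "dim_row (dualmat n n' \<Lambda>) = n * n" "dim_col (dualmat n n' \<Lambda>) = n' * n'"
  by (auto simp: dualmat_def)

lemma dual_carrier [simp]: "dual n n' \<Lambda> Z \<in> carrier_mat n n" "dim_row (dual n n' \<Lambda> Z) = n" "dim_col (dual n n' \<Lambda> Z) = n"
  by (auto simp: dual_def)

lemma dualmat_vecm: "dualmat n n' \<Lambda> *\<^sub>v vecm n' Z = vecm n (dual n n' \<Lambda> Z)"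
  by (simp add: dual_def vecm_matv)

lemma dual_index:
  assumes "i < n" "j < n"
  shows "dual n n' \<Lambda> Z $$ (i, j) = (\<Sum>a<n'. \<Sum>b<n'. cnj (\<Lambda> (mat n n (\<lambda>p. if p = (i, j) then 1 else 0)) $$ (a, b)) * Z $$ (a, b))"
  using assms idx_less[OF assms]
  by (simp add: dual_def matv_def mat_vec_index dualmat_def vecm_def del: index_mult_mat_vec)
    (rule sum_divmod[where f = "\<lambda>a b. cnj (\<Lambda> (mat n n (\<lambda>p. if p = (i, j) then 1 else 0)) $$ (a, b)) * Z $$ (a, b)"])

lemma trace_adj_right:
  assumes "B \<in> carrier_mat n n" "Z \<in> carrier_mat n n"
  shows "mtrace (B * adj Z) = (\<Sum>a<n. \<Sum>b<n. B $$ (a, b) * cnj (Z $$ (a, b)))"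
  using assms by (auto simp: mtrace_def mat_mult_index simp del: index_mult_mat(1) intro!: sum.cong)

lemma trace_dual:
  assumes L: "chan2 n n' \<Lambda>" and B: "B \<in> carrier_mat n n" and Z: "Z \<in> carrier_mat n' n'"
  shows "mtrace (\<Lambda> B * adj Z) = mtrace (B * adj (dual n n' \<Lambda> Z))"
proof -
  let ?E = "\<lambda>q. mat n n (\<lambda>p. if p = q then 1 else 0) :: complex mat"
  have car: "A \<in> carrier_mat n n \<Longrightarrow> dim_row (\<Lambda> A) = n' \<and> dim_col (\<Lambda> A) = n'" for A using chan2D(1)[OF L] by blast
  have "\<Lambda> B $$ (a, b) = (\<Sum>i<n. \<Sum>j<n. B $$ (i, j) * \<Lambda> (?E (i, j)) $$ (a, b))" if "a < n'" "b < n'" for a b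
    by (rule linear_expand[where g = "\<lambda>A. \<Lambda> A $$ (a, b)", OF _ _ B])
      (use that car in \<open>auto simp: chan2D(2,3)[OF L]\<close>)
  then have "mtrace (\<Lambda> B * adj Z) = (\<Sum>a<n'. \<Sum>b<n'. \<Sum>i<n. \<Sum>j<n. B $$ (i, j) * \<Lambda> (?E (i, j)) $$ (a, b) * cnj (Z $$ (a, b)))"
    using trace_adj_right[OF chan2D(1)[OF L B] Z] by (simp add: sum_distrib_right)
  also have "\<dots> = (\<Sum>a<n'. \<Sum>i<n. \<Sum>b<n'. \<Sum>j<n. B $$ (i, j) * \<Lambda> (?E (i, j)) $$ (a, b) * cnj (Z $$ (a, b)))"
    by (intro sum.cong refl sum.swap)
  also have "\<dots> = (\<Sum>i<n. \<Sum>a<n'. \<Sum>b<n'. \<Sum>j<n. B $$ (i, j) * \<Lambda> (?E (i, j)) $$ (a, b) * cnj (Z $$ (a, b)))"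
    by (rule sum.swap)
  also have "\<dots> = (\<Sum>i<n. \<Sum>a<n'. \<Sum>j<n. \<Sum>b<n'. B $$ (i, j) * \<Lambda> (?E (i, j)) $$ (a, b) * cnj (Z $$ (a, b)))"
    by (intro sum.cong refl sum.swap)
  also have "\<dots> = (\<Sum>i<n. \<Sum>j<n. \<Sum>a<n'. \<Sum>b<n'. B $$ (i, j) * \<Lambda> (?E (i, j)) $$ (a, b) * cnj (Z $$ (a, b)))"
    by (intro sum.cong refl sum.swap)
  also have "\<dots> = mtrace (B * adj (dual n n' \<Lambda> Z))"
    using trace_adj_right[OF B dual_carrier(1)] by (simp add: dual_index sum_distrib_left mult.assoc)
  finally show ?thesis .
qed

text \<open>Unitality is dual to trace preservation: the entries are conjugated traces of images of
  matrix units.\<close>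

lemma dual_one:
  assumes L: "chan2 n n' \<Lambda>"
  shows "dual n n' \<Lambda> (1\<^sub>m n') = 1\<^sub>m n"
proof (rule eq_matI)
  fix i j assume "i < dim_row (1\<^sub>m n :: complex mat)" "j < dim_col (1\<^sub>m n :: complex mat)"
  then have ij: "i < n" "j < n" by auto
  let ?E = "mat n n (\<lambda>p. if p = (i, j) then 1 else 0) :: complex mat"
  have "\<Lambda> ?E \<in> carrier_mat n' n'" by (rule chan2D(1)[OF L]) simp
  then have "dual n n' \<Lambda> (1\<^sub>m n') $$ (i, j) = cnj (mtrace (\<Lambda> ?E))"
    using ij by (auto simp: dual_index mtrace_def if_distrib[of "\<lambda>x. _ * x"] cong: if_cong intro!: sum.cong)
  also have "mtrace (\<Lambda> ?E) = mtrace ?E" by (rule chan2D(4)[OF L]) simp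
  also have "\<dots> = (\<Sum>k<n. if k = i then (if i = j then 1 else 0) else 0)"
    unfolding mtrace_def by (auto intro!: sum.cong)
  also have "cnj \<dots> = 1\<^sub>m n $$ (i, j)" using ij by simp
  finally show "dual n n' \<Lambda> (1\<^sub>m n') $$ (i, j) = 1\<^sub>m n $$ (i, j)" .
qed auto

text \<open>The two Schwarz inequalities for the dual map, obtained by applying 2-positivity to the
  positive block matrices built from \<open>\<rho>, \<rho>X, X\<^sup>*\<rho>X\<close> and \<open>X\<sigma>X\<^sup>*, X\<sigma>, \<sigma>\<close>.\<close>

lemma schwarz_left:
  assumes L: "chan2 n n' \<Lambda>" and p: "psd n \<rho>" and Z: "Z \<in> carrier_mat n' n'"
  defines "Y \<equiv> dual n n' \<Lambda> Z"
  shows "Re (mtrace (adj Y * \<rho> * Y)) \<le> Re (mtrace (adj Z * \<Lambda> \<rho> * Z))"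
proof -
  have Y: "Y \<in> carrier_mat n n" by (simp add: Y_def)
  note d = psd_dim[OF p] carrier_matD[OF Y] carrier_matD[OF Z]
  have q: "cinner (Y *\<^sub>v y) (\<rho> *\<^sub>v v) = cinner y (adj Y * \<rho> *\<^sub>v v)" if "y \<in> carrier_vec n" "v \<in> carrier_vec n" for y v
    using that d cinner_adj[of y "adj Y" "\<rho> *\<^sub>v v"] by (simp add: mat_mult_vec_assoc)
  have p2: "psd n (adj Y * \<rho> * Y)" using psd_conj[OF p, of "adj Y" n] Y by simp
  have "couples n \<rho> (\<rho> * Y) (adj Y * \<rho> * Y)"
  proof (rule couplesI[OF p p2])
    fix x y :: "complex vec" assume xy: "x \<in> carrier_vec n" "y \<in> carrier_vec n"
    have "cinner (x + Y *\<^sub>v y) (\<rho> *\<^sub>v (x + Y *\<^sub>v y)) = cinner x (\<rho> *\<^sub>v x) + cinner x (\<rho> * Y *\<^sub>v y)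
        + cnj (cinner x (\<rho> * Y *\<^sub>v y)) + cinner y (adj Y * \<rho> * Y *\<^sub>v y)"
      using xy d q[OF xy(2,1)] q[OF xy(2), of "Y *\<^sub>v y"] cinner_cnj[of x "\<rho> * Y *\<^sub>v y"]
        cinner_herm[OF psd_carrier[OF p] psd_adj[OF p], of "Y *\<^sub>v y" x]
      by (simp add: mult_add_distrib_mat_vec[of \<rho> n n] psd_carrier[OF p] cinner_add_left cinner_add_right mat_mult_vec_assoc)
    then show "0 \<le> Re (cinner x (\<rho> *\<^sub>v x)) + 2 * Re (cinner x (\<rho> * Y *\<^sub>v y)) + Re (cinner y (adj Y * \<rho> * Y *\<^sub>v y))"
      using psd_quad[OF p, of "x + Y *\<^sub>v y"] xy d by simp
  qed (use Y d in auto)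
  from chan2_couples[OF L this] have c: "couples n' (\<Lambda> \<rho>) (\<Lambda> (\<rho> * Y)) (\<Lambda> (adj Y * \<rho> * Y))" .
  note cc = couplesD[OF c]
  have "mtrace (adj Z * \<Lambda> (\<rho> * Y)) = mtrace (\<Lambda> (\<rho> * Y) * adj Z)"
    using cc Z by (intro mtrace_comm) auto
  also have "\<dots> = mtrace (\<rho> * Y * adj Y)" unfolding Y_def by (rule trace_dual[OF L _ Z], rule carrier_matI) (use d in auto)
  also have "\<dots> = mtrace (adj Y * (\<rho> * Y))" using d by (intro mtrace_comm) auto
  \<comment> \<open>The cross term equals the trace of the lower diagonal block, by duality and
    trace preservation. Twice the one minus the other therefore leaves exactly the claimed left
    side.\<close>
  finally have 1: "mtrace (adj Z * \<Lambda> (\<rho> * Y) * 1\<^sub>m n') = mtrace (adj Y * \<rho> * Y)"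
    using cc Z d by (simp add: mat_mult_assoc)
  have "mtrace (adj (1\<^sub>m n') * \<Lambda> (adj Y * \<rho> * Y) * 1\<^sub>m n') = mtrace (\<Lambda> (adj Y * \<rho> * Y))"
    using cc by simp
  also have "\<dots> = mtrace (adj Y * \<rho> * Y)" by (rule chan2D(4)[OF L]) (use p2 in simp)
  finally show ?thesis using couples_trace[OF c Z one_carrier_mat] 1 by simp
qed

lemma schwarz_right:
  assumes L: "chan2 n n' \<Lambda>" and p: "psd n \<sigma>" and Z: "Z \<in> carrier_mat n' n'"
  defines "Y \<equiv> dual n n' \<Lambda> Z"
  shows "Re (mtrace (Y * \<sigma> * adj Y)) \<le> Re (mtrace (Z * \<Lambda> \<sigma> * adj Z))"
proof -
  have Y: "Y \<in> carrier_mat n n" by (simp add: Y_def)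
  note d = psd_dim[OF p] carrier_matD[OF Y] carrier_matD[OF Z]
  have q: "cinner (adj Y *\<^sub>v y) (\<sigma> *\<^sub>v v) = cinner y (Y * \<sigma> *\<^sub>v v)" if "y \<in> carrier_vec n" "v \<in> carrier_vec n" for y v
    using that d cinner_adj[of y Y "\<sigma> *\<^sub>v v"] by (simp add: mat_mult_vec_assoc)
  have p2: "psd n (Y * \<sigma> * adj Y)" by (rule psd_conj[OF p Y])
  have "couples n (Y * \<sigma> * adj Y) (Y * \<sigma>) \<sigma>"
  proof (rule couplesI[OF p2 p])
    fix x y :: "complex vec" assume xy: "x \<in> carrier_vec n" "y \<in> carrier_vec n"
    have "cinner (adj Y *\<^sub>v x + y) (\<sigma> *\<^sub>v (adj Y *\<^sub>v x + y)) = cinner y (\<sigma> *\<^sub>v y) + cinner x (Y * \<sigma> *\<^sub>v y)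
        + cnj (cinner x (Y * \<sigma> *\<^sub>v y)) + cinner x (Y * \<sigma> * adj Y *\<^sub>v x)"
      using xy d q[OF xy(1,2)] q[OF xy(1), of "adj Y *\<^sub>v x"] cinner_cnj[of "adj Y *\<^sub>v x" "\<sigma> *\<^sub>v y"]
        cinner_herm[OF psd_carrier[OF p] psd_adj[OF p], of y "adj Y *\<^sub>v x"]
      by (simp add: mult_add_distrib_mat_vec[of \<sigma> n n] psd_carrier[OF p] cinner_add_left cinner_add_right mat_mult_vec_assoc)
    then show "0 \<le> Re (cinner x (Y * \<sigma> * adj Y *\<^sub>v x)) + 2 * Re (cinner x (Y * \<sigma> *\<^sub>v y)) + Re (cinner y (\<sigma> *\<^sub>v y))"
      using psd_quad[OF p, of "adj Y *\<^sub>v x + y"] xy d by simp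
  qed (use Y d in auto)
  from chan2_couples[OF L this] have c: "couples n' (\<Lambda> (Y * \<sigma> * adj Y)) (\<Lambda> (Y * \<sigma>)) (\<Lambda> \<sigma>)" .
  note cc = couplesD[OF c]
  \<comment> \<open>Mirror image of the previous argument: the cross term now equals the trace of
    the upper diagonal block, and Z* is put on the \<sigma> side.\<close>
  have "mtrace (\<Lambda> (Y * \<sigma>) * adj Z) = mtrace (Y * \<sigma> * adj Y)"
    unfolding Y_def by (rule trace_dual[OF L _ Z], rule carrier_matI) (use d in auto)
  then have 1: "mtrace (adj (1\<^sub>m n') * \<Lambda> (Y * \<sigma>) * adj Z) = mtrace (Y * \<sigma> * adj Y)"
    using cc by simp
  have "mtrace (adj (1\<^sub>m n') * \<Lambda> (Y * \<sigma> * adj Y) * 1\<^sub>m n') = mtrace (\<Lambda> (Y * \<sigma> * adj Y))"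
    using cc by simp
  also have "\<dots> = mtrace (Y * \<sigma> * adj Y)" by (rule chan2D(4)[OF L]) (use p2 in simp)
  finally show ?thesis using couples_trace[OF c one_carrier_mat, of "adj Z"] 1 Z by simp
qed

lemma affinity_chan2:
  assumes L: "chan2 n n' \<Lambda>" and p: "psd n \<rho>" "psd n \<sigma>"
  shows "affinity \<rho> \<sigma> \<le> affinity (\<Lambda> \<rho>) (\<Lambda> \<sigma>)"
proof -
  define R S where RS: "R = msqrt \<rho>" "S = msqrt \<sigma>"
  have R: "psd n R" "R * R = \<rho>" and S: "psd n S" "S * S = \<sigma>" using p by (auto simp: RS)
  note d = psd_dim[OF R(1)] psd_dim[OF S(1)]
  have p': "psd n' (\<Lambda> \<rho>)" "psd n' (\<Lambda> \<sigma>)" using chan2_psd[OF L] p by auto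
  obtain e r where e: "onb n' e" "\<Lambda> \<rho> = spec n' e r" "\<And>k. k < n' \<Longrightarrow> 0 \<le> r k" using psd_spectral[OF p'(1)] by blast
  obtain f s where f: "onb n' f" "\<Lambda> \<sigma> = spec n' f s" "\<And>k. k < n' \<Longrightarrow> 0 \<le> s k" using psd_spectral[OF p'(2)] by blast
  define b where "b k = vecm n' (outb n' e f k)" for k
  have b: "onb (n' * n') b" unfolding b_def by (rule onb_outb[OF e(1) f(1)])
  let ?p = "\<lambda>k. r (k div n')" and ?q = "\<lambda>k. s (k mod n')"
  \<comment> \<open>In the common basis \<open>b\<close> the geometric mean of C -> (\<Lambda>
    \<rho>) C and C -> C (\<Lambda> \<sigma>) has eigenvalues sqrt (r_i s_j), which is the map with
    the two square roots as factors.\<close>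
  have P: "spec (n' * n') b ?p = supop n' (\<Lambda> \<rho>) (1\<^sub>m n')"
    using supop_spec[OF e(1) f(1), of r "\<lambda>_. 1"] unfolding spec_one[OF f(1)] e(2) b_def by simp
  have Q: "spec (n' * n') b ?q = supop n' (1\<^sub>m n') (\<Lambda> \<sigma>)"
    using supop_spec[OF e(1) f(1), of "\<lambda>_. 1" s] unfolding spec_one[OF e(1)] f(2) b_def by simp
  have PQ: "spec (n' * n') b (\<lambda>k. sqrt (?p k) * sqrt (?q k)) = supop n' (msqrt (\<Lambda> \<rho>)) (msqrt (\<Lambda> \<sigma>))"
    using supop_spec[OF e(1) f(1), of "\<lambda>k. sqrt (r k)" "\<lambda>k. sqrt (s k)"]
    unfolding b_def e(2) f(2) using msqrt_spec[OF e(1,3)] msqrt_spec[OF f(1,3)] by simp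
  define M where "M = dualmat n n' \<Lambda>"
  \<comment> \<open>The map C -> R C S on the input side, pulled back along the dual; its form at
    Z1, Z2 is Tr (X* R Y S) with X and Y their dual images.\<close>
  define W where "W = adj M * supop n R S * M"
  have M: "dim_row M = n * n" "dim_col M = n' * n'" by (auto simp: M_def)
  have Wc: "W \<in> carrier_mat (n' * n') (n' * n')" using M by (auto simp: W_def)
  have "adj (supop n R S) = supop n R S"
    by (rule supop_adj) (use R S in auto)
  then have Wh: "adj W = W" using M by (simp add: W_def adj_mult mat_mult_assoc)
  have form: "cinner (vecm n' Z1) (W *\<^sub>v vecm n' Z2) = mtrace (adj (dual n n' \<Lambda> Z1) * (R * dual n n' \<Lambda> Z2 * S))" for Z1 Z2
  proof -
    have "cinner (vecm n' Z1) (W *\<^sub>v vecm n' Z2) = cinner (M *\<^sub>v vecm n' Z1) (supop n R S *\<^sub>v (M *\<^sub>v vecm n' Z2))"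
      using M cinner_adj[of "vecm n' Z1" "adj M" "supop n R S *\<^sub>v (M *\<^sub>v vecm n' Z2)"] by (simp add: W_def mat_mult_vec_assoc)
    also have "\<dots> = cinner (vecm n (dual n n' \<Lambda> Z1)) (vecm n (R * dual n n' \<Lambda> Z2 * S))"
      unfolding M_def dualmat_vecm using R S by (simp add: supop_vecm)
    also have "\<dots> = mtrace (adj (dual n n' \<Lambda> Z1) * (R * dual n n' \<Lambda> Z2 * S))"
      by (rule cinner_vecm) (use d in auto)
    finally show ?thesis .
  qed
  have bound: "(cmod (cinner x (W *\<^sub>v y)))\<^sup>2 \<le> Re (cinner x (spec (n' * n') b ?p *\<^sub>v x)) * Re (cinner y (spec (n' * n') b ?q *\<^sub>v y))"
    if xy: "x \<in> carrier_vec (n' * n')" "y \<in> carrier_vec (n' * n')" for x y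
  proof -
    define Z1 Z2 where Z: "Z1 = matv n' x" "Z2 = matv n' y"
    have x: "x = vecm n' Z1" and y: "y = vecm n' Z2" using xy by (auto simp: Z vecm_matv)
    have Zc: "Z1 \<in> carrier_mat n' n'" "Z2 \<in> carrier_mat n' n'" by (auto simp: Z)
    let ?X = "dual n n' \<Lambda> Z1" and ?Y = "dual n n' \<Lambda> Z2"
    have c: "?X \<in> carrier_mat n n" "?Y \<in> carrier_mat n n" by auto
    note cd = carrier_matD[OF c(1)] carrier_matD[OF c(2)] carrier_matD[OF Zc(1)] carrier_matD[OF Zc(2)] psd_dim[OF p'(1)] psd_dim[OF p'(2)]
    have RX: "R * ?X \<in> carrier_mat n n" "?Y * S \<in> carrier_mat n n" "adj (?Y * S) \<in> carrier_mat n n"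
      "msqrt (\<Lambda> \<rho>) * Z1 \<in> carrier_mat n' n'" "\<Lambda> \<rho> * Z1 \<in> carrier_mat n' n'" "Z2 * \<Lambda> \<sigma> \<in> carrier_mat n' n'"
      by (rule carrier_matI; use d cd psd_dim[OF psd_msqrt[OF p'(1)]] in simp)+
    have "cinner x (W *\<^sub>v y) = mtrace (adj (R * ?X) * (?Y * S))"
      unfolding x y form using d cd by (simp add: adj_mult psd_adj[OF R(1)] mat_mult_assoc)
    then have "(cmod (cinner x (W *\<^sub>v y)))\<^sup>2 \<le> Re (mtrace (adj (R * ?X) * (R * ?X))) * Re (mtrace (adj (?Y * S) * (?Y * S)))"
      using trace_cauchy_schwarz[of "R * ?X" n "?Y * S"] RX by simp
    also have "adj (R * ?X) * (R * ?X) = adj ?X * \<rho> * ?X"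
      unfolding R(2)[symmetric] using d cd by (simp add: adj_mult psd_adj[OF R(1)] mat_mult_assoc)
    also have "mtrace (adj (?Y * S) * (?Y * S)) = mtrace (?Y * S * adj (?Y * S))"
      using d cd by (intro mtrace_comm) auto
    also have "?Y * S * adj (?Y * S) = ?Y * \<sigma> * adj ?Y"
      unfolding S(2)[symmetric] using d cd by (simp add: adj_mult psd_adj[OF S(1)] mat_mult_assoc)
    also have "Re (mtrace (adj ?X * \<rho> * ?X)) * Re (mtrace (?Y * \<sigma> * adj ?Y)) \<le>
       Re (mtrace (adj Z1 * \<Lambda> \<rho> * Z1)) * Re (mtrace (Z2 * \<Lambda> \<sigma> * adj Z2))"
    proof (rule mult_mono)
      show "0 \<le> Re (mtrace (?Y * \<sigma> * adj ?Y))"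
      proof -
        have "?Y * \<sigma> * adj ?Y = adj (adj (?Y * S)) * adj (?Y * S)"
          unfolding S(2)[symmetric] using d cd by (simp add: adj_mult psd_adj[OF S(1)] mat_mult_assoc)
        moreover have "mtrace (adj (adj (?Y * S)) * adj (?Y * S)) = of_real (nrm2 (vecm n (adj (?Y * S))))"
          using cinner_vecm[OF RX(3,3)] by (simp only: cinner_self)
        ultimately show ?thesis by simp
      qed
      have "\<Lambda> \<rho> = msqrt (\<Lambda> \<rho>) * msqrt (\<Lambda> \<rho>)" using p' by simp
      then have "adj Z1 * \<Lambda> \<rho> * Z1 = adj (msqrt (\<Lambda> \<rho>) * Z1) * (msqrt (\<Lambda> \<rho>) * Z1)"
        using cd psd_dim[OF psd_msqrt[OF p'(1)]] psd_adj[OF psd_msqrt[OF p'(1)]]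
        by (metis adj_dim(2) adj_mult index_mult_mat(2,3) mat_mult_assoc)
      moreover have "mtrace (adj (msqrt (\<Lambda> \<rho>) * Z1) * (msqrt (\<Lambda> \<rho>) * Z1)) = of_real (nrm2 (vecm n' (msqrt (\<Lambda> \<rho>) * Z1)))"
        using cinner_vecm[OF RX(4,4)] by (simp only: cinner_self)
      ultimately show "0 \<le> Re (mtrace (adj Z1 * \<Lambda> \<rho> * Z1))" by simp
    qed (use schwarz_left[OF L p(1) Zc(1)] schwarz_right[OF L p(2) Zc(2)] in auto)
    also have "mtrace (adj Z1 * \<Lambda> \<rho> * Z1) = cinner x (spec (n' * n') b ?p *\<^sub>v x)"
      unfolding P x using Zc RX(5) psd_carrier[OF p'(1)] cd by (simp add: supop_vecm cinner_vecm mat_mult_assoc)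
    also have "mtrace (Z2 * \<Lambda> \<sigma> * adj Z2) = mtrace (adj Z2 * (Z2 * \<Lambda> \<sigma>))"
      using cd by (intro mtrace_comm) auto
    also have "\<dots> = cinner y (spec (n' * n') b ?q *\<^sub>v y)"
      unfolding Q y using Zc RX(6) psd_carrier[OF p'(2)] by (simp add: supop_vecm cinner_vecm)
    finally show ?thesis .
  qed
  \<comment> \<open>Evaluated at the identity matrix: since the dual is unital, the forms on the two
    sides become the two affinities.\<close>
  have "Re (cinner (vecm n' (1\<^sub>m n')) (W *\<^sub>v vecm n' (1\<^sub>m n'))) \<le>
    Re (cinner (vecm n' (1\<^sub>m n')) (spec (n' * n') b (\<lambda>k. sqrt (?p k) * sqrt (?q k)) *\<^sub>v vecm n' (1\<^sub>m n')))"
    by (rule geometric_mean_upper[OF b _ _ Wc Wh bound]) (use e f divmod_less in auto)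
  also have "cinner (vecm n' (1\<^sub>m n')) (W *\<^sub>v vecm n' (1\<^sub>m n')) = mtrace (R * S)"
    unfolding form dual_one[OF L] using d by simp
  also have "cinner (vecm n' (1\<^sub>m n')) (spec (n' * n') b (\<lambda>k. sqrt (?p k) * sqrt (?q k)) *\<^sub>v vecm n' (1\<^sub>m n')) =
    mtrace (msqrt (\<Lambda> \<rho>) * msqrt (\<Lambda> \<sigma>))"
    unfolding PQ using psd_carrier[OF psd_msqrt[OF p'(1)]] psd_carrier[OF psd_msqrt[OF p'(2)]]
    by (simp add: supop_vecm cinner_vecm)
  finally show ?thesis by (simp add: affinity_def RS)
qed

section \<open>Classical-quantum states\<close>

text \<open>The interface through which (1), (2) and (3) treat fidelity and affinity uniformly. The
  upper bound and the closeness estimate need only some coupling with Re Tr Y equal to the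
  overlap.\<close>

lemma overlap_props:
  assumes "X \<in> {fidelity, affinity}"
  shows overlap_nonneg: "\<And>n \<rho> \<sigma>. psd n \<rho> \<Longrightarrow> psd n \<sigma> \<Longrightarrow> 0 \<le> X \<rho> \<sigma>"
    and overlap_le_one: "\<And>n \<rho> \<sigma>. density n \<rho> \<Longrightarrow> density n \<sigma> \<Longrightarrow> X \<rho> \<sigma> \<le> 1"
    and overlap_close: "\<And>n \<rho> \<sigma> a b. density n \<rho> \<Longrightarrow> density n \<sigma> \<Longrightarrow> a < n \<Longrightarrow> b < n \<Longrightarrow>
      cmod (\<rho> $$ (a, b) - \<sigma> $$ (a, b)) \<le> 2 * sqrt (2 - 2 * X \<rho> \<sigma>)"
    and overlap_self: "\<And>n \<rho>. density n \<rho> \<Longrightarrow> X \<rho> \<rho> = 1"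
    and overlap_chan2: "\<And>n n' \<Lambda> \<rho> \<sigma>. chan2 n n' \<Lambda> \<Longrightarrow> psd n \<rho> \<Longrightarrow> psd n \<sigma> \<Longrightarrow> X \<rho> \<sigma> \<le> X (\<Lambda> \<rho>) (\<Lambda> \<sigma>)"
proof -
  have ex: "\<exists>Y. couples n \<rho> Y \<sigma> \<and> Re (mtrace Y) = X \<rho> \<sigma>" if "density n \<rho>" "density n \<sigma>" for n \<rho> \<sigma>
  proof (cases "X = fidelity")
    case True
    show ?thesis
      by (rule fidelity_attained[OF density_psd[OF that(1)] density_psd[OF that(2)]]) (use True in blast)
  next
    case False
    then have "X = affinity" using assms by simp
    then show ?thesis
      using affinity_attained[OF density_psd[OF that(1)] density_psd[OF that(2)]] by (auto simp only: affinity_def)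
  qed
  fix n n' \<rho> \<sigma> \<Lambda> a b
  show "0 \<le> X \<rho> \<sigma>" if "psd n \<rho>" "psd n \<sigma>"
    using assms fidelity_nonneg[OF that] affinity_nonneg[OF that] by auto
  show "X \<rho> \<sigma> \<le> 1" if "density n \<rho>" "density n \<sigma>"
    using ex[OF that] couples_close(1) that by metis
  show "cmod (\<rho> $$ (a, b) - \<sigma> $$ (a, b)) \<le> 2 * sqrt (2 - 2 * X \<rho> \<sigma>)" if "density n \<rho>" "density n \<sigma>" "a < n" "b < n"
    using ex[OF that(1,2)] couples_close(2)[OF _ that] by metis
  show "X \<rho> \<rho> = 1" if "density n \<rho>" using assms fidelity_self[OF that] affinity_self[OF that] by auto
  show "X \<rho> \<sigma> \<le> X (\<Lambda> \<rho>) (\<Lambda> \<sigma>)" if "chan2 n n' \<Lambda>" "psd n \<rho>" "psd n \<sigma>"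
    using assms fidelity_chan2[OF that] affinity_chan2[OF that] by auto
qed

lemma msum_carrier [simp]: "msum n f I \<in> carrier_mat n n" "dim_row (msum n f I) = n" "dim_col (msum n f I) = n"
  by (auto simp: msum_def)

lemma msum_empty: "msum n f {} = 0\<^sub>m n n"
  by (rule eq_matI) (auto simp: msum_def)

lemma msum_insert:
  assumes "finite I" "a \<notin> I" "f a \<in> carrier_mat n n"
  shows "msum n f (insert a I) = f a + msum n f I"
  by (rule eq_matI) (use assms in \<open>auto simp: msum_def\<close>)

lemma msum_cong: "(\<And>i. i \<in> I \<Longrightarrow> f i = g i) \<Longrightarrow> msum n f I = msum n g I"
  by (rule eq_matI) (auto simp: msum_def)

lemma msum_form:
  assumes "v \<in> carrier_vec n" "u \<in> carrier_vec n" "\<And>i. i \<in> I \<Longrightarrow> f i \<in> carrier_mat n n"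
  shows "cinner u (msum n f I *\<^sub>v v) = (\<Sum>i\<in>I. cinner u (f i *\<^sub>v v))"
proof -
  have "cinner u (msum n f I *\<^sub>v v) = (\<Sum>a<n. \<Sum>b<n. \<Sum>i\<in>I. cnj (u $ a) * (f i $$ (a, b) * v $ b))"
    using assms by (simp add: cinner_def mat_vec_index sum_distrib_left sum_distrib_right del: index_mult_mat_vec)
      (simp add: msum_def sum_distrib_left sum_distrib_right)
  also have "\<dots> = (\<Sum>a<n. \<Sum>i\<in>I. \<Sum>b<n. cnj (u $ a) * (f i $$ (a, b) * v $ b))"
    by (intro sum.cong refl sum.swap)
  also have "\<dots> = (\<Sum>i\<in>I. \<Sum>a<n. \<Sum>b<n. cnj (u $ a) * (f i $$ (a, b) * v $ b))"
    by (rule sum.swap)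
  also have "\<dots> = (\<Sum>i\<in>I. cinner u (f i *\<^sub>v v))"
    using assms(1,2) carrier_matD[OF assms(3)]
    by (auto simp: cinner_def mat_vec_index sum_distrib_left simp del: index_mult_mat_vec intro!: sum.cong)
  finally show ?thesis .
qed

lemma mtrace_msum:
  assumes "\<And>i. i \<in> I \<Longrightarrow> f i \<in> carrier_mat n n"
  shows "mtrace (msum n f I) = (\<Sum>i\<in>I. mtrace (f i))"
proof -
  have "mtrace (msum n f I) = (\<Sum>a<n. \<Sum>i\<in>I. f i $$ (a, a))" by (simp add: mtrace_def) (simp add: msum_def)
  also have "\<dots> = (\<Sum>i\<in>I. \<Sum>a<n. f i $$ (a, a))" by (rule sum.swap)
  also have "\<dots> = (\<Sum>i\<in>I. mtrace (f i))" using assms by (auto simp: mtrace_def intro!: sum.cong)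
  finally show ?thesis .
qed

lemma msum_mult:
  assumes "\<And>i. i \<in> I \<Longrightarrow> f i \<in> carrier_mat n n" "\<And>i. i \<in> I \<Longrightarrow> g i \<in> carrier_mat n n"
    "finite I" "\<And>i j. i \<in> I \<Longrightarrow> j \<in> I \<Longrightarrow> i \<noteq> j \<Longrightarrow> f i * g j = 0\<^sub>m n n"
  shows "msum n f I * msum n g I = msum n (\<lambda>i. f i * g i) I"
proof (rule eq_matI)
  fix a b assume "a < dim_row (msum n (\<lambda>i. f i * g i) I)" "b < dim_col (msum n (\<lambda>i. f i * g i) I)"
  then have ab: "a < n" "b < n" by auto
  have "(msum n f I * msum n g I) $$ (a, b) = (\<Sum>c<n. (\<Sum>i\<in>I. f i $$ (a, c)) * (\<Sum>j\<in>I. g j $$ (c, b)))"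
    using ab by (simp add: mat_mult_index del: index_mult_mat(1)) (simp add: msum_def)
  also have "\<dots> = (\<Sum>c<n. \<Sum>i\<in>I. \<Sum>j\<in>I. f i $$ (a, c) * g j $$ (c, b))" by (simp add: sum_product)
  also have "\<dots> = (\<Sum>i\<in>I. \<Sum>c<n. \<Sum>j\<in>I. f i $$ (a, c) * g j $$ (c, b))" by (rule sum.swap)
  also have "\<dots> = (\<Sum>i\<in>I. \<Sum>j\<in>I. \<Sum>c<n. f i $$ (a, c) * g j $$ (c, b))" by (intro sum.cong refl sum.swap)
  also have "\<dots> = (\<Sum>i\<in>I. \<Sum>j\<in>I. (f i * g j) $$ (a, b))"
  proof (intro sum.cong refl)
    fix i j assume "i \<in> I" "j \<in> I"
    then show "(\<Sum>c<n. f i $$ (a, c) * g j $$ (c, b)) = (f i * g j) $$ (a, b)"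
      using ab assms(1)[of i] assms(2)[of j] by (auto simp: mat_mult_index simp del: index_mult_mat(1))
  qed
  also have "\<dots> = (\<Sum>i\<in>I. \<Sum>j\<in>I. if j = i then (f i * g i) $$ (a, b) else 0)"
    using ab assms(4) by (intro sum.cong refl) (metis index_zero_mat(1))
  also have "\<dots> = msum n (\<lambda>i. f i * g i) I $$ (a, b)"
    using ab assms(3) by (simp add: msum_def del: index_mult_mat(1))
  finally show "(msum n f I * msum n g I) $$ (a, b) = msum n (\<lambda>i. f i * g i) I $$ (a, b)" .
qed auto

lemma chan2_msum:
  assumes L: "chan2 n n' \<Lambda>" and "finite I" "\<And>i. i \<in> I \<Longrightarrow> f i \<in> carrier_mat n n"
  shows "\<Lambda> (msum n f I) = msum n' (\<lambda>i. \<Lambda> (f i)) I"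
  using assms(2,3)
proof (induction I)
  case empty
  have "\<Lambda> (0 \<cdot>\<^sub>m 0\<^sub>m n n) = 0 \<cdot>\<^sub>m \<Lambda> (0\<^sub>m n n)" by (rule chan2D(3)[OF L]) simp
  moreover have "0 \<cdot>\<^sub>m M = 0\<^sub>m n' n'" if "M \<in> carrier_mat n' n'" for M :: "complex mat"
    by (rule eq_matI) (use that in auto)
  ultimately show ?case using chan2D(1)[OF L, of "0\<^sub>m n n"] by (simp add: msum_empty)
next
  case (insert a I)
  then show ?case
    using chan2D(1,2)[OF L] by (simp add: msum_insert)
qed

text \<open>\<open>emb db a\<close> is the isometry \<open>v \<mapsto> a \<otimes> v\<close>, so that \<open>|a\<rangle>\<langle>a| \<otimes> \<sigma>\<close> is a conjugation of \<open>\<sigma>\<close> by it.\<close>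

definition emb :: "nat \<Rightarrow> complex vec \<Rightarrow> complex mat" where
  "emb db a = mat (dim_vec a * db) db (\<lambda>(r, l). a $ (r div db) * (if r mod db = l then 1 else 0))"

lemma emb_dim [simp]: "dim_row (emb db a) = dim_vec a * db" "dim_col (emb db a) = db"
  by (auto simp: emb_def)

lemma emb_carrier [simp]: "a \<in> carrier_vec da \<Longrightarrow> emb db a \<in> carrier_mat (da * db) db"
  by (auto simp: emb_def)

lemma kron_proj_emb:
  assumes S: "\<sigma> \<in> carrier_mat db db"
  shows "kron (proj a) \<sigma> = emb db a * \<sigma> * adj (emb db a)"
proof (rule eq_matI)
  fix r c assume "r < dim_row (emb db a * \<sigma> * adj (emb db a))" "c < dim_col (emb db a * \<sigma> * adj (emb db a))"
  then have rc: "r < dim_vec a * db" "c < dim_vec a * db" by auto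
  note d = divmod_less[OF rc(1)] divmod_less[OF rc(2)]
  have 1: "(emb db a * \<sigma>) $$ (r, m) = a $ (r div db) * \<sigma> $$ (r mod db, m)" if "m < db" for m
  proof -
    have "(emb db a * \<sigma>) $$ (r, m) = (\<Sum>l<db. if l = r mod db then a $ (r div db) * \<sigma> $$ (l, m) else 0)"
      using rc that S by (auto simp: mat_mult_index simp del: index_mult_mat(1) intro!: sum.cong) (auto simp: emb_def if_distrib[of "\<lambda>x. _ * x"] if_distrib[of "\<lambda>x. x * _"] cong: if_cong)
    then show ?thesis using d by simp
  qed
  have "(emb db a * \<sigma> * adj (emb db a)) $$ (r, c) = (\<Sum>m<db. (emb db a * \<sigma>) $$ (r, m) * cnj (emb db a $$ (c, m)))"
    using rc S by (subst mat_mult_index) auto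
  also have "\<dots> = (\<Sum>m<db. if m = c mod db then a $ (r div db) * \<sigma> $$ (r mod db, m) * cnj (a $ (c div db)) else 0)"
  proof (intro sum.cong refl)
    fix m assume "m \<in> {..<db}"
    then have m: "m < db" by simp
    have "cnj (emb db a $$ (c, m)) = (if m = c mod db then cnj (a $ (c div db)) else 0)"
      using m rc by (simp add: emb_def)
    then show "(emb db a * \<sigma>) $$ (r, m) * cnj (emb db a $$ (c, m)) =
      (if m = c mod db then a $ (r div db) * \<sigma> $$ (r mod db, m) * cnj (a $ (c div db)) else 0)"
      using 1[OF m] by simp
  qed
  also have "\<dots> = kron (proj a) \<sigma> $$ (r, c)"
    using rc d S by (simp add: kron_def proj_def)
  finally show "kron (proj a) \<sigma> $$ (r, c) = (emb db a * \<sigma> * adj (emb db a)) $$ (r, c)" by simp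
qed (use S in \<open>auto simp: kron_def proj_def\<close>)

lemma emb_gram:
  assumes "dim_vec a = dim_vec b"
  shows "adj (emb db a) * emb db b = cinner a b \<cdot>\<^sub>m 1\<^sub>m db"
proof (rule eq_matI)
  fix i j assume "i < dim_row (cinner a b \<cdot>\<^sub>m 1\<^sub>m db)" "j < dim_col (cinner a b \<cdot>\<^sub>m 1\<^sub>m db)"
  then have ij: "i < db" "j < db" by auto
  have "(adj (emb db a) * emb db b) $$ (i, j) = (\<Sum>r<dim_vec a * db. (\<lambda>x y. cnj (a $ x) * b $ x * (if y = i then (if i = j then 1 else 0) else 0)) (r div db) (r mod db))"
    using ij assms by (subst mat_mult_index) (auto simp: emb_def divmod_less intro!: sum.cong)
  also have "\<dots> = (\<Sum>x<dim_vec a. cnj (a $ x) * b $ x) * (if i = j then 1 else 0)"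
    using ij by (subst sum_divmod) (simp add: if_distrib[of "\<lambda>x. _ * x"] if_distrib[of "\<lambda>x. x * _"] cong: if_cong)
  finally show "(adj (emb db a) * emb db b) $$ (i, j) = (cinner a b \<cdot>\<^sub>m 1\<^sub>m db) $$ (i, j)"
    using ij by (simp add: cinner_def)
qed auto

definition cqm :: "nat \<Rightarrow> nat \<Rightarrow> (nat \<Rightarrow> complex vec) \<Rightarrow> (nat \<Rightarrow> real) \<Rightarrow> (nat \<Rightarrow> complex mat) \<Rightarrow> complex mat" where
  "cqm da db \<alpha> p \<sigma> = msum (da * db) (\<lambda>i. complex_of_real (p i) \<cdot>\<^sub>m kron (proj (\<alpha> i)) (\<sigma> i)) {..<da}"

lemma cqm_carrier [simp]: "cqm da db \<alpha> p \<sigma> \<in> carrier_mat (da * db) (da * db)"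
  by (simp add: cqm_def)

lemma cq_states_cqm: "cq_states da db \<alpha> = {cqm da db \<alpha> p \<sigma> | p \<sigma>. prob_vec da p \<and> (\<forall>i<da. density db (\<sigma> i))}"
  by (simp add: cq_states_def cqm_def)

lemma cq_statesI:
  "prob_vec da p \<Longrightarrow> (\<And>i. i < da \<Longrightarrow> density db (\<sigma> i)) \<Longrightarrow> cqm da db \<alpha> p \<sigma> \<in> cq_states da db \<alpha>"
  unfolding cq_states_cqm by (rule CollectI, rule exI[of _ p], rule exI[of _ \<sigma>]) simp

lemma cq_statesE:
  assumes "s \<in> cq_states da db \<alpha>"
  obtains p \<sigma> where "s = cqm da db \<alpha> p \<sigma>" "prob_vec da p" "\<And>i. i < da \<Longrightarrow> density db (\<sigma> i)"
  using assms unfolding cq_states_cqm by auto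

lemma kron_proj_carrier:
  assumes "a \<in> carrier_vec da" "\<sigma> \<in> carrier_mat db db"
  shows "kron (proj a) \<sigma> \<in> carrier_mat (da * db) (da * db)"
  using assms by (auto simp: kron_def proj_def)

lemma kron_proj_trace:
  assumes "\<sigma> \<in> carrier_mat db db" "cinner a a = 1"
  shows "mtrace (kron (proj a) \<sigma>) = mtrace \<sigma>"
proof -
  have "mtrace (emb db a * \<sigma> * adj (emb db a)) = mtrace (adj (emb db a) * (emb db a * \<sigma>))"
    using assms by (intro mtrace_comm) auto
  also have "adj (emb db a) * (emb db a * \<sigma>) = adj (emb db a) * emb db a * \<sigma>"
    using assms by (simp add: mat_mult_assoc)
  also have "\<dots> = \<sigma>" using assms by (auto simp: emb_gram intro!: eq_matI)
  finally show ?thesis using assms by (simp add: kron_proj_emb)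
qed

lemma cqm_form:
  assumes "onb da \<alpha>" "\<And>i. i < da \<Longrightarrow> \<sigma> i \<in> carrier_mat db db" "\<psi> \<in> carrier_vec (da * db)" "\<phi> \<in> carrier_vec (da * db)"
  shows "cinner \<phi> (cqm da db \<alpha> p \<sigma> *\<^sub>v \<psi>) =
    (\<Sum>i<da. of_real (p i) * cinner (adj (emb db (\<alpha> i)) *\<^sub>v \<phi>) (\<sigma> i *\<^sub>v (adj (emb db (\<alpha> i)) *\<^sub>v \<psi>)))"
proof -
  have ac: "\<alpha> i \<in> carrier_vec da" if "i < da" for i using assms that by (auto simp: onb_def)
  have "cinner \<phi> (cqm da db \<alpha> p \<sigma> *\<^sub>v \<psi>) = (\<Sum>i<da. cinner \<phi> ((complex_of_real (p i) \<cdot>\<^sub>m kron (proj (\<alpha> i)) (\<sigma> i)) *\<^sub>v \<psi>))"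
    unfolding cqm_def by (rule msum_form) (use assms kron_proj_carrier ac in auto)
  also have "\<dots> = (\<Sum>i<da. of_real (p i) * cinner (adj (emb db (\<alpha> i)) *\<^sub>v \<phi>) (\<sigma> i *\<^sub>v (adj (emb db (\<alpha> i)) *\<^sub>v \<psi>)))"
  proof (rule sum.cong)
    fix i assume "i \<in> {..<da}"
    then have i: "i < da" by simp
    note c = kron_proj_carrier[OF ac[OF i] assms(2)[OF i]]
    have "(complex_of_real (p i) \<cdot>\<^sub>m kron (proj (\<alpha> i)) (\<sigma> i)) *\<^sub>v \<psi> = complex_of_real (p i) \<cdot>\<^sub>v (kron (proj (\<alpha> i)) (\<sigma> i) *\<^sub>v \<psi>)"
      by (rule eq_vecI) (use c assms in \<open>auto simp: mat_vec_index sum_distrib_left mult.assoc simp del: index_mult_mat_vec\<close>)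
    moreover have "cinner \<phi> (kron (proj (\<alpha> i)) (\<sigma> i) *\<^sub>v \<psi>) = cinner (adj (emb db (\<alpha> i)) *\<^sub>v \<phi>) (\<sigma> i *\<^sub>v (adj (emb db (\<alpha> i)) *\<^sub>v \<psi>))"
      using assms(2)[OF i] assms(3,4) ac[OF i] cinner_adj[of \<phi> "emb db (\<alpha> i)" "\<sigma> i *\<^sub>v (adj (emb db (\<alpha> i)) *\<^sub>v \<psi>)"]
      by (simp add: kron_proj_emb mat_mult_vec_assoc)
    ultimately show "cinner \<phi> ((complex_of_real (p i) \<cdot>\<^sub>m kron (proj (\<alpha> i)) (\<sigma> i)) *\<^sub>v \<psi>) =
      of_real (p i) * cinner (adj (emb db (\<alpha> i)) *\<^sub>v \<phi>) (\<sigma> i *\<^sub>v (adj (emb db (\<alpha> i)) *\<^sub>v \<psi>))"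
      using c assms by (simp add: cinner_smult_right)
  qed simp
  finally show ?thesis .
qed

lemma cqm_psd:
  assumes a: "onb da \<alpha>" and p: "\<And>i. i < da \<Longrightarrow> 0 \<le> p i" and s: "\<And>i. i < da \<Longrightarrow> psd db (\<sigma> i)"
  shows "psd (da * db) (cqm da db \<alpha> p \<sigma>)"
  unfolding psd_def
proof (intro conjI ballI)
  fix v :: "complex vec" assume v: "v \<in> carrier_vec (da * db)"
  let ?g = "\<lambda>i. cinner (adj (emb db (\<alpha> i)) *\<^sub>v v) (\<sigma> i *\<^sub>v (adj (emb db (\<alpha> i)) *\<^sub>v v))"
  have f: "cinner v (cqm da db \<alpha> p \<sigma> *\<^sub>v v) = (\<Sum>i<da. of_real (p i) * ?g i)"
    by (rule cqm_form[OF a _ v v]) (use s in auto)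
  have g: "?g i \<in> \<real>" "0 \<le> Re (?g i)" if "i < da" for i using s[OF that] by (auto simp: psd_def)
  show "cinner v (cqm da db \<alpha> p \<sigma> *\<^sub>v v) \<in> \<real>" unfolding f using g by (intro sum_in_Reals Reals_mult) auto
  show "0 \<le> Re (cinner v (cqm da db \<alpha> p \<sigma> *\<^sub>v v))"
    unfolding f using g p by (auto intro!: sum_nonneg mult_nonneg_nonneg)
qed simp

lemma cqm_density:
  assumes a: "onb da \<alpha>" and p: "prob_vec da p" and s: "\<And>i. i < da \<Longrightarrow> density db (\<sigma> i)"
  shows "density (da * db) (cqm da db \<alpha> p \<sigma>)"
proof -
  have ac: "\<alpha> i \<in> carrier_vec da" if "i < da" for i using a that by (auto simp: onb_def)
  have sc: "\<sigma> i \<in> carrier_mat db db" if "i < da" for i using s[OF that] by simp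
  have "mtrace (cqm da db \<alpha> p \<sigma>) = (\<Sum>i<da. mtrace (complex_of_real (p i) \<cdot>\<^sub>m kron (proj (\<alpha> i)) (\<sigma> i)))"
    unfolding cqm_def by (rule mtrace_msum) (use kron_proj_carrier ac sc in auto)
  also have "\<dots> = (\<Sum>i<da. complex_of_real (p i))"
  proof (rule sum.cong)
    fix i assume "i \<in> {..<da}"
    then have i: "i < da" by simp
    show "mtrace (complex_of_real (p i) \<cdot>\<^sub>m kron (proj (\<alpha> i)) (\<sigma> i)) = complex_of_real (p i)"
      using kron_proj_carrier[OF ac[OF i] sc[OF i]] kron_proj_trace[OF sc[OF i], of "\<alpha> i"] onb_cinner[OF a i i] s[OF i]
      by (simp add: mtrace_smult density_def)
  qed simp
  also have "\<dots> = 1" using p by (simp add: prob_vec_def flip: of_real_sum)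
  finally show ?thesis using cqm_psd[OF a] p s by (simp add: density_def prob_vec_def)
qed

text \<open>\<open>Inf\<close> on the reals is informative only for nonempty sets bounded below; the
  bound 0 comes from overlaps lying in [0, 1].\<close>

lemma coh_basis_props:
  assumes X: "X \<in> {fidelity, affinity}" and a: "onb da \<alpha>" and r: "density (da * db) \<rho>" and pos: "0 < da" "0 < db"
  shows coh_basis_nonempty: "{dist_X X \<rho> \<sigma> | \<sigma>. \<sigma> \<in> cq_states da db \<alpha>} \<noteq> {}"
    and coh_basis_bdd: "bdd_below {dist_X X \<rho> \<sigma> | \<sigma>. \<sigma> \<in> cq_states da db \<alpha>}"
    and coh_basis_nonneg: "0 \<le> coh_basis X da db \<rho> \<alpha>"
proof -
  \<comment> \<open>The pure state |0><0| on b; with all weight on the first basis vector it shows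
    that classical-quantum states exist.\<close>
  let ?D = "mat db db (\<lambda>(i, j). if i = 0 \<and> j = 0 then 1 else 0) :: complex mat"
  let ?v = "unit_vec db 0 :: complex vec"
  have D: "density db ?D"
    unfolding density_def
  proof
    have "cinner v (?D *\<^sub>v v) = of_real ((cmod (v $ 0))\<^sup>2)" if "v \<in> carrier_vec db" for v
    proof -
      have 1: "(?D *\<^sub>v v) $ i = (if i = 0 then v $ 0 else 0)" if "i < db" for i
      proof -
        have "(?D *\<^sub>v v) $ i = (\<Sum>k<db. if k = 0 then (if i = 0 then v $ 0 else 0) else 0)"
          using that \<open>v \<in> carrier_vec db\<close> by (auto simp: mat_vec_index if_distrib[of "\<lambda>x. _ * x"] if_distrib[of "\<lambda>x. x * _"] cong: if_cong simp del: index_mult_mat_vec intro!: sum.cong)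
        then show ?thesis using pos by simp
      qed
      have "cinner v (?D *\<^sub>v v) = (\<Sum>i<db. if i = 0 then cnj (v $ 0) * v $ 0 else 0)"
        using that by (auto simp: cinner_def 1 if_distrib[of "\<lambda>x. _ * x"] if_distrib[of "\<lambda>x. x * _"] cong: if_cong simp del: index_mult_mat_vec intro!: sum.cong)
      then have "cinner v (?D *\<^sub>v v) = v $ 0 * cnj (v $ 0)" using pos by simp
      then show ?thesis by (simp add: complex_norm_square[symmetric] flip: of_real_power)
    qed
    then have f: "cinner v (?D *\<^sub>v v) \<in> \<real> \<and> 0 \<le> Re (cinner v (?D *\<^sub>v v))" if "v \<in> carrier_vec db" for v
      using that by (metis Re_complex_of_real Reals_of_real zero_le_power2)
    show "psd db ?D" unfolding psd_def by (intro conjI[OF mat_carrier] ballI f)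
    have "mtrace ?D = (\<Sum>i<db. if i = 0 then 1 else 0)" unfolding mtrace_def by (auto intro!: sum.cong)
    then show "mtrace ?D = 1" using pos by simp
  qed
  have "prob_vec da (\<lambda>i. if i = 0 then 1 else 0)" using pos by (simp add: prob_vec_def)
  then have "cqm da db \<alpha> (\<lambda>i. if i = 0 then 1 else 0) (\<lambda>_. ?D) \<in> cq_states da db \<alpha>"
    by (rule cq_statesI) (rule D)
  then show ne: "{dist_X X \<rho> \<sigma> | \<sigma>. \<sigma> \<in> cq_states da db \<alpha>} \<noteq> {}" by auto
  have 0: "0 \<le> y" if mem: "y \<in> {dist_X X \<rho> \<sigma> | \<sigma>. \<sigma> \<in> cq_states da db \<alpha>}" for y
  proof -
    obtain \<sigma> where y: "y = dist_X X \<rho> \<sigma>" and s: "\<sigma> \<in> cq_states da db \<alpha>" using mem by auto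
    have d: "density (da * db) \<sigma>" using s cqm_density[OF a] by (auto elim!: cq_statesE)
    have "X \<rho> \<sigma> \<le> 1" "0 \<le> X \<rho> \<sigma>"
      using overlap_le_one[OF X r d] overlap_nonneg[OF X, of "da * db"] r d by auto
    then show ?thesis unfolding y dist_X_def by (simp add: power_le_one)
  qed
  then show "bdd_below {dist_X X \<rho> \<sigma> | \<sigma>. \<sigma> \<in> cq_states da db \<alpha>}" by (rule bdd_belowI)
  show "0 \<le> coh_basis X da db \<rho> \<alpha>" unfolding coh_basis_def by (rule cInf_greatest[OF ne 0])
qed

lemma ptrace_carrier [simp]: "ptrace_b da db \<rho> \<in> carrier_mat da da"
  by (simp add: ptrace_b_def)

lemma ptrace_herm:
  assumes "psd (da * db) \<rho>"
  shows "adj (ptrace_b da db \<rho>) = ptrace_b da db \<rho>"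
proof (rule eq_matI)
  fix i j assume "i < dim_row (ptrace_b da db \<rho>)" "j < dim_col (ptrace_b da db \<rho>)"
  then have ij: "i < da" "j < da" by (auto simp: ptrace_b_def)
  have "cnj (\<rho> $$ (j * db + k, i * db + k)) = \<rho> $$ (i * db + k, j * db + k)" if "k < db" for k
    using adj_index[of "i * db + k" \<rho> "j * db + k"] psd_adj[OF assms] psd_dim[OF assms]
      idx_less[OF ij(1) that] idx_less[OF ij(2) that] by simp
  then show "adj (ptrace_b da db \<rho>) $$ (i, j) = ptrace_b da db \<rho> $$ (i, j)"
    using ij by (simp add: ptrace_b_def)
qed (auto simp: ptrace_b_def)

lemma eigenbasis_exists:
  assumes "psd (da * db) \<rho>"
  shows "\<exists>\<alpha>. eigenbasis da (ptrace_b da db \<rho>) \<alpha>"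
  using spectral_theorem[OF ptrace_carrier ptrace_herm[OF assms]] spec_apply
  unfolding eigenbasis_def by metis

lemma corr_coh_props:
  assumes X: "X \<in> {fidelity, affinity}" and r: "density (da * db) \<rho>" and pos: "0 < da" "0 < db"
  shows corr_coh_nonempty: "{coh_basis X da db \<rho> \<alpha> | \<alpha>. eigenbasis da (ptrace_b da db \<rho>) \<alpha>} \<noteq> {}"
    and corr_coh_bdd: "bdd_below {coh_basis X da db \<rho> \<alpha> | \<alpha>. eigenbasis da (ptrace_b da db \<rho>) \<alpha>}"
    and corr_coh_nonneg: "0 \<le> corr_coh X da db \<rho>"
proof -
  show ne: "{coh_basis X da db \<rho> \<alpha> | \<alpha>. eigenbasis da (ptrace_b da db \<rho>) \<alpha>} \<noteq> {}"
    using eigenbasis_exists[of da db \<rho>] r by auto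
  have 0: "0 \<le> y" if "y \<in> {coh_basis X da db \<rho> \<alpha> | \<alpha>. eigenbasis da (ptrace_b da db \<rho>) \<alpha>}" for y
    using that coh_basis_nonneg[OF X _ r pos] by (auto simp: eigenbasis_def)
  then show "bdd_below {coh_basis X da db \<rho> \<alpha> | \<alpha>. eigenbasis da (ptrace_b da db \<rho>) \<alpha>}" by (rule bdd_belowI)
  show "0 \<le> corr_coh X da db \<rho>" unfolding corr_coh_def by (rule cInf_greatest[OF ne 0])
qed

lemma corr_coh_le_dist:
  assumes X: "X \<in> {fidelity, affinity}" and r: "density (da * db) \<rho>" and pos: "0 < da" "0 < db"
    and a: "eigenbasis da (ptrace_b da db \<rho>) \<alpha>" and s: "\<sigma> \<in> cq_states da db \<alpha>"
  shows "corr_coh X da db \<rho> \<le> dist_X X \<rho> \<sigma>"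
proof -
  have o: "onb da \<alpha>" using a by (simp add: eigenbasis_def)
  have "corr_coh X da db \<rho> \<le> coh_basis X da db \<rho> \<alpha>"
    unfolding corr_coh_def by (rule cInf_lower[OF _ corr_coh_bdd[OF X r pos]]) (use a in auto)
  also have "\<dots> \<le> dist_X X \<rho> \<sigma>"
    unfolding coh_basis_def by (rule cInf_lower[OF _ coh_basis_bdd[OF X o r pos]]) (use s in auto)
  finally show ?thesis .
qed

text \<open>Together with \<open>corr_coh_le_dist\<close> this removes the nested infimum: later
  arguments only handle pairs of an eigenbasis and a state classical in it.\<close>

lemma corr_coh_greatest:
  assumes X: "X \<in> {fidelity, affinity}" and r: "density (da * db) \<rho>" and pos: "0 < da" "0 < db"
    and le: "\<And>\<alpha> \<sigma>. eigenbasis da (ptrace_b da db \<rho>) \<alpha> \<Longrightarrow> \<sigma> \<in> cq_states da db \<alpha> \<Longrightarrow> c \<le> dist_X X \<rho> \<sigma>"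
  shows "c \<le> corr_coh X da db \<rho>"
  unfolding corr_coh_def
proof (rule cInf_greatest[OF corr_coh_nonempty[OF X r pos]])
  fix y assume "y \<in> {coh_basis X da db \<rho> \<alpha> | \<alpha>. eigenbasis da (ptrace_b da db \<rho>) \<alpha>}"
  then obtain \<alpha> where a: "eigenbasis da (ptrace_b da db \<rho>) \<alpha>" and y: "y = coh_basis X da db \<rho> \<alpha>" by auto
  have o: "onb da \<alpha>" using a by (simp add: eigenbasis_def)
  show "c \<le> y" unfolding y coh_basis_def
    by (rule cInf_greatest[OF coh_basis_nonempty[OF X o r pos]]) (use le[OF a] in auto)
qed

text \<open>\<open>T\<close> transports bases: it is the identity for a channel on b and
  multiplication by the first unitary for local unitaries. Each competitor for \<rho> becomes a
  competitor for \<Lambda> \<rho> with no smaller overlap, and nonnegativity lets the overlaps be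
  squared.\<close>

lemma corr_coh_mono:
  assumes X: "X \<in> {fidelity, affinity}" and r: "density (da * db) \<rho>" and pos: "0 < da" "0 < db" "0 < db'"
    and L: "chan2 (da * db) (da * db') \<Lambda>"
    and T: "\<And>\<alpha>. eigenbasis da (ptrace_b da db \<rho>) \<alpha> \<Longrightarrow> eigenbasis da (ptrace_b da db' (\<Lambda> \<rho>)) (T \<alpha>)"
    and C: "\<And>\<alpha> \<sigma>. onb da \<alpha> \<Longrightarrow> \<sigma> \<in> cq_states da db \<alpha> \<Longrightarrow> \<Lambda> \<sigma> \<in> cq_states da db' (T \<alpha>)"
  shows "corr_coh X da db' (\<Lambda> \<rho>) \<le> corr_coh X da db \<rho>"
proof (rule corr_coh_greatest[OF X r pos(1,2)])
  fix \<alpha> \<sigma> assume a: "eigenbasis da (ptrace_b da db \<rho>) \<alpha>" and s: "\<sigma> \<in> cq_states da db \<alpha>"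
  have o: "onb da \<alpha>" using a by (simp add: eigenbasis_def)
  have d: "density (da * db) \<sigma>" using s cqm_density[OF o] by (auto elim!: cq_statesE)
  have "corr_coh X da db' (\<Lambda> \<rho>) \<le> dist_X X (\<Lambda> \<rho>) (\<Lambda> \<sigma>)"
    by (rule corr_coh_le_dist[OF X chan2_density[OF L r] pos(1,3) T[OF a] C[OF o s]])
  also have "\<dots> \<le> dist_X X \<rho> \<sigma>"
    unfolding dist_X_def using overlap_chan2[OF X L, of \<rho> \<sigma>] overlap_nonneg[OF X, of "da * db" \<rho> \<sigma>] r d
    by (simp add: power_mono)
  finally show "corr_coh X da db' (\<Lambda> \<rho>) \<le> dist_X X \<rho> \<sigma>" .
qed

section \<open>Local channels and local unitaries\<close>

text \<open>The output dimension in (3) is arbitrary; trace preservation on the identity rules out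
  0.\<close>

lemma cptp_pos:
  assumes P: "cptp db db' \<Phi>" and "0 < db"
  shows "0 < db'"
proof (rule ccontr)
  assume "\<not> 0 < db'"
  then have "\<Phi> (1\<^sub>m db) \<in> carrier_mat 0 0" "mtrace (\<Phi> (1\<^sub>m db)) = mtrace (1\<^sub>m db :: complex mat)"
    using P by (auto simp: cptp_def)
  then show False using assms(2) by (simp add: mtrace_def)
qed

text \<open>Positivity of the map itself is complete positivity with a one-dimensional
  reference.\<close>

lemma cptp_density:
  assumes P: "cptp db db' \<Phi>" and s: "density db \<sigma>"
  shows "density db' (\<Phi> \<sigma>)"
proof -
  have c: "\<sigma> \<in> carrier_mat db db" using s by simp
  have "psd (1 * db') (id_tensor 1 db db' \<Phi> \<sigma>)"
    using P s unfolding cptp_def by (metis density_psd mult_1)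
  moreover have "block db 0 0 \<sigma> = \<sigma>" by (rule eq_matI) (use c in \<open>auto simp: block_def\<close>)
  then have "id_tensor 1 db db' \<Phi> \<sigma> = \<Phi> \<sigma>"
    using P c by (intro eq_matI) (auto simp: id_tensor_def cptp_def)
  ultimately show ?thesis using P s c by (simp add: density_def cptp_def)
qed

lemma id_tensor_kron:
  assumes P: "cptp db db' \<Phi>" and a: "a \<in> carrier_vec da" and s: "\<sigma> \<in> carrier_mat db db"
  shows "id_tensor da db db' \<Phi> (kron (proj a) \<sigma>) = kron (proj a) (\<Phi> \<sigma>)"
proof (rule eq_matI)
  have S: "\<Phi> \<sigma> \<in> carrier_mat db' db'" using P s by (simp add: cptp_def)
  fix r c assume "r < dim_row (kron (proj a) (\<Phi> \<sigma>))" "c < dim_col (kron (proj a) (\<Phi> \<sigma>))"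
  then have rc: "r < da * db'" "c < da * db'" using a S by (auto simp: kron_def proj_def)
  note d = divmod_less[OF rc(1)] divmod_less[OF rc(2)]
  have "block db (r div db') (c div db') (kron (proj a) \<sigma>) = (a $ (r div db') * cnj (a $ (c div db'))) \<cdot>\<^sub>m \<sigma>"
    by (rule eq_matI) (use a s d idx_less in \<open>auto simp: block_def kron_def proj_def\<close>)
  moreover have "\<Phi> ((a $ (r div db') * cnj (a $ (c div db'))) \<cdot>\<^sub>m \<sigma>) = (a $ (r div db') * cnj (a $ (c div db'))) \<cdot>\<^sub>m \<Phi> \<sigma>"
    using P s by (simp add: cptp_def)
  ultimately show "id_tensor da db db' \<Phi> (kron (proj a) \<sigma>) $$ (r, c) = kron (proj a) (\<Phi> \<sigma>) $$ (r, c)"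
    using rc d a S by (simp add: id_tensor_def kron_def proj_def)
qed (use a P s in \<open>auto simp: id_tensor_def kron_def proj_def cptp_def\<close>)

lemma chan2_cqm:
  assumes L: "chan2 (da * db) (da * db') \<Lambda>" and a: "onb da \<alpha>"
    and s: "\<And>i. i < da \<Longrightarrow> \<sigma> i \<in> carrier_mat db db"
    and K: "\<And>i. i < da \<Longrightarrow> \<Lambda> (kron (proj (\<alpha> i)) (\<sigma> i)) = kron (proj (\<beta> i)) (\<tau> i)"
  shows "\<Lambda> (cqm da db \<alpha> p \<sigma>) = cqm da db' \<beta> p \<tau>"
proof -
  have ac: "\<alpha> i \<in> carrier_vec da" if "i < da" for i using a that by (auto simp: onb_def)
  have "\<Lambda> (cqm da db \<alpha> p \<sigma>) = msum (da * db') (\<lambda>i. \<Lambda> (complex_of_real (p i) \<cdot>\<^sub>m kron (proj (\<alpha> i)) (\<sigma> i))) {..<da}"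
    unfolding cqm_def by (rule chan2_msum[OF L]) (use kron_proj_carrier ac s in auto)
  also have "\<dots> = cqm da db' \<beta> p \<tau>"
    unfolding cqm_def by (rule msum_cong) (use chan2D(3)[OF L] kron_proj_carrier ac s K in auto)
  finally show ?thesis .
qed

text \<open>Entry (i, j) of the reduced state is the trace of block (i, j), which the map preserves;
  the admissible eigenbases are therefore the same before and after.\<close>

lemma ptrace_id_tensor:
  assumes P: "cptp db db' \<Phi>"
  shows "ptrace_b da db' (id_tensor da db db' \<Phi> \<rho>) = ptrace_b da db \<rho>"
proof (rule eq_matI)
  fix i j assume "i < dim_row (ptrace_b da db \<rho>)" "j < dim_col (ptrace_b da db \<rho>)"
  then have ij: "i < da" "j < da" by (auto simp: ptrace_b_def)
  have B: "block db i j \<rho> \<in> carrier_mat db db" by (simp add: block_def)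
  then have "dim_row (\<Phi> (block db i j \<rho>)) = db'" "mtrace (\<Phi> (block db i j \<rho>)) = mtrace (block db i j \<rho>)"
    using P by (auto simp: cptp_def)
  then show "ptrace_b da db' (id_tensor da db db' \<Phi> \<rho>) $$ (i, j) = ptrace_b da db \<rho> $$ (i, j)"
    using ij idx_less[OF ij(1)] idx_less[OF ij(2)] by (simp add: ptrace_b_def id_tensor_def mtrace_def) (simp add: block_def)
qed (auto simp: ptrace_b_def)

lemma corr_coh_cptp:
  assumes X: "X \<in> {fidelity, affinity}" and r: "density (da * db) \<rho>" and pos: "0 < da" "0 < db"
    and P: "cptp db db' \<Phi>"
  shows "corr_coh X da db' (id_tensor da db db' \<Phi> \<rho>) \<le> corr_coh X da db \<rho>"
proof (rule corr_coh_mono[where T = "\<lambda>\<alpha>. \<alpha>", OF X r pos cptp_pos[OF P pos(2)] id_tensor_chan2[OF P]])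
  fix \<alpha> \<sigma> assume a: "onb da \<alpha>" and "\<sigma> \<in> cq_states da db \<alpha>"
  then obtain p s where s: "\<sigma> = cqm da db \<alpha> p s" "prob_vec da p" "\<And>i. i < da \<Longrightarrow> density db (s i)"
    by (auto elim!: cq_statesE)
  have ac: "\<alpha> i \<in> carrier_vec da" if "i < da" for i using a that by (auto simp: onb_def)
  have "id_tensor da db db' \<Phi> \<sigma> = cqm da db' \<alpha> p (\<lambda>i. \<Phi> (s i))"
    unfolding s(1) by (rule chan2_cqm[OF id_tensor_chan2[OF P] a])
      (use id_tensor_kron[OF P ac] s(3) in auto)
  then show "id_tensor da db db' \<Phi> \<sigma> \<in> cq_states da db' \<alpha>"
    using cq_statesI[OF s(2), of db' "\<lambda>i. \<Phi> (s i)"] cptp_density[OF P s(3)] by simp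
qed (simp add: ptrace_id_tensor[OF P])

section \<open>Local unitaries\<close>

lemma chan2_conj:
  assumes U: "unitary n U"
  shows "chan2 n n (\<lambda>A. U * A * adj U)"
proof -
  have Uc: "U \<in> carrier_mat n n" and UU: "adj U * U = 1\<^sub>m n" using U by (auto simp: unitary_def)
  note d = carrier_matD[OF Uc]
  show ?thesis
    unfolding chan2_def
  proof (intro conjI ballI allI impI)
    fix A :: "complex mat" assume A: "A \<in> carrier_mat n n"
    show "U * A * adj U \<in> carrier_mat n n" using Uc A by auto
    show "U * (A + B) * adj U = U * A * adj U + U * B * adj U" if B: "B \<in> carrier_mat n n" for B
      using add_mult_distrib_mat[OF mult_carrier_mat[OF Uc A] mult_carrier_mat[OF Uc B] adj_carrier[OF Uc]] Uc A B
      by (simp add: mult_add_distrib_mat[of _ n n])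
    show "U * (c \<cdot>\<^sub>m A) * adj U = c \<cdot>\<^sub>m (U * A * adj U)" for c
      using mult_smult_assoc_mat[OF mult_carrier_mat[OF Uc A] adj_carrier[OF Uc]] Uc A
      by (simp add: mult_smult_distrib[of _ n n])
    have "mtrace (U * A * adj U) = mtrace (adj U * (U * A))" using Uc A by (intro mtrace_comm) auto
    also have "adj U * (U * A) = A" using Uc A UU by (simp flip: mat_mult_assoc)
    finally show "mtrace (U * A * adj U) = mtrace A" .
    fix B C D :: "complex mat" assume BCD: "B \<in> carrier_mat n n" "C \<in> carrier_mat n n" "D \<in> carrier_mat n n"
      and p: "psd (n + n) (four_block_mat A B C D)"
    \<comment> \<open>Conjugating the four blocks by U is conjugating the block matrix by diag (U,
      U), which preserves positivity.\<close>
    define O2 where "O2 = (0\<^sub>m n n :: complex mat)"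
    define V where "V = four_block_mat U O2 O2 U"
    have O2: "O2 \<in> carrier_mat n n" by (simp add: O2_def)
    have V: "V \<in> carrier_mat (n + n) (n + n)" using Uc by (auto simp: V_def)
    have "adj V = four_block_mat (adj U) O2 O2 (adj U)"
      by (rule eq_matI) (use Uc in \<open>auto simp: V_def O2_def\<close>)
    moreover have "V * four_block_mat A B C D = four_block_mat (U * A) (U * B) (U * C) (U * D)"
      unfolding V_def
      by (subst mult_four_block_mat[of _ n n _ n _ n _ _ n _ n]) (use Uc A BCD O2 in \<open>auto simp: O2_def\<close>)
    moreover have "four_block_mat (U * A) (U * B) (U * C) (U * D) * four_block_mat (adj U) O2 O2 (adj U)
      = four_block_mat (U * A * adj U) (U * B * adj U) (U * C * adj U) (U * D * adj U)"
      by (subst mult_four_block_mat[of _ n n _ n _ n _ _ n _ n]) (use Uc A BCD O2 in \<open>auto simp: O2_def\<close>)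
    ultimately show "psd (n + n) (four_block_mat (U * A * adj U) (U * B * adj U) (U * C * adj U) (U * D * adj U))"
      using psd_conj[OF p V] by simp
  qed
qed

lemma kron_dim [simp]: "dim_row (kron A B) = dim_row A * dim_row B" "dim_col (kron A B) = dim_col A * dim_col B"
  by (auto simp: kron_def)

lemma kron_mult:
  assumes "dim_col A = dim_row C" "dim_col B = dim_row D"
  shows "kron A B * kron C D = kron (A * C) (B * D)"
proof (rule eq_matI)
  fix i j assume "i < dim_row (kron (A * C) (B * D))" "j < dim_col (kron (A * C) (B * D))"
  then have ij: "i < dim_row A * dim_row B" "j < dim_col C * dim_col D" by auto
  note d = divmod_less[OF ij(1)] divmod_less[OF ij(2)]
  have "(kron A B * kron C D) $$ (i, j) = (\<Sum>k<dim_row C * dim_row D.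
     (\<lambda>x y. (A $$ (i div dim_row B, x) * C $$ (x, j div dim_col D)) * (B $$ (i mod dim_row B, y) * D $$ (y, j mod dim_col D)))
       (k div dim_row D) (k mod dim_row D))"
    using ij assms by (subst mat_mult_index) (auto simp: kron_def mult_ac intro!: sum.cong)
  also have "\<dots> = (A * C) $$ (i div dim_row B, j div dim_col D) * (B * D) $$ (i mod dim_row B, j mod dim_col D)"
    using assms d by (subst sum_divmod) (simp add: mat_mult_index sum_product del: index_mult_mat(1))
  also have "\<dots> = kron (A * C) (B * D) $$ (i, j)" using ij by (simp add: kron_def del: index_mult_mat(1))
  finally show "(kron A B * kron C D) $$ (i, j) = kron (A * C) (B * D) $$ (i, j)" .
qed auto

lemma kron_adj: "adj (kron A B) = kron (adj A) (adj B)"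
proof (rule eq_matI)
  fix i j assume "i < dim_row (kron (adj A) (adj B))" "j < dim_col (kron (adj A) (adj B))"
  then have ij: "i < dim_col A * dim_col B" "j < dim_row A * dim_row B" by auto
  then show "adj (kron A B) $$ (i, j) = kron (adj A) (adj B) $$ (i, j)"
    using divmod_less[OF ij(1)] divmod_less[OF ij(2)] by (simp add: kron_def)
qed auto

lemma kron_one: "kron (1\<^sub>m m) (1\<^sub>m n) = (1\<^sub>m (m * n) :: complex mat)"
proof (rule eq_matI)
  fix i j assume "i < dim_row (1\<^sub>m (m * n) :: complex mat)" "j < dim_col (1\<^sub>m (m * n) :: complex mat)"
  then have ij: "i < m * n" "j < m * n" by auto
  have "i = j \<longleftrightarrow> i div n = j div n \<and> i mod n = j mod n" by (metis div_mult_mod_eq)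
  then show "kron (1\<^sub>m m) (1\<^sub>m n) $$ (i, j) = (1\<^sub>m (m * n) :: complex mat) $$ (i, j)"
    using ij divmod_less[OF ij(1)] divmod_less[OF ij(2)] by (auto simp: kron_def)
qed auto

lemma unitary_kron:
  assumes "unitary m U" "unitary n V"
  shows "unitary (m * n) (kron U V)"
  using assms by (auto simp: unitary_def kron_adj kron_mult kron_one)

lemma unitary_adj: "unitary n U \<Longrightarrow> unitary n (adj U)"
  using mat_mult_left_right_inverse[of "adj U" n U] by (auto simp: unitary_def)

lemma proj_conj:
  assumes "dim_vec a = dim_col U"
  shows "U * proj a * adj U = proj (U *\<^sub>v a)"
proof (rule eq_matI)
  fix i j assume "i < dim_row (proj (U *\<^sub>v a))" "j < dim_col (proj (U *\<^sub>v a))"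
  then have ij: "i < dim_row U" "j < dim_row U" by (auto simp: proj_def)
  have pd: "dim_row (proj a) = dim_vec a" "dim_col (proj a) = dim_vec a" by (auto simp: proj_def)
  have "(U * proj a * adj U) $$ (i, j) = (\<Sum>l<dim_vec a. (\<Sum>k<dim_vec a. U $$ (i, k) * a $ k) * cnj (U $$ (j, l) * a $ l))"
  proof -
    have 1: "(U * proj a) $$ (i, l) = (\<Sum>k<dim_vec a. U $$ (i, k) * a $ k) * cnj (a $ l)" if "l < dim_vec a" for l
      using ij assms pd that by (subst mat_mult_index) (auto simp: proj_def sum_distrib_right mult.assoc intro!: sum.cong)
    have "(U * proj a * adj U) $$ (i, j) = (\<Sum>l<dim_vec a. (U * proj a) $$ (i, l) * adj U $$ (l, j))"
      using ij assms pd by (subst mat_mult_index) auto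
    then show ?thesis using ij assms by (simp add: 1 mult_ac del: index_mult_mat(1))
  qed
  also have "\<dots> = (U *\<^sub>v a) $ i * cnj ((U *\<^sub>v a) $ j)"
    using ij assms by (simp add: mat_vec_index sum_distrib_left[symmetric] del: index_mult_mat_vec)
  also have "\<dots> = proj (U *\<^sub>v a) $$ (i, j)" using ij by (simp add: proj_def)
  finally show "(U * proj a * adj U) $$ (i, j) = proj (U *\<^sub>v a) $$ (i, j)" .
qed (auto simp: proj_def)

text \<open>The partial trace as adjoint of M -> M \<otimes> 1; reduced states can then be computed
  by cyclicity of the trace instead of by indices.\<close>

lemma ptrace_dual:
  assumes r: "\<rho> \<in> carrier_mat (da * db) (da * db)" and M: "M \<in> carrier_mat da da"
  shows "mtrace (\<rho> * kron M (1\<^sub>m db)) = mtrace (ptrace_b da db \<rho> * M)"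
proof -
  have "mtrace (\<rho> * kron M (1\<^sub>m db)) = (\<Sum>s<da * db. \<Sum>t<da * db. \<rho> $$ (s, t) * kron M (1\<^sub>m db) $$ (t, s))"
    using r M by (auto simp: mtrace_def mat_mult_index simp del: index_mult_mat(1) intro!: sum.cong)
  also have "\<dots> = (\<Sum>s<da * db. \<Sum>j<da. \<rho> $$ (s, j * db + s mod db) * M $$ (j, s div db))"
  proof (rule sum.cong)
    fix s assume "s \<in> {..<da * db}"
    then have s: "s < da * db" by simp
    note d = divmod_less[OF s]
    have "(\<Sum>t<da * db. \<rho> $$ (s, t) * kron M (1\<^sub>m db) $$ (t, s)) = (\<Sum>t<da * db.
       (\<lambda>j l. if l = s mod db then \<rho> $$ (s, j * db + l) * M $$ (j, s div db) else 0) (t div db) (t mod db))"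
    proof (intro sum.cong refl)
      fix t assume "t \<in> {..<da * db}"
      then have t: "t < da * db" by simp
      show "\<rho> $$ (s, t) * kron M (1\<^sub>m db) $$ (t, s) = (\<lambda>j l. if l = s mod db then \<rho> $$ (s, j * db + l) * M $$ (j, s div db) else 0) (t div db) (t mod db)"
      proof (cases "t mod db = s mod db")
        case True
        then have "t div db * db + s mod db = t" using div_mult_mod_eq[of t db] by simp
        then show ?thesis using s t M d divmod_less[OF t] True by (simp add: kron_def)
      qed (use s t M d divmod_less[OF t] in \<open>simp add: kron_def\<close>)
    qed
    also have "\<dots> = (\<Sum>j<da. \<rho> $$ (s, j * db + s mod db) * M $$ (j, s div db))"
      using d by (subst sum_divmod) simp
    finally show "(\<Sum>t<da * db. \<rho> $$ (s, t) * kron M (1\<^sub>m db) $$ (t, s)) = (\<Sum>j<da. \<rho> $$ (s, j * db + s mod db) * M $$ (j, s div db))" .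
  qed simp
  also have "\<dots> = (\<Sum>s<da * db. (\<lambda>i k. \<Sum>j<da. \<rho> $$ (i * db + k, j * db + k) * M $$ (j, i)) (s div db) (s mod db))"
    by simp
  also have "\<dots> = (\<Sum>i<da. \<Sum>k<db. \<Sum>j<da. \<rho> $$ (i * db + k, j * db + k) * M $$ (j, i))"
    by (rule sum_divmod)
  also have "\<dots> = (\<Sum>i<da. \<Sum>j<da. \<Sum>k<db. \<rho> $$ (i * db + k, j * db + k) * M $$ (j, i))"
    by (intro sum.cong refl sum.swap)
  also have "\<dots> = (\<Sum>i<da. \<Sum>j<da. ptrace_b da db \<rho> $$ (i, j) * M $$ (j, i))"
    by (simp add: ptrace_b_def sum_distrib_right)
  also have "\<dots> = mtrace (ptrace_b da db \<rho> * M)"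
    using M carrier_matD[OF ptrace_carrier[of da db \<rho>]] by (simp add: mtrace_def mat_mult_index del: index_mult_mat(1))
  finally show ?thesis .
qed

lemma mat_eq_trace:
  assumes A: "A \<in> carrier_mat n n" "B \<in> carrier_mat n n"
    and eq: "\<And>M. M \<in> carrier_mat n n \<Longrightarrow> mtrace (A * M) = mtrace (B * M)"
  shows "A = B"
proof (rule eq_matI)
  fix i j assume "i < dim_row B" "j < dim_col B"
  then have ij: "i < n" "j < n" using A by auto
  define M where "M = mat n n (\<lambda>p. if p = (j, i) then 1 else 0 :: complex)"
  have "mtrace (C * M) = C $$ (i, j)" if C: "C \<in> carrier_mat n n" for C
  proof -
    have "mtrace (C * M) = (\<Sum>s<n. \<Sum>t<n. if t = j then (if s = i then C $$ (s, t) else 0) else 0)"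
      using C by (auto simp: M_def mtrace_def mat_mult_index simp del: index_mult_mat(1) intro!: sum.cong) (auto simp: if_distrib[of "\<lambda>x. _ * x"] if_distrib[of "\<lambda>x. x * _"] cong: if_cong)
    then show ?thesis using ij by simp
  qed
  then show "A $$ (i, j) = B $$ (i, j)" using eq[of M] A by (simp add: M_def)
qed (use A in auto)

text \<open>Tested against M: moving the unitaries onto M \<otimes> 1 by cyclicity, the second one
  cancels and the first conjugates M.\<close>

lemma ptrace_conj:
  assumes r: "\<rho> \<in> carrier_mat (da * db) (da * db)" and U: "unitary da Ua" "unitary db Ub"
  shows "ptrace_b da db (kron Ua Ub * \<rho> * adj (kron Ua Ub)) = Ua * ptrace_b da db \<rho> * adj Ua"
proof (rule mat_eq_trace)
  let ?U = "kron Ua Ub"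
  have Ua: "Ua \<in> carrier_mat da da" and Ub: "Ub \<in> carrier_mat db db" "adj Ub * Ub = 1\<^sub>m db" using U by (auto simp: unitary_def)
  have Uc: "?U \<in> carrier_mat (da * db) (da * db)" using Ua Ub by auto
  show "Ua * ptrace_b da db \<rho> * adj Ua \<in> carrier_mat da da" using Ua ptrace_carrier[of da db \<rho>] by (metis adj_carrier mult_carrier_mat)
  fix M :: "complex mat" assume M: "M \<in> carrier_mat da da"
  note d = carrier_matD[OF Ua] carrier_matD[OF Ub(1)] carrier_matD[OF r] carrier_matD[OF M]
  have "mtrace (ptrace_b da db (?U * \<rho> * adj ?U) * M) = mtrace (?U * \<rho> * adj ?U * kron M (1\<^sub>m db))"
    by (rule ptrace_dual[symmetric, OF _ M], rule carrier_matI) (use d in auto)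
  also have "\<dots> = mtrace (?U * (\<rho> * adj ?U * kron M (1\<^sub>m db)))" using d by (simp add: mat_mult_assoc)
  also have "\<dots> = mtrace (\<rho> * adj ?U * kron M (1\<^sub>m db) * ?U)" using d by (intro mtrace_comm) auto
  also have "\<rho> * adj ?U * kron M (1\<^sub>m db) * ?U = \<rho> * (kron (adj Ua) (adj Ub) * kron M (1\<^sub>m db) * kron Ua Ub)"
    using d by (simp add: mat_mult_assoc kron_adj)
  also have "kron (adj Ua) (adj Ub) * kron M (1\<^sub>m db) * kron Ua Ub = kron (adj Ua * M * Ua) (1\<^sub>m db)"
    using d Ub by (simp add: kron_mult)
  also have "mtrace (\<rho> * kron (adj Ua * M * Ua) (1\<^sub>m db)) = mtrace (ptrace_b da db \<rho> * (adj Ua * M * Ua))"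
    by (rule ptrace_dual[OF r]) (use Ua M in auto)
  also have "\<dots> = mtrace (ptrace_b da db \<rho> * adj Ua * M * Ua)"
    using d carrier_matD[OF ptrace_carrier[of da db \<rho>]] by (simp add: mat_mult_assoc)
  also have "\<dots> = mtrace (Ua * (ptrace_b da db \<rho> * adj Ua * M))"
    using d carrier_matD[OF ptrace_carrier[of da db \<rho>]] by (intro mtrace_comm) auto
  also have "\<dots> = mtrace (Ua * ptrace_b da db \<rho> * adj Ua * M)"
    using d carrier_matD[OF ptrace_carrier[of da db \<rho>]] by (simp add: mat_mult_assoc)
  finally show "mtrace (ptrace_b da db (?U * \<rho> * adj ?U) * M) = mtrace (Ua * ptrace_b da db \<rho> * adj Ua * M)" .
qed simp

lemma eigenbasis_conj:
  assumes A: "A \<in> carrier_mat n n" and U: "unitary n U" and e: "eigenbasis n A \<alpha>"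
  shows "eigenbasis n (U * A * adj U) (\<lambda>i. U *\<^sub>v \<alpha> i)"
  unfolding eigenbasis_def onb_def
proof (intro conjI allI impI)
  have Uc: "U \<in> carrier_mat n n" and UU: "adj U * U = 1\<^sub>m n" using U by (auto simp: unitary_def)
  note d = carrier_matD[OF Uc] carrier_matD[OF A]
  have o: "onb n \<alpha>" and ev: "\<And>i. i < n \<Longrightarrow> \<exists>c. A *\<^sub>v \<alpha> i = c \<cdot>\<^sub>v \<alpha> i" using e by (auto simp: eigenbasis_def)
  have ac: "\<alpha> i \<in> carrier_vec n" if "i < n" for i using o that by (auto simp: onb_def)
  fix i assume i: "i < n"
  show "U *\<^sub>v \<alpha> i \<in> carrier_vec n" using d by simp
  show "cinner (U *\<^sub>v \<alpha> i) (U *\<^sub>v \<alpha> j) = (if i = j then 1 else 0)" if j: "j < n" for j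
    using cinner_gram[of "\<alpha> i" U "\<alpha> j"] d ac[OF i] ac[OF j] UU onb_cinner[OF o i j] by simp
  obtain c where c: "A *\<^sub>v \<alpha> i = c \<cdot>\<^sub>v \<alpha> i" using ev[OF i] by auto
  have "U * A * adj U *\<^sub>v (U *\<^sub>v \<alpha> i) = U *\<^sub>v (A *\<^sub>v (adj U * U *\<^sub>v \<alpha> i))"
    using d ac[OF i] by (simp add: mat_mult_vec_assoc)
  also have "\<dots> = c \<cdot>\<^sub>v (U *\<^sub>v \<alpha> i)" using ac[OF i] Uc by (simp add: UU c mult_mat_vec[of _ n n])
  finally show "\<exists>c. U * A * adj U *\<^sub>v (U *\<^sub>v \<alpha> i) = c \<cdot>\<^sub>v (U *\<^sub>v \<alpha> i)" by blast
qed

lemma corr_coh_conj_le: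
  assumes X: "X \<in> {fidelity, affinity}" and r: "density (da * db) \<rho>" and pos: "0 < da" "0 < db"
    and U: "unitary da Ua" "unitary db Ub"
  shows "corr_coh X da db (kron Ua Ub * \<rho> * adj (kron Ua Ub)) \<le> corr_coh X da db \<rho>"
proof (rule corr_coh_mono[where T = "\<lambda>\<alpha> i. Ua *\<^sub>v \<alpha> i" and \<Lambda> = "\<lambda>A. kron Ua Ub * A * adj (kron Ua Ub)", OF X r pos pos(2) chan2_conj[OF unitary_kron[OF U]]])
  show "eigenbasis da (ptrace_b da db (kron Ua Ub * \<rho> * adj (kron Ua Ub))) (\<lambda>i. Ua *\<^sub>v \<alpha> i)"
    if "eigenbasis da (ptrace_b da db \<rho>) \<alpha>" for \<alpha>
    using eigenbasis_conj[OF ptrace_carrier U(1) that] ptrace_conj[OF _ U, of \<rho>] r by simp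
  fix \<alpha> \<sigma> assume a: "onb da \<alpha>" and "\<sigma> \<in> cq_states da db \<alpha>"
  then obtain p s where s: "\<sigma> = cqm da db \<alpha> p s" "prob_vec da p" "\<And>i. i < da \<Longrightarrow> density db (s i)"
    by (auto elim!: cq_statesE)
  have ac: "\<alpha> i \<in> carrier_vec da" if "i < da" for i using a that by (auto simp: onb_def)
  have Uc: "Ua \<in> carrier_mat da da" "Ub \<in> carrier_mat db db" using U by (auto simp: unitary_def)
  have "kron Ua Ub * cqm da db \<alpha> p s * adj (kron Ua Ub) = cqm da db (\<lambda>i. Ua *\<^sub>v \<alpha> i) p (\<lambda>i. Ub * s i * adj Ub)"
  proof (rule chan2_cqm[OF chan2_conj[OF unitary_kron[OF U]] a])
    fix i assume i: "i < da"
    show "s i \<in> carrier_mat db db" using s(3)[OF i] by simp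
    then show "kron Ua Ub * kron (proj (\<alpha> i)) (s i) * adj (kron Ua Ub) = kron (proj (Ua *\<^sub>v \<alpha> i)) (Ub * s i * adj Ub)"
      using Uc ac[OF i] proj_conj[of "\<alpha> i" Ua] by (simp add: kron_adj kron_mult proj_def[of "\<alpha> i"])
  qed
  moreover have "density db (Ub * s i * adj Ub)" if "i < da" for i
    by (rule chan2_density[OF chan2_conj[OF U(2)] s(3)[OF that]])
  ultimately show "kron Ua Ub * \<sigma> * adj (kron Ua Ub) \<in> cq_states da db (\<lambda>i. Ua *\<^sub>v \<alpha> i)"
    using cq_statesI[OF s(2), of db "\<lambda>i. Ub * s i * adj Ub"] s(1) by simp
qed

lemma corr_coh_conj:
  assumes X: "X \<in> {fidelity, affinity}" and r: "density (da * db) \<rho>" and pos: "0 < da" "0 < db"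
    and U: "unitary da Ua" "unitary db Ub"
  shows "corr_coh X da db (kron Ua Ub * \<rho> * adj (kron Ua Ub)) = corr_coh X da db \<rho>"
proof (rule antisym)
  show "corr_coh X da db (kron Ua Ub * \<rho> * adj (kron Ua Ub)) \<le> corr_coh X da db \<rho>"
    by (rule corr_coh_conj_le[OF assms])
  let ?U = "kron Ua Ub"
  note uk = unitary_kron[OF U]
  have Uc: "?U \<in> carrier_mat (da * db) (da * db)" and UU: "adj ?U * ?U = 1\<^sub>m (da * db)" using uk by (auto simp: unitary_def)
  have rc: "\<rho> \<in> carrier_mat (da * db) (da * db)" using r by simp
  have k: "kron (adj Ua) (adj Ub) = adj ?U" by (simp add: kron_adj)
  \<comment> \<open>The reverse inequality is the first one for the rotated state and the inverse
    unitaries.\<close>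
  have "corr_coh X da db (kron (adj Ua) (adj Ub) * (?U * \<rho> * adj ?U) * adj (kron (adj Ua) (adj Ub))) \<le> corr_coh X da db (?U * \<rho> * adj ?U)"
    by (rule corr_coh_conj_le[OF X chan2_density[OF chan2_conj[OF uk] r] pos unitary_adj[OF U(1)] unitary_adj[OF U(2)]])
  also have "kron (adj Ua) (adj Ub) * (?U * \<rho> * adj ?U) * adj (kron (adj Ua) (adj Ub)) = (adj ?U * ?U) * \<rho> * (adj ?U * ?U)"
    unfolding k using carrier_matD[OF Uc] carrier_matD[OF rc] by (simp add: mat_mult_assoc del: kron_dim)
  also have "\<dots> = \<rho>" unfolding UU using rc by simp
  finally show "corr_coh X da db \<rho> \<le> corr_coh X da db (?U * \<rho> * adj ?U)" .
qed

section \<open>Faithfulness\<close>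

lemma bounded_real_subseq:
  fixes f :: "nat \<Rightarrow> real"
  assumes "\<And>n. \<bar>f n\<bar> \<le> B"
  shows "\<exists>r l. strict_mono r \<and> (\<lambda>n. f (r n)) \<longlonglongrightarrow> l"
proof -
  obtain r where r: "strict_mono r" "monoseq (\<lambda>n. f (r n))" using seq_monosub[of f] by auto
  have "Bseq (\<lambda>n. f (r n))" using assms by (intro BseqI'[of _ B]) auto
  then have "convergent (\<lambda>n. f (r n))" using r(2) by (rule Bseq_monoseq_convergent)
  then show ?thesis using r(1) by (auto simp: convergent_def)
qed

lemma finite_family_real_subseq:
  fixes f :: "nat \<Rightarrow> 'i \<Rightarrow> real"
  assumes "finite I" "\<And>n i. i \<in> I \<Longrightarrow> \<bar>f n i\<bar> \<le> B"
  shows "\<exists>r l. strict_mono r \<and> (\<forall>i\<in>I. (\<lambda>n. f (r n) i) \<longlonglongrightarrow> l i)"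
  using assms
proof (induction I)
  case empty
  then show ?case by (auto intro: strict_mono_id[unfolded id_def] exI[of _ "\<lambda>n. n"])
next
  case (insert a I)
  then obtain r l where r: "strict_mono r" "\<forall>i\<in>I. (\<lambda>n. f (r n) i) \<longlonglongrightarrow> l i" by auto
  obtain r' l' where r': "strict_mono r'" "(\<lambda>n. f (r (r' n)) a) \<longlonglongrightarrow> l'"
    using bounded_real_subseq[of "\<lambda>n. f (r n) a" B] insert by auto
  have "(\<lambda>n. f ((r \<circ> r') n) i) \<longlonglongrightarrow> (l(a := l')) i" if "i \<in> insert a I" for i
  proof (cases "i = a")
    case False
    then have "(\<lambda>n. f (r n) i) \<longlonglongrightarrow> l i" using that r by auto
    from LIMSEQ_subseq_LIMSEQ[OF this r'(1)] show ?thesis using False by (simp add: o_def)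
  qed (use r' in auto)
  moreover have "strict_mono (r \<circ> r')" using r r' by (simp add: strict_mono_o)
  ultimately show ?case by blast
qed

lemma finite_family_complex_subseq:
  fixes f :: "nat \<Rightarrow> 'i \<Rightarrow> complex"
  assumes "finite I" "\<And>n i. i \<in> I \<Longrightarrow> cmod (f n i) \<le> B"
  shows "\<exists>r l. strict_mono r \<and> (\<forall>i\<in>I. (\<lambda>n. f (r n) i) \<longlonglongrightarrow> l i)"
proof -
  let ?g = "\<lambda>n (i, b). if b then Re (f n i) else Im (f n i)"
  have "\<exists>r l. strict_mono r \<and> (\<forall>i\<in>I \<times> {True, False}. (\<lambda>n. ?g (r n) i) \<longlonglongrightarrow> l i)"
    by (rule finite_family_real_subseq[where B = B])
      (use assms abs_Re_le_cmod abs_Im_le_cmod order_trans in \<open>fastforce split: if_splits\<close>)+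
  then obtain r l where r: "strict_mono r" "\<And>i b. i \<in> I \<Longrightarrow> (\<lambda>n. ?g (r n) (i, b)) \<longlonglongrightarrow> l (i, b)" by blast
  have "(\<lambda>n. f (r n) i) \<longlonglongrightarrow> Complex (l (i, True)) (l (i, False))" if "i \<in> I" for i
    using tendsto_Complex[OF r(2)[OF that, of True] r(2)[OF that, of False]] by simp
  then show ?thesis using r(1) by (intro exI[of _ r] exI[of _ "\<lambda>i. Complex (l (i, True)) (l (i, False))"]) simp
qed

lemma onb_entry_le:
  assumes "onb n e" "i < n" "j < n"
  shows "cmod (e i $ j) \<le> 1"
proof -
  have "(cmod (e i $ j))\<^sup>2 \<le> (\<Sum>k<n. (cmod (e i $ k))\<^sup>2)" by (rule member_le_sum) (use assms in auto)
  also have "\<dots> = 1" using onb_nrm2[OF assms(1,2)] onb_dim[OF assms(1,2)] by (simp add: nrm2_def)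
  finally show ?thesis by (simp add: power_le_one_iff)
qed

lemma density_entry_le:
  assumes "density n \<sigma>" "i < n" "j < n"
  shows "cmod (\<sigma> $$ (i, j)) \<le> 1"
proof -
  have p: "psd n \<sigma>" using assms by simp
  have 1: "Re (\<sigma> $$ (k, k)) \<le> 1" "0 \<le> Re (\<sigma> $$ (k, k))" if "k < n" for k
    using psd_diag_le_trace[OF p that] psd_diag_nonneg[OF p that] assms by (auto simp: density_def)
  have "(cmod (\<sigma> $$ (i, j)))\<^sup>2 \<le> Re (\<sigma> $$ (i, i)) * Re (\<sigma> $$ (j, j))"
    using psd_cauchy_schwarz[OF p, of "unit_vec n i" "unit_vec n j"] assms by (simp add: cinner_unit_mat)
  also have "\<dots> \<le> 1 * 1" using 1 assms by (intro mult_mono) auto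
  finally show ?thesis by (simp add: power_le_one_iff)
qed

lemma cqm_index:
  assumes "a < da * db" "b < da * db" "\<And>i. i < da \<Longrightarrow> \<alpha> i \<in> carrier_vec da" "\<And>i. i < da \<Longrightarrow> \<sigma> i \<in> carrier_mat db db"
  shows "cqm da db \<alpha> p \<sigma> $$ (a, b) =
    (\<Sum>i<da. of_real (p i) * (\<alpha> i $ (a div db) * cnj (\<alpha> i $ (b div db)) * \<sigma> i $$ (a mod db, b mod db)))"
  using assms(1,2) carrier_vecD[OF assms(3)] carrier_matD[OF assms(4)] divmod_less[OF assms(1)] divmod_less[OF assms(2)]
  by (simp add: cqm_def msum_def kron_def proj_def)

text \<open>Basis entries, weights and entries of the states are all bounded by 1, so along one
  subsequence all of them converge. The defining equations and inequalities are closed conditions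
  and pass to the limit, as does the formula for the entries of the state.\<close>

lemma cqm_closed:
  assumes a: "\<And>n. onb da (\<alpha> n)" and p: "\<And>n. prob_vec da (p n)" and s: "\<And>n i. i < da \<Longrightarrow> density db (s n i)"
    and r: "\<rho> \<in> carrier_mat (da * db) (da * db)"
    and lim: "\<And>u v. u < da * db \<Longrightarrow> v < da * db \<Longrightarrow> (\<lambda>n. cqm da db (\<alpha> n) (p n) (s n) $$ (u, v)) \<longlonglongrightarrow> \<rho> $$ (u, v)"
  shows "\<exists>\<alpha> p s. onb da \<alpha> \<and> prob_vec da p \<and> (\<forall>i<da. density db (s i)) \<and> \<rho> = cqm da db \<alpha> p s"
proof -
  \<comment> \<open>All parameters packed into one complex family: tag 0 for the basis, 1 for the
    weights, 2 for the states, and 0 as value at meaningless indices.\<close>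
  define f :: "nat \<Rightarrow> nat \<times> nat \<times> nat \<times> nat \<Rightarrow> complex" where "f n = (\<lambda>(t, i, j, k).
    if t = 0 then (if i < da \<and> j < da then \<alpha> n i $ j else 0)
    else if t = 1 then (if i < da then of_real (p n i) else 0)
    else (if i < da \<and> j < db \<and> k < db then s n i $$ (j, k) else 0))" for n
  \<comment> \<open>One box containing every index in use: j runs below \<open>da\<close> for basis
    vectors and below \<open>db\<close> for states, and the slots j = 0, k = 0 serve as
    dummies.\<close>
  define I where "I = {..<3::nat} \<times> {..<da} \<times> {..<Suc (da + db)} \<times> {..<Suc db}"
  have p1: "\<bar>p n i\<bar> \<le> 1" if "i < da" for n i
  proof -
    have "p n i \<le> (\<Sum>k<da. p n k)" by (rule member_le_sum) (use p[of n] that in \<open>auto simp: prob_vec_def\<close>)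
    then show ?thesis using p[of n] that by (auto simp: prob_vec_def)
  qed
  have "cmod (f n x) \<le> 1" for n x
    using onb_entry_le[OF a] p1 density_entry_le[OF s] by (cases x) (auto simp: f_def)
  then have "\<exists>q l. strict_mono q \<and> (\<forall>x\<in>I. (\<lambda>n. f (q n) x) \<longlonglongrightarrow> l x)"
    by (intro finite_family_complex_subseq[of I f 1]) (simp add: I_def)
  then obtain q l where q: "strict_mono q" and l: "\<And>x. x \<in> I \<Longrightarrow> (\<lambda>n. f (q n) x) \<longlonglongrightarrow> l x"
    by blast
  define \<alpha>' where "\<alpha>' i = vec da (\<lambda>j. l (0, i, j, 0))" for i
  define p' where "p' i = Re (l (1, i, 0, 0))" for i
  define s' where "s' i = mat db db (\<lambda>(j, k). l (2, i, j, k))" for i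
  have la: "(\<lambda>n. \<alpha> (q n) i $ j) \<longlonglongrightarrow> \<alpha>' i $ j" if "i < da" "j < da" for i j
    using l[of "(0, i, j, 0)"] that by (simp add: I_def f_def \<alpha>'_def)
  have lp: "(\<lambda>n. p (q n) i) \<longlonglongrightarrow> p' i" if "i < da" for i
    using tendsto_Re[OF l[of "(1, i, 0, 0)"]] that by (simp add: I_def f_def p'_def)
  have ls: "(\<lambda>n. s (q n) i $$ (j, k)) \<longlonglongrightarrow> s' i $$ (j, k)" if "i < da" "j < db" "k < db" for i j k
    using l[of "(2, i, j, k)"] that by (simp add: I_def f_def s'_def)
  have ac: "\<alpha> n i \<in> carrier_vec da" if "i < da" for i n using a[of n] that by (auto simp: onb_def)
  have sc: "s n i \<in> carrier_mat db db" if "i < da" for i n using s[OF that] by simp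
  have ac': "\<alpha>' i \<in> carrier_vec da" for i by (simp add: \<alpha>'_def)
  have sc': "s' i \<in> carrier_mat db db" for i by (simp add: s'_def)
  have "onb da \<alpha>'"
    unfolding onb_def
  proof (intro conjI allI impI)
    fix i j assume ij: "i < da" "j < da"
    have "(\<lambda>n. \<Sum>k<da. cnj (\<alpha> (q n) i $ k) * \<alpha> (q n) j $ k) \<longlonglongrightarrow> (\<Sum>k<da. cnj (\<alpha>' i $ k) * \<alpha>' j $ k)"
      by (intro tendsto_sum tendsto_mult tendsto_cnj la ij) auto
    then have "(\<lambda>n. if i = j then 1 else 0) \<longlonglongrightarrow> cinner (\<alpha>' i) (\<alpha>' j)"
      using ij ac'[of i] by (simp add: onb_sum[OF a] cinner_def)
    then show "cinner (\<alpha>' i) (\<alpha>' j) = (if i = j then 1 else 0)" using LIMSEQ_const_iff by metis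
  qed (rule ac')
  moreover have "prob_vec da p'"
    unfolding prob_vec_def
  proof (intro conjI allI impI)
    show "0 \<le> p' i" if "i < da" for i
      by (rule LIMSEQ_le_const[OF lp[OF that]]) (use p that in \<open>auto simp: prob_vec_def\<close>)
    have "(\<lambda>n. \<Sum>i<da. p (q n) i) \<longlonglongrightarrow> (\<Sum>i<da. p' i)" by (intro tendsto_sum lp) auto
    then show "(\<Sum>i<da. p' i) = 1" using p by (simp add: prob_vec_def LIMSEQ_const_iff)
  qed
  moreover have "density db (s' i)" if i: "i < da" for i
    unfolding density_def psd_def
  proof (intro conjI ballI)
    show "s' i \<in> carrier_mat db db" by (rule sc')
    have "(\<lambda>n. \<Sum>k<db. s (q n) i $$ (k, k)) \<longlonglongrightarrow> (\<Sum>k<db. s' i $$ (k, k))" by (intro tendsto_sum ls i) auto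
    moreover have "(\<Sum>k<db. s n i $$ (k, k)) = 1" for n using s[OF i, of n] sc[OF i, of n] by (auto simp: density_def mtrace_def)
    ultimately show "mtrace (s' i) = 1" using sc'[of i] by (auto simp: mtrace_def LIMSEQ_const_iff)
    fix v :: "complex vec" assume v: "v \<in> carrier_vec db"
    have form: "cinner v (M *\<^sub>v v) = (\<Sum>k<db. cnj (v $ k) * (\<Sum>m<db. M $$ (k, m) * v $ m))" if "M \<in> carrier_mat db db" for M
      using that v by (simp add: cinner_def mat_vec_index del: index_mult_mat_vec)
    have L: "(\<lambda>n. cinner v (s (q n) i *\<^sub>v v)) \<longlonglongrightarrow> cinner v (s' i *\<^sub>v v)"
      unfolding form[OF sc'] form[OF sc[OF i]] by (intro tendsto_sum tendsto_mult tendsto_const ls i) auto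
    have R: "Im (cinner v (s n i *\<^sub>v v)) = 0" "0 \<le> Re (cinner v (s n i *\<^sub>v v))" for n
      using s[OF i, of n] v by (auto simp: density_def psd_def complex_is_Real_iff)
    have "(\<lambda>n. 0) \<longlonglongrightarrow> Im (cinner v (s' i *\<^sub>v v))" using tendsto_Im[OF L] R(1) by simp
    then show "cinner v (s' i *\<^sub>v v) \<in> \<real>" by (simp add: complex_is_Real_iff LIMSEQ_const_iff)
    show "0 \<le> Re (cinner v (s' i *\<^sub>v v))"
      by (rule LIMSEQ_le_const[OF tendsto_Re[OF L]]) (use R(2) in auto)
  qed
  moreover have "\<rho> = cqm da db \<alpha>' p' s'"
  proof (rule eq_matI)
    fix u v assume "u < dim_row (cqm da db \<alpha>' p' s')" "v < dim_col (cqm da db \<alpha>' p' s')"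
    then have uv: "u < da * db" "v < da * db" by (auto simp: carrier_matD[OF cqm_carrier])
    note d = divmod_less[OF uv(1)] divmod_less[OF uv(2)]
    have idx: "cqm da db (\<alpha> n) (p n) (s n) $$ (u, v) = (\<Sum>i<da. of_real (p n i) *
       (\<alpha> n i $ (u div db) * cnj (\<alpha> n i $ (v div db)) * s n i $$ (u mod db, v mod db)))" for n
      by (rule cqm_index[OF uv ac sc])
    have "(\<lambda>n. cqm da db (\<alpha> (q n)) (p (q n)) (s (q n)) $$ (u, v)) \<longlonglongrightarrow> cqm da db \<alpha>' p' s' $$ (u, v)"
      unfolding idx cqm_index[OF uv ac' sc']
      by (intro tendsto_sum tendsto_mult tendsto_of_real tendsto_cnj la lp ls d) auto
    moreover have "(\<lambda>n. cqm da db (\<alpha> (q n)) (p (q n)) (s (q n)) $$ (u, v)) \<longlonglongrightarrow> \<rho> $$ (u, v)"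
      using LIMSEQ_subseq_LIMSEQ[OF lim[OF uv] q] by (simp add: o_def)
    ultimately show "\<rho> $$ (u, v) = cqm da db \<alpha>' p' s' $$ (u, v)" using LIMSEQ_unique by blast
  qed (use r carrier_matD[OF cqm_carrier] in auto)
  ultimately show ?thesis by blast
qed

text \<open>Each state on b has trace 1, so the reduced state is diagonal in \<alpha>. This makes
  \<alpha> an admissible eigenbasis and gives the easy half of (1).\<close>

lemma ptrace_cqm:
  assumes a: "onb da \<alpha>" and s: "\<And>i. i < da \<Longrightarrow> density db (\<sigma> i)"
  shows "ptrace_b da db (cqm da db \<alpha> p \<sigma>) = spec da \<alpha> p"
proof (rule eq_matI)
  fix i j assume "i < dim_row (spec da \<alpha> p)" "j < dim_col (spec da \<alpha> p)"
  then have ij: "i < da" "j < da" by auto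
  have ac: "\<alpha> m \<in> carrier_vec da" if "m < da" for m using a that by (auto simp: onb_def)
  have sc: "\<sigma> m \<in> carrier_mat db db" if "m < da" for m using s[OF that] by simp
  have tr: "(\<Sum>k<db. \<sigma> m $$ (k, k)) = 1" if "m < da" for m
    using s[OF that] sc[OF that] by (auto simp: density_def mtrace_def)
  have "ptrace_b da db (cqm da db \<alpha> p \<sigma>) $$ (i, j) =
      (\<Sum>k<db. \<Sum>m<da. of_real (p m) * (\<alpha> m $ i * cnj (\<alpha> m $ j) * \<sigma> m $$ (k, k)))"
    using ij idx_less[OF ij(1)] idx_less[OF ij(2)] by (simp add: ptrace_b_def cqm_index ac sc)
  also have "\<dots> = (\<Sum>m<da. \<Sum>k<db. of_real (p m) * (\<alpha> m $ i * cnj (\<alpha> m $ j)) * \<sigma> m $$ (k, k))"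
    by (subst sum.swap) (simp add: mult.assoc)
  also have "\<dots> = spec da \<alpha> p $$ (i, j)"
    using ij by (simp add: spec_def sum_distrib_left[symmetric] tr mult.assoc)
  finally show "ptrace_b da db (cqm da db \<alpha> p \<sigma>) $$ (i, j) = spec da \<alpha> p $$ (i, j)" .
qed (auto simp: ptrace_b_def)

lemma corr_coh_cqm:
  assumes X: "X \<in> {fidelity, affinity}" and pos: "0 < da" "0 < db"
    and a: "onb da \<alpha>" and p: "prob_vec da p" and s: "\<And>i. i < da \<Longrightarrow> density db (\<sigma> i)"
  shows "corr_coh X da db (cqm da db \<alpha> p \<sigma>) = 0"
proof (rule antisym)
  let ?r = "cqm da db \<alpha> p \<sigma>"
  have d: "density (da * db) ?r" by (rule cqm_density[OF a p s])
  have "eigenbasis da (ptrace_b da db ?r) \<alpha>"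
  proof -
    have pt: "ptrace_b da db ?r = spec da \<alpha> p" by (rule ptrace_cqm[OF a s])
    show ?thesis unfolding eigenbasis_def pt using a spec_apply[OF a] by (auto intro!: exI)
  qed
  then have "corr_coh X da db ?r \<le> dist_X X ?r ?r"
    by (rule corr_coh_le_dist[OF X d pos]) (rule cq_statesI[OF p s])
  then show "corr_coh X da db ?r \<le> 0" using overlap_self[OF X d] by (simp add: dist_X_def)
  show "0 \<le> corr_coh X da db ?r" by (rule corr_coh_nonneg[OF X d pos])
qed

text \<open>Competitors at distance below 1 / (n + 1) converge to \<rho> entrywise, and the
  classical-quantum states over all orthonormal bases form a closed set.\<close>

lemma corr_coh_zeroD:
  assumes X: "X \<in> {fidelity, affinity}" and r: "density (da * db) \<rho>" and pos: "0 < da" "0 < db"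
    and z: "corr_coh X da db \<rho> = 0"
  shows "\<exists>\<alpha> p s. onb da \<alpha> \<and> prob_vec da p \<and> (\<forall>i<da. density db (s i)) \<and> \<rho> = cqm da db \<alpha> p s"
proof -
  have "\<exists>\<alpha> p s. onb da \<alpha> \<and> prob_vec da p \<and> (\<forall>i<da. density db (s i)) \<and>
    dist_X X \<rho> (cqm da db \<alpha> p s) < 1 / real (Suc n)" for n
  proof (rule ccontr)
    assume no: "\<not> ?thesis"
    have "1 / real (Suc n) \<le> corr_coh X da db \<rho>"
    proof (rule corr_coh_greatest[OF X r pos])
      fix \<alpha> \<sigma> assume e: "eigenbasis da (ptrace_b da db \<rho>) \<alpha>" and "\<sigma> \<in> cq_states da db \<alpha>"
      then obtain p s where "\<sigma> = cqm da db \<alpha> p s" "prob_vec da p" "\<And>i. i < da \<Longrightarrow> density db (s i)"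
        by (auto elim!: cq_statesE)
      then have "\<not> dist_X X \<rho> \<sigma> < 1 / real (Suc n)" using no e unfolding eigenbasis_def by blast
      then show "1 / real (Suc n) \<le> dist_X X \<rho> \<sigma>" by simp
    qed
    then show False using z by simp
  qed
  then obtain \<alpha> p s where seq: "\<And>n. onb da (\<alpha> n)" "\<And>n. prob_vec da (p n)" "\<And>n i. i < da \<Longrightarrow> density db (s n i)"
    and dist: "\<And>n. dist_X X \<rho> (cqm da db (\<alpha> n) (p n) (s n)) < 1 / real (Suc n)" by metis
  show ?thesis
  proof (rule cqm_closed[OF seq])
    show "\<rho> \<in> carrier_mat (da * db) (da * db)" using r by simp
    fix u v assume uv: "u < da * db" "v < da * db"
    have bd: "norm (cqm da db (\<alpha> n) (p n) (s n) $$ (u, v) - \<rho> $$ (u, v)) \<le> 2 * sqrt (2 * (1 / real (Suc n)))" for n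
    proof -
      let ?x = "X \<rho> (cqm da db (\<alpha> n) (p n) (s n))"
      have d: "density (da * db) (cqm da db (\<alpha> n) (p n) (s n))" by (rule cqm_density) (use seq in auto)
      have x: "0 \<le> ?x" "?x \<le> 1" using overlap_nonneg[OF X, of "da * db"] overlap_le_one[OF X r d] r d by auto
      \<comment> \<open>The distance controls 1 - x^2 while the closeness estimate needs 1 - x; on
        [0, 1] the latter is the smaller one.\<close>
      then have "?x\<^sup>2 \<le> ?x" by (simp add: power2_eq_square mult_left_le)
      then have "2 - 2 * ?x \<le> 2 * (1 / real (Suc n))" using dist[of n] unfolding dist_X_def by linarith
      then have le: "2 * sqrt (2 - 2 * ?x) \<le> 2 * sqrt (2 * (1 / real (Suc n)))" by simp
      have "norm (cqm da db (\<alpha> n) (p n) (s n) $$ (u, v) - \<rho> $$ (u, v)) = norm (\<rho> $$ (u, v) - cqm da db (\<alpha> n) (p n) (s n) $$ (u, v))"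
        by (rule norm_minus_commute)
      also have "\<dots> \<le> 2 * sqrt (2 - 2 * ?x)" by (rule overlap_close[OF X r d uv])
      also note le
      finally show ?thesis .
    qed
    have "(\<lambda>n. 2 * sqrt (2 * (1 / real (Suc n)))) \<longlonglongrightarrow> 2 * sqrt (2 * 0)"
      by (intro tendsto_mult tendsto_const tendsto_real_sqrt LIMSEQ_Suc[OF lim_1_over_n])
    then have "(\<lambda>n. 2 * sqrt (2 * (1 / real (Suc n)))) \<longlonglongrightarrow> 0" by simp
    then have "(\<lambda>n. cqm da db (\<alpha> n) (p n) (s n) $$ (u, v) - \<rho> $$ (u, v)) \<longlonglongrightarrow> 0"
      by (rule tendsto_0_le[where K = 1], intro always_eventually allI) (use bd in simp)
    then show "(\<lambda>n. cqm da db (\<alpha> n) (p n) (s n) $$ (u, v)) \<longlonglongrightarrow> \<rho> $$ (u, v)" by (simp add: LIM_zero_iff)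
  qed
qed

section \<open>LOCC on pure states\<close>

definition mvec :: "nat \<Rightarrow> nat \<Rightarrow> complex vec \<Rightarrow> complex mat" where
  "mvec da db \<psi> = mat da db (\<lambda>(i, k). \<psi> $ (i * db + k))"

lemma mvec_dim [simp]: "dim_row (mvec da db \<psi>) = da" "dim_col (mvec da db \<psi>) = db" "mvec da db \<psi> \<in> carrier_mat da db"
  by (auto simp: mvec_def)

text \<open>In the coefficient matrix the first party acts from the left and the second, transposed,
  from the right; after a transposition both look alike.\<close>

lemma mvec_kron:
  assumes A: "A \<in> carrier_mat da da" and B: "B \<in> carrier_mat db db" and v: "\<psi> \<in> carrier_vec (da * db)"
  shows "mvec da db (kron A B *\<^sub>v \<psi>) = A * mvec da db \<psi> * B\<^sup>T"
proof (rule eq_matI)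
  fix i k assume "i < dim_row (A * mvec da db \<psi> * B\<^sup>T)" "k < dim_col (A * mvec da db \<psi> * B\<^sup>T)"
  then have ik: "i < da" "k < db" using A B by auto
  have "mvec da db (kron A B *\<^sub>v \<psi>) $$ (i, k) = (\<Sum>s<da * db. kron A B $$ (i * db + k, s) * \<psi> $ s)"
    using ik A B v idx_less[OF ik] by (simp add: mvec_def mat_vec_index del: index_mult_mat_vec)
  also have "\<dots> = (\<Sum>s<da * db. (\<lambda>j l. A $$ (i, j) * B $$ (k, l) * \<psi> $ (j * db + l)) (s div db) (s mod db))"
    using ik A B v idx_less[OF ik] by (intro sum.cong refl) (simp add: kron_def)
  also have "\<dots> = (\<Sum>j<da. \<Sum>l<db. A $$ (i, j) * B $$ (k, l) * \<psi> $ (j * db + l))" by (rule sum_divmod)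
  also have "\<dots> = (\<Sum>l<db. \<Sum>j<da. A $$ (i, j) * B $$ (k, l) * \<psi> $ (j * db + l))" by (rule sum.swap)
  also have "\<dots> = (\<Sum>l<db. (A * mvec da db \<psi>) $$ (i, l) * B\<^sup>T $$ (l, k))"
    using ik A B by (simp add: mat_mult_index sum_distrib_left mult_ac del: index_mult_mat(1)) (simp add: mvec_def mult_ac)
  also have "\<dots> = (A * mvec da db \<psi> * B\<^sup>T) $$ (i, k)"
    using ik A B by (subst mat_mult_index[of _ "A * mvec da db \<psi>" _ "B\<^sup>T"]) auto
  finally show "mvec da db (kron A B *\<^sub>v \<psi>) $$ (i, k) = (A * mvec da db \<psi> * B\<^sup>T) $$ (i, k)" .
qed (use A B in auto)

lemma mvec_smult: "\<psi> \<in> carrier_vec (da * db) \<Longrightarrow> mvec da db (c \<cdot>\<^sub>v \<psi>) = c \<cdot>\<^sub>m mvec da db \<psi>"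
  by (rule eq_matI) (auto simp: mvec_def idx_less)

text \<open>\<open>kraus\<close> says that the best constant \<open>c\<close> in \<open>Q c M\<close> does not decrease on average under a
  local measurement by the first party; by \<open>trans\<close> the same holds for the second party.\<close>

locale kraus_bound =
  fixes Q :: "real \<Rightarrow> complex mat \<Rightarrow> bool"
  assumes kraus: "\<And>r c M As b. M \<in> carrier_mat r c \<Longrightarrow> kraus_complete r As \<Longrightarrow>
      (\<And>l. l < length As \<Longrightarrow> Q (b l) (As ! l * M)) \<Longrightarrow> Q (\<Sum>l<length As. b l) M"
    and trans: "\<And>c M. Q c M \<Longrightarrow> Q c M\<^sup>T"
    and scale: "\<And>c z M. Q c M \<Longrightarrow> Q ((cmod z)\<^sup>2 * c) (z \<cdot>\<^sub>m M)"

text \<open>Groups the bounds at the leaves of a protocol according to the branch they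
  extend.\<close>

lemma list_all2_concat:
  "list_all2 P bs (concat xss) \<Longrightarrow> \<exists>bss. bs = concat bss \<and> list_all2 (list_all2 P) bss xss"
proof (induction xss arbitrary: bs)
  case (Cons xs xss)
  then obtain us vs where "bs = us @ vs" "list_all2 P us xs" "list_all2 P vs (concat xss)"
    by (auto simp: list_all2_append2)
  moreover from Cons.IH[OF this(3)] obtain bss where "vs = concat bss" "list_all2 (list_all2 P) bss xss" by auto
  ultimately show ?case by (intro exI[of _ "us # bss"]) auto
qed auto

lemma sum_list_concat_map: "sum_list (concat xss) = sum_list (map sum_list xss)" for xss :: "real list list"
  by (induction xss) auto

lemma local_instr_carrier:
  assumes "local_instr da db Ls" "L \<in> set Ls"
  shows "L \<in> carrier_mat (da * db) (da * db)"
proof -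
  from assms(1) consider (a) As where "kraus_complete da As" "Ls = map (\<lambda>A. kron A (1\<^sub>m db)) As"
    | (b) Bs where "kraus_complete db Bs" "Ls = map (\<lambda>B. kron (1\<^sub>m da) B) Bs"
    unfolding local_instr_def by blast
  then show ?thesis
  proof cases
    case a
    then obtain A where "L = kron A (1\<^sub>m db)" "A \<in> carrier_mat da da"
      using assms(2) by (auto simp: kraus_complete_def)
    then show ?thesis by (intro carrier_matI) auto
  next
    case b
    then obtain B where "L = kron (1\<^sub>m da) B" "B \<in> carrier_mat db db"
      using assms(2) by (auto simp: kraus_complete_def)
    then show ?thesis by (intro carrier_matI) auto
  qed
qed

lemma LOCC_ops_carrier:
  assumes "LOCC_ops da db Ms" "M \<in> set Ms"
  shows "M \<in> carrier_mat (da * db) (da * db)"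
  using assms
proof (induction arbitrary: M)
  case init
  then show ?case by simp
next
  case (round Ms Ls)
  then obtain k L where k: "k < length Ms" "L \<in> set (Ls ! k)" "M = L * Ms ! k" by auto
  have "L \<in> carrier_mat (da * db) (da * db)"
    using local_instr_carrier[of da db "Ls ! k" L] round.hyps k by blast
  then show ?case using k round.IH[of "Ms ! k"] by simp
qed

lemma (in kraus_bound) local_step:
  assumes I: "local_instr da db Ls" and v: "\<psi> \<in> carrier_vec (da * db)"
    and b: "list_all2 (\<lambda>b L. Q b (mvec da db (L *\<^sub>v \<psi>))) bs Ls"
  shows "Q (sum_list bs) (mvec da db \<psi>)"
proof -
  have len: "length bs = length Ls" using b by (rule list_all2_lengthD)
  have nth: "Q (bs ! l) (mvec da db (Ls ! l *\<^sub>v \<psi>))" if "l < length Ls" for l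
    using b that by (simp add: list_all2_conv_all_nth)
  have sl: "sum_list bs = (\<Sum>l<length Ls. bs ! l)" by (simp add: sum_list_sum_nth len atLeast0LessThan)
  from I consider (a) As where "kraus_complete da As" "Ls = map (\<lambda>A. kron A (1\<^sub>m db)) As"
    | (b) Bs where "kraus_complete db Bs" "Ls = map (\<lambda>B. kron (1\<^sub>m da) B) Bs"
    unfolding local_instr_def by blast
  then show ?thesis
  proof cases
    case a
    have "Q (bs ! l) (As ! l * mvec da db \<psi>)" if l: "l < length As" for l
    proof -
      have "As ! l \<in> carrier_mat da da" using a(1) l by (auto simp: kraus_complete_def)
      then show ?thesis using nth[of l] l v mvec_kron[of "As ! l" da "1\<^sub>m db" db \<psi>] a(2)
        right_mult_one_mat[of "As ! l * mvec da db \<psi>" da db] by simp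
    qed
    from kraus[OF mvec_dim(3) a(1) this] show ?thesis using sl a(2) by simp
  next
    case b
    have "Q (bs ! l) (Bs ! l * (mvec da db \<psi>)\<^sup>T)" if l: "l < length Bs" for l
    proof -
      have c: "Bs ! l \<in> carrier_mat db db" using b(1) l by (auto simp: kraus_complete_def)
      then have "Q (bs ! l) (mvec da db \<psi> * (Bs ! l)\<^sup>T)" using nth[of l] l v mvec_kron[of "1\<^sub>m da" da "Bs ! l" db \<psi>] b(2)
        left_mult_one_mat[of "mvec da db \<psi>" da db] by simp
      from trans[OF this] show ?thesis
        using c transpose_mult[of "mvec da db \<psi>" da db "(Bs ! l)\<^sup>T" db] by simp
    qed
    from kraus[OF transpose_carrier_mat[THEN iffD2, OF mvec_dim(3)] b(1) this]
    have "Q (sum_list bs) ((mvec da db \<psi>)\<^sup>T)" using sl b(2) by simp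
    from trans[OF this] show ?thesis by simp
  qed
qed

text \<open>Peels off the last round: the bounds at the leaves of a branch add up to a bound at the
  branch by \<open>local_step\<close>, and the induction hypothesis handles the shorter
  protocol.\<close>

lemma (in kraus_bound) LOCC_bound:
  assumes "LOCC_ops da db Ms" and v: "\<psi> \<in> carrier_vec (da * db)"
    and "list_all2 (\<lambda>b M. Q b (mvec da db (M *\<^sub>v \<psi>))) bs Ms"
  shows "Q (sum_list bs) (mvec da db \<psi>)"
  using assms(1,3)
proof (induction arbitrary: bs)
  case init
  then show ?case using v by (auto simp: list_all2_Cons2)
next
  case (round Ms Ls)
  let ?xss = "map (\<lambda>k. map (\<lambda>L. L * Ms ! k) (Ls ! k)) [0..<length Ms]"
  obtain bss where bss: "bs = concat bss" "list_all2 (list_all2 (\<lambda>b M. Q b (mvec da db (M *\<^sub>v \<psi>)))) bss ?xss"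
    using list_all2_concat[OF round.prems] by blast
  have len: "length bss = length Ms" using list_all2_lengthD[OF bss(2)] by simp
  have "Q (sum_list (bss ! k)) (mvec da db (Ms ! k *\<^sub>v \<psi>))" if k: "k < length Ms" for k
  proof (rule local_step)
    show "local_instr da db (Ls ! k)" using round.hyps k by blast
    have c: "Ms ! k \<in> carrier_mat (da * db) (da * db)" using LOCC_ops_carrier[OF round.hyps(1)] k by simp
    then show "Ms ! k *\<^sub>v \<psi> \<in> carrier_vec (da * db)" by auto
    have Lc: "dim_col L = da * db" if "L \<in> set (Ls ! k)" for L
      using local_instr_carrier[of da db "Ls ! k" L] round.hyps k that by blast
    have "list_all2 (\<lambda>b M. Q b (mvec da db (M *\<^sub>v \<psi>))) (bss ! k) (map (\<lambda>L. L * Ms ! k) (Ls ! k))"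
      using list_all2_nthD[OF bss(2), of k] k len by simp
    then show "list_all2 (\<lambda>b L. Q b (mvec da db (L *\<^sub>v (Ms ! k *\<^sub>v \<psi>)))) (bss ! k) (Ls ! k)"
      unfolding list_all2_map2
      by (rule list.rel_mono_strong) (use c Lc v in \<open>auto simp: mat_mult_vec_assoc\<close>)
  qed
  then have "list_all2 (\<lambda>b M. Q b (mvec da db (M *\<^sub>v \<psi>))) (map sum_list bss) Ms"
    using len by (simp add: list_all2_conv_all_nth)
  from round.IH[OF this] show ?case by (simp add: bss(1) sum_list_concat_map)
qed

lemma proj_carrier [simp]: "v \<in> carrier_vec n \<Longrightarrow> proj v \<in> carrier_mat n n"
  and proj_dim [simp]: "dim_row (proj v) = dim_vec v" "dim_col (proj v) = dim_vec v"
  by (auto simp: proj_def)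

lemma proj_apply:
  assumes "dim_vec w = dim_vec x"
  shows "proj x *\<^sub>v w = cinner x w \<cdot>\<^sub>v x"
  by (rule eq_vecI) (use assms in \<open>auto simp: mat_vec_index proj_def cinner_def sum_distrib_left sum_distrib_right mult_ac
     simp del: index_mult_mat_vec intro!: sum.cong\<close>)

lemma proj_form:
  assumes "dim_vec w = dim_vec x"
  shows "cinner w (proj x *\<^sub>v w) = of_real ((cmod (cinner x w))\<^sup>2)"
  using cinner_cnj[of x w] assms
  by (simp add: proj_apply cinner_smult_right complex_norm_square flip: of_real_power)

text \<open>The positive rank-one terms |x_i><x_i| sum to |\<phi>><\<phi>|, which forces x_i = c_i
  \<phi>, and the form at \<phi> gives sum |c_i|^2 = 1. By \<open>scale\<close> branch i has the
  bound |c_i|^2 c, and these bounds add up to c.\<close>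

lemma (in kraus_bound) LOCC_transformable_bound:
  assumes p: "pure_state (da * db) \<psi>" "pure_state (da * db) \<phi>" and T: "LOCC_transformable da db \<psi> \<phi>"
    and Q: "Q c (mvec da db \<phi>)"
  shows "Q c (mvec da db \<psi>)"
proof -
  let ?n = "da * db"
  obtain Ms where Ms: "LOCC_ops da db Ms" "apply_ops ?n Ms (proj \<psi>) = proj \<phi>" using T by (auto simp: LOCC_transformable_def)
  have v: "\<psi> \<in> carrier_vec ?n" "\<phi> \<in> carrier_vec ?n" and n1: "cinner \<phi> \<phi> = 1" using p by (auto simp: pure_state_def)
  define x where "x M = M *\<^sub>v \<psi>" for M
  have Mc: "M \<in> carrier_mat ?n ?n" if "M \<in> set Ms" for M using LOCC_ops_carrier[OF Ms(1) that] .
  have xc: "x M \<in> carrier_vec ?n" if "M \<in> set Ms" for M using Mc[OF that] by (auto simp: x_def)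
  have "apply_ops ?n Ms (proj \<psi>) = msum ?n (\<lambda>i. proj (x (Ms ! i))) {..<length Ms}"
    unfolding apply_ops_def x_def
    by (rule msum_cong, rule proj_conj) (use v carrier_matD(2)[OF Mc[OF nth_mem]] in auto)
  then have eq: "msum ?n (\<lambda>i. proj (x (Ms ! i))) {..<length Ms} = proj \<phi>" using Ms(2) by simp
  have form: "(\<Sum>i<length Ms. (cmod (cinner (x (Ms ! i)) w))\<^sup>2) = (cmod (cinner \<phi> w))\<^sup>2" if w: "w \<in> carrier_vec ?n" for w
  proof -
    have "cinner w (proj \<phi> *\<^sub>v w) = (\<Sum>i<length Ms. cinner w (proj (x (Ms ! i)) *\<^sub>v w))"
      unfolding eq[symmetric] by (rule msum_form[OF w w]) (use xc in auto)
    also have "\<dots> = (\<Sum>i<length Ms. of_real ((cmod (cinner (x (Ms ! i)) w))\<^sup>2))"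
      by (rule sum.cong) (use w carrier_vecD[OF xc[OF nth_mem]] in \<open>auto simp: proj_form\<close>)
    finally show ?thesis using w v by (simp add: proj_form flip: of_real_sum of_real_power)
  qed
  define c' where "c' M = cinner \<phi> (x M)" for M
  have xe: "x M = c' M \<cdot>\<^sub>v \<phi>" if M: "M \<in> set Ms" for M
  proof -
    \<comment> \<open>The part of the branch vector orthogonal to \<phi>. The total form vanishes
      there, hence so does every summand, including the one of this branch, which makes the part
      orthogonal to itself.\<close>
    let ?w = "x M - c' M \<cdot>\<^sub>v \<phi>"
    note xd = xc[OF M]
    have w: "?w \<in> carrier_vec ?n" using xd v by auto
    have pw: "cinner \<phi> ?w = 0" using xd v n1 by (simp add: cinner_diff_right cinner_smult_right c'_def)
    then have "(\<Sum>i<length Ms. (cmod (cinner (x (Ms ! i)) ?w))\<^sup>2) = 0" using form[OF w] by simp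
    then have "\<forall>i<length Ms. cinner (x (Ms ! i)) ?w = 0" by (simp add: sum_nonneg_eq_0_iff)
    then have "cinner (x M) ?w = 0" using M by (metis in_set_conv_nth)
    then have "cinner ?w ?w = 0" using pw xd v by (simp add: cinner_diff_left[of "x M"] cinner_smult_left)
    then have "nrm2 ?w = 0" by (simp add: cinner_self)
    then have z: "?w = 0\<^sub>v ?n" using nrm2_eq0[of ?w] w v by simp
    show ?thesis
    proof (rule eq_vecI)
      fix i assume i: "i < dim_vec (c' M \<cdot>\<^sub>v \<phi>)"
      then show "x M $ i = (c' M \<cdot>\<^sub>v \<phi>) $ i" using arg_cong[OF z, of "\<lambda>u. u $ i"] v xd by simp
    qed (use xd v in auto)
  qed
  have "(\<Sum>i<length Ms. (cmod (c' (Ms ! i)))\<^sup>2) = (\<Sum>i<length Ms. (cmod (cinner (x (Ms ! i)) \<phi>))\<^sup>2)"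
  proof (rule sum.cong)
    fix i assume "i \<in> {..<length Ms}"
    then have "x (Ms ! i) \<in> carrier_vec ?n" using xc by simp
    then have "c' (Ms ! i) = cnj (cinner (x (Ms ! i)) \<phi>)" using cinner_cnj[of "x (Ms ! i)" \<phi>] v by (simp add: c'_def)
    then show "(cmod (c' (Ms ! i)))\<^sup>2 = (cmod (cinner (x (Ms ! i)) \<phi>))\<^sup>2" by simp
  qed simp
  also have "\<dots> = 1" using form[OF v(2)] n1 by simp
  finally have s1: "(\<Sum>i<length Ms. (cmod (c' (Ms ! i)))\<^sup>2) = 1" .
  let ?bs = "map (\<lambda>M. (cmod (c' M))\<^sup>2 * c) Ms"
  have "list_all2 (\<lambda>b M. Q b (mvec da db (M *\<^sub>v \<psi>))) ?bs Ms"
    using scale[OF Q] xe v by (auto simp: list_all2_map1 x_def mvec_smult intro!: list_all2_refl list.rel_refl_strong)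
  from LOCC_bound[OF Ms(1) v(1) this] have "Q (sum_list ?bs) (mvec da db \<psi>)" .
  moreover have "sum_list ?bs = c"
    using s1 by (simp add: sum_list_sum_nth atLeast0LessThan flip: sum_distrib_right)
  ultimately show ?thesis by simp
qed

text \<open>\<open>c\<close> bounds the squared operator norm; phrased as a predicate, it needs no
  supremum.\<close>

definition opbound :: "real \<Rightarrow> complex mat \<Rightarrow> bool" where
  "opbound c M \<longleftrightarrow> 0 \<le> c \<and> (\<forall>v \<in> carrier_vec (dim_col M). nrm2 (M *\<^sub>v v) \<le> c * nrm2 v)"

text \<open>For y = M* v, |y|^4 = |<v, M y>|^2 \<le> |v|^2 c |y|^2; then divide by |y|^2.\<close>

lemma opbound_adj:
  assumes "opbound c M"
  shows "opbound c (adj M)"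
  unfolding opbound_def
proof (intro conjI ballI)
  show "0 \<le> c" using assms by (simp add: opbound_def)
  fix v :: "complex vec" assume v: "v \<in> carrier_vec (dim_col (adj M))"
  let ?y = "adj M *\<^sub>v v"
  have "cinner ?y ?y = cinner v (M *\<^sub>v ?y)" using cinner_adj[of v M ?y] v by simp
  then have "(nrm2 ?y)\<^sup>2 = (cmod (cinner v (M *\<^sub>v ?y)))\<^sup>2" by (metis cinner_self norm_of_real power2_abs)
  also have "\<dots> \<le> nrm2 v * nrm2 (M *\<^sub>v ?y)" by (rule cauchy_schwarz) (use v in simp)
  also have "\<dots> \<le> nrm2 v * (c * nrm2 ?y)"
    using assms by (intro mult_left_mono) (auto simp: opbound_def)
  finally have "nrm2 ?y * nrm2 ?y \<le> (c * nrm2 v) * nrm2 ?y" by (simp add: power2_eq_square mult_ac)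
  then show "nrm2 ?y \<le> c * nrm2 v"
    using \<open>0 \<le> c\<close> by (cases "nrm2 ?y = 0") (auto simp: mult_le_cancel_right order.not_eq_order_implies_strict)
qed

definition vcnj :: "complex vec \<Rightarrow> complex vec" where
  "vcnj v = vec (dim_vec v) (\<lambda>i. cnj (v $ i))"

lemma vcnj_dim [simp]: "dim_vec (vcnj v) = dim_vec v"
  by (simp add: vcnj_def)

lemma nrm2_vcnj [simp]: "nrm2 (vcnj v) = nrm2 v"
  by (simp add: nrm2_def vcnj_def)

lemma transpose_apply_cnj:
  assumes "dim_vec v = dim_row M"
  shows "M\<^sup>T *\<^sub>v v = vcnj (adj M *\<^sub>v vcnj v)"
  by (rule eq_vecI) (use assms in \<open>auto simp: vcnj_def mat_vec_index simp del: index_mult_mat_vec\<close>)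

text \<open>Completeness makes |Mv|^2 the sum of the |A_l M v|^2, so the branch bounds add.
  Transposition is the adjoint up to entrywise conjugation of vectors, which preserves
  norms.\<close>

interpretation opbound: kraus_bound opbound
proof
  fix r c M As b
  assume M: "M \<in> carrier_mat r c" and K: "kraus_complete r As" and Q: "\<And>l. l < length As \<Longrightarrow> opbound (b l) (As ! l * M)"
  have Ac: "As ! l \<in> carrier_mat r r" if "l < length As" for l using K that by (auto simp: kraus_complete_def)
  show "opbound (\<Sum>l<length As. b l) M"
    unfolding opbound_def
  proof (intro conjI ballI)
    show "0 \<le> (\<Sum>l<length As. b l)" using Q by (auto simp: opbound_def intro!: sum_nonneg)
    fix v :: "complex vec" assume v: "v \<in> carrier_vec (dim_col M)"
    let ?w = "M *\<^sub>v v"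
    have w: "?w \<in> carrier_vec r" using M by auto
    have "cinner ?w (1\<^sub>m r *\<^sub>v ?w) = (\<Sum>l<length As. cinner ?w (adj (As ! l) * As ! l *\<^sub>v ?w))"
    proof -
      have "1\<^sub>m r = msum r (\<lambda>l. adj (As ! l) * As ! l) {..<length As}" using K by (simp add: kraus_complete_def)
      moreover have "cinner ?w (msum r (\<lambda>l. adj (As ! l) * As ! l) {..<length As} *\<^sub>v ?w) =
        (\<Sum>l<length As. cinner ?w (adj (As ! l) * As ! l *\<^sub>v ?w))"
      proof (rule msum_form[OF w w])
        show "adj (As ! l) * As ! l \<in> carrier_mat r r" if "l \<in> {..<length As}" for l
          using Ac[of l] that by (intro carrier_matI) auto
      qed
      ultimately show ?thesis by simp
    qed
    also have "\<dots> = (\<Sum>l<length As. of_real (nrm2 (As ! l *\<^sub>v ?w)))"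
      by (rule sum.cong, simp, subst cinner_gram) (use carrier_matD[OF Ac] M in \<open>auto simp: cinner_self\<close>)
    finally have "nrm2 ?w = (\<Sum>l<length As. nrm2 (As ! l *\<^sub>v ?w))"
      using w by (simp add: cinner_self flip: of_real_sum)
    also have "\<dots> \<le> (\<Sum>l<length As. b l * nrm2 v)"
    proof (rule sum_mono)
      fix l assume "l \<in> {..<length As}"
      then have l: "l < length As" by simp
      have "As ! l *\<^sub>v ?w = As ! l * M *\<^sub>v v" using Ac[OF l] M v by (simp add: mat_mult_vec_assoc)
      then show "nrm2 (As ! l *\<^sub>v ?w) \<le> b l * nrm2 v" using Q[OF l] v by (simp add: opbound_def)
    qed
    finally show "nrm2 ?w \<le> (\<Sum>l<length As. b l) * nrm2 v" by (simp add: sum_distrib_right)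
  qed
next
  fix c M assume Q: "opbound c M"
  show "opbound c M\<^sup>T"
    unfolding opbound_def
  proof (intro conjI ballI)
    fix v :: "complex vec" assume v: "v \<in> carrier_vec (dim_col M\<^sup>T)"
    have "vcnj v \<in> carrier_vec (dim_col (adj M))" using v by (intro carrier_vecI) simp
    then have "nrm2 (adj M *\<^sub>v vcnj v) \<le> c * nrm2 (vcnj v)"
      using opbound_adj[OF Q] unfolding opbound_def by blast
    then show "nrm2 (M\<^sup>T *\<^sub>v v) \<le> c * nrm2 v" using v by (simp add: transpose_apply_cnj)
  qed (use Q in \<open>simp add: opbound_def\<close>)
next
  fix c z M assume Q: "opbound c M"
  show "opbound ((cmod z)\<^sup>2 * c) (z \<cdot>\<^sub>m M)"
    unfolding opbound_def
  proof (intro conjI ballI)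
    fix v :: "complex vec" assume v: "v \<in> carrier_vec (dim_col (z \<cdot>\<^sub>m M))"
    have "(z \<cdot>\<^sub>m M) *\<^sub>v v = z \<cdot>\<^sub>v (M *\<^sub>v v)"
      by (rule eq_vecI) (use v in \<open>auto simp: mat_vec_index sum_distrib_left mult.assoc simp del: index_mult_mat_vec\<close>)
    then show "nrm2 ((z \<cdot>\<^sub>m M) *\<^sub>v v) \<le> (cmod z)\<^sup>2 * c * nrm2 v"
      using Q v by (simp add: nrm2_smult opbound_def mult.assoc mult_left_mono)
  qed (use Q in \<open>simp add: opbound_def\<close>)
qed

text \<open>Frobenius norm, written with \<open>L2_set\<close> so that the triangle inequality is
  inherited.\<close>

definition fnorm :: "complex mat \<Rightarrow> real" where
  "fnorm A = L2_set (\<lambda>p. cmod (A $$ p)) ({..<dim_row A} \<times> {..<dim_col A})"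

lemma fnorm_nonneg [simp]: "0 \<le> fnorm A"
  by (simp add: fnorm_def L2_set_nonneg)

lemma fnorm_msum:
  assumes "finite I" "\<And>i. i \<in> I \<Longrightarrow> f i \<in> carrier_mat n n"
  shows "fnorm (msum n f I) \<le> (\<Sum>i\<in>I. fnorm (f i))"
  using assms
proof (induction I)
  case empty
  have "fnorm (0\<^sub>m n n) = L2_set (\<lambda>p. 0) ({..<n} \<times> {..<n})"
    unfolding fnorm_def by (rule L2_set_cong) auto
  then show ?case by (simp add: msum_empty L2_set_def)
next
  case (insert a I)
  let ?S = "{..<n} \<times> {..<n}"
  have "fnorm (msum n f (insert a I)) = L2_set (\<lambda>p. cmod ((f a + msum n f I) $$ p)) ?S"
    using insert by (simp add: fnorm_def msum_insert carrier_matD)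
  also have "\<dots> \<le> L2_set (\<lambda>p. cmod (f a $$ p) + cmod (msum n f I $$ p)) ?S"
    by (rule L2_set_mono) (auto simp: norm_triangle_ineq)
  also have "\<dots> \<le> L2_set (\<lambda>p. cmod (f a $$ p)) ?S + L2_set (\<lambda>p. cmod (msum n f I $$ p)) ?S"
    by (rule L2_set_triangle_ineq)
  also have "\<dots> = fnorm (f a) + fnorm (msum n f I)" using insert carrier_matD[of "f a" n n] by (simp add: fnorm_def)
  finally show ?case using insert by simp
qed

lemma fnorm_sq: "(fnorm A)\<^sup>2 = Re (mtrace (adj A * A))"
proof -
  have "(fnorm A)\<^sup>2 = (\<Sum>i<dim_row A. \<Sum>j<dim_col A. (cmod (A $$ (i, j)))\<^sup>2)"
    by (simp add: fnorm_def L2_set_def sum_nonneg sum.cartesian_product case_prod_unfold)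
  also have "\<dots> = (\<Sum>j<dim_col A. \<Sum>i<dim_row A. (cmod (A $$ (i, j)))\<^sup>2)" by (rule sum.swap)
  also have "\<dots> = Re (mtrace (adj A * A))"
    unfolding mtrace_def Re_sum
  proof (rule sum.cong)
    fix j assume "j \<in> {..<dim_row (adj A * A)}"
    moreover have "cnj x * x = of_real ((cmod x)\<^sup>2)" for x
      by (simp add: complex_norm_square mult.commute del: of_real_power)
    ultimately have "(adj A * A) $$ (j, j) = of_real (\<Sum>i<dim_row A. (cmod (A $$ (i, j)))\<^sup>2)"
      by (simp add: mat_mult_index del: index_mult_mat(1) of_real_power)
    then show "(\<Sum>i<dim_row A. (cmod (A $$ (i, j)))\<^sup>2) = Re ((adj A * A) $$ (j, j))" by simp
  qed simp
  finally show ?thesis .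
qed

lemma fnorm_transpose: "fnorm A\<^sup>T = fnorm A"
proof -
  have "(\<Sum>p\<in>{..<dim_col A} \<times> {..<dim_row A}. (cmod (A\<^sup>T $$ p))\<^sup>2) = (\<Sum>i<dim_col A. \<Sum>j<dim_row A. (cmod (A $$ (j, i)))\<^sup>2)"
    unfolding sum.cartesian_product by (rule sum.cong) auto
  also have "\<dots> = (\<Sum>j<dim_row A. \<Sum>i<dim_col A. (cmod (A $$ (j, i)))\<^sup>2)" by (rule sum.swap)
  finally show ?thesis by (simp add: fnorm_def L2_set_def sum.cartesian_product)
qed

text \<open>Both squares are the trace of (M* M)^2, by cyclicity.\<close>

lemma fnorm_gram_swap: "fnorm (M * adj M) = fnorm (adj M * M)"
proof -
  have "mtrace (adj (M * adj M) * (M * adj M)) = mtrace (M * (adj M * M * adj M))"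
    by (simp add: adj_mult mat_mult_assoc)
  also have "\<dots> = mtrace (adj M * M * adj M * M)" by (rule mtrace_comm) auto
  also have "adj M * M * adj M * M = adj (adj M * M) * (adj M * M)" by (simp add: adj_mult mat_mult_assoc)
  finally have "(fnorm (M * adj M))\<^sup>2 = (fnorm (adj M * M))\<^sup>2" by (simp add: fnorm_sq)
  then show ?thesis by (simp add: power2_eq_iff_nonneg)
qed

text \<open>Completeness splits M* M into the Gram matrices of the branches A_l M, and the triangle
  inequality adds their norms.\<close>

interpretation gram_bound: kraus_bound "\<lambda>c M. fnorm (adj M * M) \<le> c"
proof
  fix r c M As b
  assume M: "M \<in> carrier_mat r c" and K: "kraus_complete r As" and Q: "\<And>l. l < length As \<Longrightarrow> fnorm (adj (As ! l * M) * (As ! l * M)) \<le> b l"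
  have Ac: "As ! l \<in> carrier_mat r r" if "l < length As" for l using K that by (auto simp: kraus_complete_def)
  let ?G = "\<lambda>l. adj (As ! l * M) * (As ! l * M)"
  have Gc: "?G l \<in> carrier_mat c c" if "l < length As" for l using M by (intro carrier_matI) auto
  \<comment> \<open>Compared by traces against arbitrary Z: cyclicity moves M Z M* next to the sum
    of A_l* A_l, which is the identity.\<close>
  have "adj M * M = msum c ?G {..<length As}"
  proof (rule mat_eq_trace)
    show "adj M * M \<in> carrier_mat c c" using M by auto
    fix Z :: "complex mat" assume Z: "Z \<in> carrier_mat c c"
    note d = carrier_matD[OF M] carrier_matD[OF Z]
    let ?N = "M * Z * adj M"
    have N: "?N \<in> carrier_mat r r" using M Z by auto
    have tr: "mtrace (msum n f I * Z') = (\<Sum>i\<in>I. mtrace (f i * Z'))"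
      if "\<And>i. i \<in> I \<Longrightarrow> f i \<in> carrier_mat n n" "Z' \<in> carrier_mat n n" for n f and I :: "nat set" and Z'
    proof -
      have "mtrace (msum n f I * Z') = (\<Sum>a<n. \<Sum>b<n. \<Sum>i\<in>I. f i $$ (a, b) * Z' $$ (b, a))"
        using that(2) by (simp add: mtrace_def mat_mult_index del: index_mult_mat(1)) (simp add: msum_def sum_distrib_right)
      also have "\<dots> = (\<Sum>a<n. \<Sum>i\<in>I. \<Sum>b<n. f i $$ (a, b) * Z' $$ (b, a))" by (intro sum.cong refl sum.swap)
      also have "\<dots> = (\<Sum>i\<in>I. \<Sum>a<n. \<Sum>b<n. f i $$ (a, b) * Z' $$ (b, a))" by (rule sum.swap)
      also have "\<dots> = (\<Sum>i\<in>I. mtrace (f i * Z'))"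
      proof (rule sum.cong)
        fix i assume "i \<in> I"
        then show "(\<Sum>a<n. \<Sum>b<n. f i $$ (a, b) * Z' $$ (b, a)) = mtrace (f i * Z')"
          using that(1)[of i] that(2) by (auto simp: mtrace_def mat_mult_index simp del: index_mult_mat(1))
      qed simp
      finally show ?thesis .
    qed
    have "mtrace (adj M * M * Z) = mtrace (adj M * (M * Z))" using d by (simp add: mat_mult_assoc)
    also have "\<dots> = mtrace (1\<^sub>m r * ?N)" using d N by (subst mtrace_comm) auto
    also have "\<dots> = mtrace (msum r (\<lambda>l. adj (As ! l) * As ! l) {..<length As} * ?N)"
      using K by (simp add: kraus_complete_def)
    also have "\<dots> = (\<Sum>l<length As. mtrace (adj (As ! l) * As ! l * ?N))"
    proof (rule tr[OF _ N])
      show "adj (As ! l) * As ! l \<in> carrier_mat r r" if "l \<in> {..<length As}" for l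
        using Ac[of l] that by (intro carrier_matI) auto
    qed
    also have "\<dots> = (\<Sum>l<length As. mtrace (?G l * Z))"
    proof (rule sum.cong)
      fix l assume "l \<in> {..<length As}"
      then have a: "dim_row (As ! l) = r" "dim_col (As ! l) = r" using Ac[of l] by auto
      have "mtrace (?G l * Z) = mtrace (adj M * (adj (As ! l) * As ! l * M * Z))" using d a by (simp add: adj_mult mat_mult_assoc)
      also have "\<dots> = mtrace (adj (As ! l) * As ! l * M * Z * adj M)" using d a by (intro mtrace_comm) auto
      finally show "mtrace (adj (As ! l) * As ! l * ?N) = mtrace (?G l * Z)" using d a by (simp add: mat_mult_assoc)
    qed simp
    also have "\<dots> = mtrace (msum c ?G {..<length As} * Z)"
      by (rule tr[symmetric]) (use Gc Z in auto)
    finally show "mtrace (adj M * M * Z) = mtrace (msum c ?G {..<length As} * Z)" .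
  qed simp
  then have "fnorm (adj M * M) \<le> (\<Sum>l<length As. fnorm (?G l))"
    using fnorm_msum[of "{..<length As}" ?G c] Gc by simp
  also have "\<dots> \<le> (\<Sum>l<length As. b l)" by (rule sum_mono) (use Q in auto)
  finally show "fnorm (adj M * M) \<le> (\<Sum>l<length As. b l)" .
next
  fix c :: real and M assume Q: "fnorm (adj M * M) \<le> c"
  \<comment> \<open>The Gram matrix of the transpose is the transpose of M M*, whose norm agrees
    with that of M* M.\<close>
  have "adj M\<^sup>T * M\<^sup>T = (M * adj M)\<^sup>T"
    by (rule eq_matI) (auto simp: mat_mult_index mult.commute simp del: index_mult_mat(1) intro!: sum.cong)
  then show "fnorm (adj M\<^sup>T * M\<^sup>T) \<le> c" using Q by (simp add: fnorm_transpose fnorm_gram_swap)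
next
  fix c :: real and z M assume Q: "fnorm (adj M * M) \<le> c"
  let ?G = "adj M * M"
  have "adj (z \<cdot>\<^sub>m M) * (z \<cdot>\<^sub>m M) = complex_of_real ((cmod z)\<^sup>2) \<cdot>\<^sub>m ?G"
    by (rule eq_matI) (auto simp: mat_mult_index sum_distrib_left complex_norm_square mult_ac simp del: index_mult_mat(1) of_real_power intro!: sum.cong)
  moreover have k: "fnorm (complex_of_real k \<cdot>\<^sub>m ?G) = k * fnorm ?G" if "0 \<le> k" for k
  proof -
    have "fnorm (complex_of_real k \<cdot>\<^sub>m ?G) = L2_set (\<lambda>p. k * cmod (?G $$ p)) ({..<dim_col M} \<times> {..<dim_col M})"
      unfolding fnorm_def using that by (intro L2_set_cong) (auto simp: norm_mult simp del: index_mult_mat(1))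
    also have "\<dots> = k * fnorm ?G" unfolding fnorm_def L2_set_right_distrib[OF that] by simp
    finally show ?thesis .
  qed
  ultimately have "fnorm (adj (z \<cdot>\<^sub>m M) * (z \<cdot>\<^sub>m M)) = (cmod z)\<^sup>2 * fnorm ?G" using k[of "(cmod z)\<^sup>2"] by simp
  then show "fnorm (adj (z \<cdot>\<^sub>m M) * (z \<cdot>\<^sub>m M)) \<le> (cmod z)\<^sup>2 * c" using Q by (simp add: mult_left_mono)
qed

section \<open>Correlated coherence of pure states\<close>

lemma psd_proj: "psd (dim_vec x) (proj x)"
  unfolding psd_def
proof (intro conjI ballI)
  fix v :: "complex vec" assume "v \<in> carrier_vec (dim_vec x)"
  then have "cinner v (proj x *\<^sub>v v) = of_real ((cmod (cinner x v))\<^sup>2)" by (intro proj_form) simp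
  then show "cinner v (proj x *\<^sub>v v) \<in> \<real>" "0 \<le> Re (cinner v (proj x *\<^sub>v v))" by (simp_all del: of_real_power)
qed (simp add: carrier_matI)

lemma proj_square: "proj x * proj x = of_real (nrm2 x) \<cdot>\<^sub>m proj x"
  unfolding cinner_self[symmetric]
  by (rule eq_matI) (auto simp: mat_mult_index proj_def cinner_def sum_distrib_left sum_distrib_right mult_ac
     simp del: index_mult_mat(1) intro!: sum.cong)

lemma mtrace_proj: "mtrace (proj x) = of_real (nrm2 x)"
  unfolding cinner_self[symmetric] by (simp add: mtrace_def cinner_def) (simp add: proj_def mult.commute)

lemma density_proj: "x \<in> carrier_vec n \<Longrightarrow> nrm2 x = 1 \<Longrightarrow> density n (proj x)"
  using psd_proj[of x] by (simp add: density_def mtrace_proj)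

lemma mtrace_proj_mult:
  assumes "A \<in> carrier_mat n n" "x \<in> carrier_vec n"
  shows "mtrace (proj x * A) = cinner x (A *\<^sub>v x)"
proof -
  have "mtrace (proj x * A) = (\<Sum>i<n. \<Sum>j<n. x $ i * cnj (x $ j) * A $$ (j, i))"
    using assms by (simp add: mtrace_def mat_mult_index del: index_mult_mat(1)) (simp add: proj_def)
  also have "\<dots> = (\<Sum>j<n. \<Sum>i<n. x $ i * cnj (x $ j) * A $$ (j, i))" by (rule sum.swap)
  also have "\<dots> = cinner x (A *\<^sub>v x)"
    using assms by (simp add: cinner_def mat_vec_index sum_distrib_left mult_ac del: index_mult_mat_vec)
  finally show ?thesis .
qed

text \<open>With \<open>1 / 0 = 0\<close> this also covers \<open>x = 0\<close>.\<close>

lemma msqrt_proj: "msqrt (proj x) = of_real (1 / sqrt (nrm2 x)) \<cdot>\<^sub>m proj x"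
proof (rule msqrt_unique)
  let ?c = "1 / sqrt (nrm2 x)"
  have c: "of_real ?c \<cdot>\<^sub>m proj x \<in> carrier_mat (dim_vec x) (dim_vec x)" by (simp add: carrier_matI)
  have app: "(of_real ?c \<cdot>\<^sub>m proj x) *\<^sub>v v = of_real ?c \<cdot>\<^sub>v (proj x *\<^sub>v v)" if "v \<in> carrier_vec (dim_vec x)" for v
    by (rule eq_vecI) (use that in \<open>auto simp: mat_vec_index sum_distrib_left mult.assoc simp del: index_mult_mat_vec\<close>)
  show "psd (dim_vec x) (of_real ?c \<cdot>\<^sub>m proj x)"
    unfolding psd_def
  proof (intro conjI ballI c)
    fix v :: "complex vec" assume v: "v \<in> carrier_vec (dim_vec x)"
    have "cinner v ((of_real ?c \<cdot>\<^sub>m proj x) *\<^sub>v v) = of_real ?c * cinner v (proj x *\<^sub>v v)"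
      unfolding app[OF v] by (rule cinner_smult_right) (use v in simp)
    also have "\<dots> = of_real (?c * (cmod (cinner x v))\<^sup>2)" using v by (simp add: proj_form)
    finally show "cinner v ((of_real ?c \<cdot>\<^sub>m proj x) *\<^sub>v v) \<in> \<real>" "0 \<le> Re (cinner v ((of_real ?c \<cdot>\<^sub>m proj x) *\<^sub>v v))"
      by (simp_all del: of_real_mult of_real_divide of_real_power)
  qed
  show "of_real ?c \<cdot>\<^sub>m proj x * (of_real ?c \<cdot>\<^sub>m proj x) = proj x"
  proof (cases "nrm2 x = 0")
    case True
    then have x: "x = 0\<^sub>v (dim_vec x)" by (rule nrm2_eq0)
    have x0: "x $ i = 0" if "i < dim_vec x" for i using arg_cong[OF x, of "\<lambda>v. v $ i"] that by simp
    show ?thesis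
      by (rule eq_matI) (auto simp: mat_mult_index proj_def x0 simp del: index_mult_mat(1))
  next
    case False
    have "of_real c \<cdot>\<^sub>m proj x * (of_real c \<cdot>\<^sub>m proj x) = of_real (c * c) \<cdot>\<^sub>m (proj x * proj x)" for c
      by (rule eq_matI) (auto simp: mat_mult_index sum_distrib_left mult_ac simp del: index_mult_mat(1))
    then have "of_real ?c \<cdot>\<^sub>m proj x * (of_real ?c \<cdot>\<^sub>m proj x) = of_real (?c * ?c) \<cdot>\<^sub>m (proj x * proj x)" .
    also have "\<dots> = of_real (?c * ?c * nrm2 x) \<cdot>\<^sub>m proj x"
      unfolding proj_square by (rule eq_matI) (auto simp: mult.assoc)
    also have "?c * ?c * nrm2 x = 1" using False by (simp add: field_simps)
    finally show ?thesis by (auto intro!: eq_matI)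
  qed
qed

lemma msqrt_proj_unit: "nrm2 x = 1 \<Longrightarrow> msqrt (proj x) = proj x"
  by (rule eq_matI) (auto simp: msqrt_proj)

text \<open>With S the root of \<sigma>, the inner matrix S |\<psi>><\<psi>| S is the rank-one
  matrix of S \<psi>; the trace of its root is |S \<psi>|.\<close>

lemma fidelity_pure:
  assumes v: "\<psi> \<in> carrier_vec n" and s: "psd n \<sigma>"
  shows "(fidelity (proj \<psi>) \<sigma>)\<^sup>2 = Re (cinner \<psi> (\<sigma> *\<^sub>v \<psi>))"
proof -
  let ?S = "msqrt \<sigma>"
  note S = psd_msqrt[OF s]
  have "?S * proj \<psi> * ?S = ?S * proj \<psi> * adj ?S" using psd_adj[OF S] by simp
  also have "\<dots> = proj (?S *\<^sub>v \<psi>)" by (rule proj_conj) (use v psd_dim[OF S] in simp)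
  finally have "fidelity (proj \<psi>) \<sigma> = 1 / sqrt (nrm2 (?S *\<^sub>v \<psi>)) * nrm2 (?S *\<^sub>v \<psi>)"
    by (simp add: fidelity_def msqrt_proj mtrace_smult mtrace_proj)
  also have "\<dots> = sqrt (nrm2 (?S *\<^sub>v \<psi>))" by (simp add: real_div_sqrt)
  finally show ?thesis using psd_sqrt_quad[OF s v] by simp
qed

lemma affinity_pure:
  assumes v: "\<psi> \<in> carrier_vec n" "nrm2 \<psi> = 1" and s: "psd n \<sigma>"
  shows "affinity (proj \<psi>) \<sigma> = Re (cinner \<psi> (msqrt \<sigma> *\<^sub>v \<psi>))"
  unfolding affinity_def msqrt_proj_unit[OF v(2)]
  using mtrace_proj_mult[OF psd_carrier[OF psd_msqrt[OF s]] v(1)] by simp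

text \<open>The summands have mutually orthogonal ranges, so the cross terms of the square vanish
  and the root is taken term by term.\<close>

lemma msqrt_cqm:
  assumes a: "onb da \<alpha>" and p: "\<And>i. i < da \<Longrightarrow> 0 \<le> p i" and s: "\<And>i. i < da \<Longrightarrow> psd db (\<sigma> i)"
  shows "msqrt (cqm da db \<alpha> p \<sigma>) = cqm da db \<alpha> (\<lambda>i. sqrt (p i)) (\<lambda>i. msqrt (\<sigma> i))"
proof (rule msqrt_unique)
  show "psd (da * db) (cqm da db \<alpha> (\<lambda>i. sqrt (p i)) (\<lambda>i. msqrt (\<sigma> i)))"
    by (rule cqm_psd[OF a]) (use p s in auto)
  let ?f = "\<lambda>i. complex_of_real (sqrt (p i)) \<cdot>\<^sub>m kron (proj (\<alpha> i)) (msqrt (\<sigma> i))"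
  have ac: "\<alpha> i \<in> carrier_vec da" if "i < da" for i using a that by (auto simp: onb_def)
  have sc: "msqrt (\<sigma> i) \<in> carrier_mat db db" if "i < da" for i using psd_msqrt[OF s[OF that]] by simp
  have fc: "?f i \<in> carrier_mat (da * db) (da * db)" if "i < da" for i using kron_proj_carrier[OF ac[OF that] sc[OF that]] by simp
  have prod: "?f i * ?f j = (complex_of_real (sqrt (p i)) * complex_of_real (sqrt (p j))) \<cdot>\<^sub>m
     kron (proj (\<alpha> i) * proj (\<alpha> j)) (msqrt (\<sigma> i) * msqrt (\<sigma> j))" if ij: "i < da" "j < da" for i j
  proof -
    have "kron (proj (\<alpha> i) * proj (\<alpha> j)) (msqrt (\<sigma> i) * msqrt (\<sigma> j)) = kron (proj (\<alpha> i)) (msqrt (\<sigma> i)) * kron (proj (\<alpha> j)) (msqrt (\<sigma> j))"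
      by (rule kron_mult[symmetric]) (use carrier_vecD[OF ac] carrier_matD[OF sc] ij in auto)
    moreover have "?f i * ?f j = (complex_of_real (sqrt (p i)) * complex_of_real (sqrt (p j))) \<cdot>\<^sub>m
      (kron (proj (\<alpha> i)) (msqrt (\<sigma> i)) * kron (proj (\<alpha> j)) (msqrt (\<sigma> j)))"
      using carrier_vecD[OF ac[OF ij(1)]] carrier_vecD[OF ac[OF ij(2)]] carrier_matD[OF sc[OF ij(1)]] carrier_matD[OF sc[OF ij(2)]]
      by (intro eq_matI) (auto simp: mat_mult_index sum_distrib_left mult_ac simp del: index_mult_mat(1))
    ultimately show ?thesis by simp
  qed
  have "cqm da db \<alpha> (\<lambda>i. sqrt (p i)) (\<lambda>i. msqrt (\<sigma> i)) * cqm da db \<alpha> (\<lambda>i. sqrt (p i)) (\<lambda>i. msqrt (\<sigma> i)) =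
    msum (da * db) (\<lambda>i. ?f i * ?f i) {..<da}"
    unfolding cqm_def
  proof (rule msum_mult)
    fix i j assume ij: "i \<in> {..<da}" "j \<in> {..<da}" "i \<noteq> j"
    then have ij': "i < da" "j < da" by auto
    have "proj (\<alpha> i) * proj (\<alpha> j) = 0\<^sub>m da da"
    proof (rule eq_matI)
      fix r c assume "r < dim_row (0\<^sub>m da da :: complex mat)" "c < dim_col (0\<^sub>m da da :: complex mat)"
      then have rc: "r < da" "c < da" by auto
      have "(proj (\<alpha> i) * proj (\<alpha> j)) $$ (r, c) = (\<Sum>k<da. \<alpha> i $ r * cnj (\<alpha> j $ c) * (cnj (\<alpha> i $ k) * \<alpha> j $ k))"
        using rc carrier_vecD[OF ac[OF ij'(1)]] carrier_vecD[OF ac[OF ij'(2)]]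
        by (auto simp: mat_mult_index proj_def mult_ac simp del: index_mult_mat(1) intro!: sum.cong)
      also have "\<dots> = 0" using onb_sum[OF a ij'] ij(3) by (simp flip: sum_distrib_left)
      finally show "(proj (\<alpha> i) * proj (\<alpha> j)) $$ (r, c) = 0\<^sub>m da da $$ (r, c)" using rc by simp
    qed (use carrier_vecD[OF ac] ij' in auto)
    then show "?f i * ?f j = 0\<^sub>m (da * db) (da * db)"
      unfolding prod[OF ij'] using carrier_matD[OF sc[OF ij'(1)]] carrier_matD[OF sc[OF ij'(2)]]
      by (intro eq_matI) (auto simp: kron_def divmod_less)
  qed (use fc in auto)
  also have "\<dots> = cqm da db \<alpha> p \<sigma>"
    unfolding cqm_def
  proof (rule msum_cong)
    fix i assume "i \<in> {..<da}"
    then have i: "i < da" by simp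
    have "proj (\<alpha> i) * proj (\<alpha> i) = proj (\<alpha> i)"
      using onb_nrm2[OF a i] by (simp add: proj_square) (auto intro!: eq_matI)
    then show "?f i * ?f i = complex_of_real (p i) \<cdot>\<^sub>m kron (proj (\<alpha> i)) (\<sigma> i)"
      unfolding prod[OF i i] using s[OF i] p[OF i] by (simp flip: of_real_mult)
  qed
  finally show "cqm da db \<alpha> (\<lambda>i. sqrt (p i)) (\<lambda>i. msqrt (\<sigma> i)) * cqm da db \<alpha> (\<lambda>i. sqrt (p i)) (\<lambda>i. msqrt (\<sigma> i)) = cqm da db \<alpha> p \<sigma>" .
qed

text \<open>The vector (<a| \<otimes> 1) \<psi>: the unnormalised state of b after outcome
  \<open>a\<close> on the first system.\<close>

abbreviation slice :: "nat \<Rightarrow> complex vec \<Rightarrow> complex vec \<Rightarrow> complex vec" where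
  "slice db a \<psi> \<equiv> adj (emb db a) *\<^sub>v \<psi>"

lemma slice_mvec:
  assumes "a \<in> carrier_vec da" "\<psi> \<in> carrier_vec (da * db)"
  shows "slice db a \<psi> = vcnj (adj (mvec da db \<psi>) *\<^sub>v a)"
proof (rule eq_vecI)
  fix k assume "k < dim_vec (vcnj (adj (mvec da db \<psi>) *\<^sub>v a))"
  then have k: "k < db" by simp
  have "slice db a \<psi> $ k = (\<Sum>r<da * db. (\<lambda>j l. if l = k then cnj (a $ j) * \<psi> $ (j * db + l) else 0) (r div db) (r mod db))"
    using assms k by (auto simp: mat_vec_index emb_def simp del: index_mult_mat_vec intro!: sum.cong)
  also have "\<dots> = (\<Sum>j<da. cnj (a $ j) * \<psi> $ (j * db + k))" using k by (subst sum_divmod) simp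
  also have "\<dots> = vcnj (adj (mvec da db \<psi>) *\<^sub>v a) $ k"
    using assms k by (simp add: vcnj_def mat_vec_index mult.commute del: index_mult_mat_vec) (simp add: mvec_def mult.commute)
  finally show "slice db a \<psi> $ k = vcnj (adj (mvec da db \<psi>) *\<^sub>v a) $ k" .
qed (use assms in simp)

lemma nrm2_slice:
  assumes "a \<in> carrier_vec da" "\<psi> \<in> carrier_vec (da * db)"
  shows "nrm2 (slice db a \<psi>) = nrm2 (adj (mvec da db \<psi>) *\<^sub>v a)"
  by (simp add: slice_mvec[OF assms])

lemma slice_gram:
  assumes "a \<in> carrier_vec da" "\<psi> \<in> carrier_vec (da * db)"
  shows "cinner a (mvec da db \<psi> * adj (mvec da db \<psi>) *\<^sub>v a) = of_real (nrm2 (slice db a \<psi>))"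
  using cinner_gram[of a "adj (mvec da db \<psi>)" a] assms by (simp add: nrm2_slice[OF assms] cinner_self)

lemma ptrace_proj:
  assumes "\<psi> \<in> carrier_vec (da * db)"
  shows "ptrace_b da db (proj \<psi>) = mvec da db \<psi> * adj (mvec da db \<psi>)"
proof (rule eq_matI)
  fix i j assume "i < dim_row (mvec da db \<psi> * adj (mvec da db \<psi>))" "j < dim_col (mvec da db \<psi> * adj (mvec da db \<psi>))"
  then have ij: "i < da" "j < da" by auto
  have "(mvec da db \<psi> * adj (mvec da db \<psi>)) $$ (i, j) = (\<Sum>k<db. \<psi> $ (i * db + k) * cnj (\<psi> $ (j * db + k)))"
    using ij by (simp add: mat_mult_index del: index_mult_mat(1)) (simp add: mvec_def)
  then show "ptrace_b da db (proj \<psi>) $$ (i, j) = (mvec da db \<psi> * adj (mvec da db \<psi>)) $$ (i, j)"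
    using ij assms idx_less[OF ij(1)] idx_less[OF ij(2)] by (simp add: ptrace_b_def proj_def del: index_mult_mat(1))
qed (auto simp: ptrace_b_def)

lemma sum_nrm2_slice:
  assumes a: "onb da \<alpha>" and v: "\<psi> \<in> carrier_vec (da * db)"
  shows "(\<Sum>i<da. nrm2 (slice db (\<alpha> i) \<psi>)) = nrm2 \<psi>"
proof -
  let ?M = "mvec da db \<psi>"
  have ac: "\<alpha> i \<in> carrier_vec da" if "i < da" for i using a that by (auto simp: onb_def)
  have "mtrace (?M * adj ?M) = (\<Sum>i<da. cinner (\<alpha> i) (?M * adj ?M *\<^sub>v \<alpha> i))"
    by (rule trace_onb[OF _ a], rule carrier_matI) auto
  also have "\<dots> = (\<Sum>i<da. of_real (nrm2 (slice db (\<alpha> i) \<psi>)))"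
  proof (rule sum.cong)
    fix i assume "i \<in> {..<da}"
    then have i: "i < da" by simp
    show "cinner (\<alpha> i) (?M * adj ?M *\<^sub>v \<alpha> i) = of_real (nrm2 (slice db (\<alpha> i) \<psi>))"
      by (rule slice_gram[OF ac[OF i] v])
  qed simp
  finally have 1: "mtrace (?M * adj ?M) = of_real (\<Sum>i<da. nrm2 (slice db (\<alpha> i) \<psi>))" by simp
  have "mtrace (?M * adj ?M) = (\<Sum>i<da. \<Sum>k<db. \<psi> $ (i * db + k) * cnj (\<psi> $ (i * db + k)))"
    by (simp add: mtrace_def mat_mult_index del: index_mult_mat(1)) (simp add: mvec_def)
  also have "\<dots> = (\<Sum>s<da * db. (\<lambda>i k. \<psi> $ (i * db + k) * cnj (\<psi> $ (i * db + k))) (s div db) (s mod db))"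
    by (rule sum_divmod[symmetric])
  also have "\<dots> = cinner \<psi> \<psi>" using v by (simp add: cinner_def mult.commute)
  finally show ?thesis unfolding 1 cinner_self by (simp only: of_real_eq_iff)
qed

lemma cqm_pure_form:
  assumes a: "onb da \<alpha>" and s: "\<And>i. i < da \<Longrightarrow> \<sigma> i \<in> carrier_mat db db" and v: "\<psi> \<in> carrier_vec (da * db)"
  shows "Re (cinner \<psi> (cqm da db \<alpha> p \<sigma> *\<^sub>v \<psi>)) = (\<Sum>i<da. p i * Re (cinner (slice db (\<alpha> i) \<psi>) (\<sigma> i *\<^sub>v slice db (\<alpha> i) \<psi>)))"
proof -
  have "cinner \<psi> (cqm da db \<alpha> p \<sigma> *\<^sub>v \<psi>) = (\<Sum>i<da. of_real (p i) * cinner (slice db (\<alpha> i) \<psi>) (\<sigma> i *\<^sub>v slice db (\<alpha> i) \<psi>))"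
    by (rule cqm_form[OF a s v v])
  then show ?thesis by simp
qed

text \<open>Nonnegative eigenvalues with sum 1 are at most 1, and so are their square roots.\<close>

lemma density_form_le:
  assumes s: "density n \<sigma>" and v: "v \<in> carrier_vec n"
  shows "Re (cinner v (\<sigma> *\<^sub>v v)) \<le> nrm2 v" "Re (cinner v (msqrt \<sigma> *\<^sub>v v)) \<le> nrm2 v"
proof -
  obtain e c where e: "onb n e" "\<sigma> = spec n e c" "\<And>k. k < n \<Longrightarrow> 0 \<le> c k"
    using psd_spectral[OF density_psd[OF s]] by blast
  have "(\<Sum>k<n. c k) = 1" using s e spec_trace[OF e(1), of c] by (simp add: density_def flip: of_real_sum)
  then have c1: "c k \<le> 1" if "k < n" for k using member_le_sum[of k "{..<n}" c] e that by auto
  show "Re (cinner v (\<sigma> *\<^sub>v v)) \<le> nrm2 v" unfolding e(2) by (rule spec_nrm2_le[OF e(1) v c1])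
  have m: "msqrt \<sigma> = spec n e (\<lambda>k. sqrt (c k))" unfolding e(2) by (rule msqrt_spec[OF e(1,3)])
  show "Re (cinner v (msqrt \<sigma> *\<^sub>v v)) \<le> nrm2 v"
    unfolding m by (rule spec_nrm2_le[OF e(1) v]) (use c1 in auto)
qed

lemma slice_carrier: "a \<in> carrier_vec da \<Longrightarrow> slice db a \<psi> \<in> carrier_vec db"
  by (intro carrier_vecI) simp

text \<open>The normalised slice. A zero slice gets an arbitrary unit vector, because a
  classical-quantum state needs a density matrix at every index, including those of weight
  0.\<close>

definition slice_state :: "nat \<Rightarrow> complex vec \<Rightarrow> complex vec" where
  "slice_state n x = (if nrm2 x = 0 then unit_vec n 0 else of_real (1 / sqrt (nrm2 x)) \<cdot>\<^sub>v x)"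

lemma slice_state:
  assumes "x \<in> carrier_vec n" "0 < n"
  shows "slice_state n x \<in> carrier_vec n" "nrm2 (slice_state n x) = 1"
    "cinner x (proj (slice_state n x) *\<^sub>v x) = of_real (nrm2 x)"
proof -
  show c: "slice_state n x \<in> carrier_vec n" using assms by (auto simp: slice_state_def)
  show "nrm2 (slice_state n x) = 1"
    using assms by (auto simp: slice_state_def nrm2_smult norm_divide power_divide simp del: of_real_divide)
  have "cinner x (proj (slice_state n x) *\<^sub>v x) = of_real ((cmod (cinner (slice_state n x) x))\<^sup>2)"
    by (rule proj_form) (use assms c in simp)
  also have "(cmod (cinner (slice_state n x) x))\<^sup>2 = nrm2 x"
  proof (cases "nrm2 x = 0")
    case True
    then have "x = 0\<^sub>v n" using nrm2_eq0[of x] assms by simp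
    then show ?thesis using c by simp
  next
    case False
    then have "cmod (cinner (slice_state n x) x) = sqrt (nrm2 x)"
      by (simp add: slice_state_def cinner_smult_left cinner_self norm_divide real_div_sqrt)
    then show ?thesis by simp
  qed
  finally show "cinner x (proj (slice_state n x) *\<^sub>v x) = of_real (nrm2 x)" .
qed

text \<open>For a pure state with reduced state \<open>M M\<^sup>*\<close> the largest squared fidelity to a classical-quantum
  state is the top eigenvalue of \<open>M M\<^sup>*\<close>, the largest squared affinity is \<open>Tr (M M\<^sup>*)\<^sup>2\<close>.\<close>

lemma fidelity_pure_upper:
  assumes a: "onb da \<alpha>" and v: "\<psi> \<in> carrier_vec (da * db)" and s: "\<sigma> \<in> cq_states da db \<alpha>"
    and c: "opbound c (mvec da db \<psi>)"
  shows "(fidelity (proj \<psi>) \<sigma>)\<^sup>2 \<le> c"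
proof -
  obtain p s where s: "\<sigma> = cqm da db \<alpha> p s" "prob_vec da p" "\<And>i. i < da \<Longrightarrow> density db (s i)"
    using s by (auto elim!: cq_statesE)
  have ac: "\<alpha> i \<in> carrier_vec da" if "i < da" for i using a that by (auto simp: onb_def)
  have d: "density (da * db) \<sigma>" unfolding s(1) by (rule cqm_density[OF a s(2,3)])
  have "(fidelity (proj \<psi>) \<sigma>)\<^sup>2 = Re (cinner \<psi> (\<sigma> *\<^sub>v \<psi>))" by (rule fidelity_pure[OF v]) (use d in simp)
  also have "\<dots> = (\<Sum>i<da. p i * Re (cinner (slice db (\<alpha> i) \<psi>) (s i *\<^sub>v slice db (\<alpha> i) \<psi>)))"
    unfolding s(1) by (rule cqm_pure_form[OF a _ v]) (use s(3) in simp)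
  \<comment> \<open>A convex combination of slice forms, each at most the squared slice norm and
    hence at most the squared operator norm of M*.\<close>
  also have "\<dots> \<le> (\<Sum>i<da. p i * c)"
  proof (intro sum_mono mult_left_mono)
    fix i assume "i \<in> {..<da}"
    then have i: "i < da" by simp
    show "0 \<le> p i" using s(2) i by (simp add: prob_vec_def)
    have "Re (cinner (slice db (\<alpha> i) \<psi>) (s i *\<^sub>v slice db (\<alpha> i) \<psi>)) \<le> nrm2 (slice db (\<alpha> i) \<psi>)"
      by (rule density_form_le(1)[OF s(3)[OF i] slice_carrier[OF ac[OF i]]])
    also have "\<dots> = nrm2 (adj (mvec da db \<psi>) *\<^sub>v \<alpha> i)" by (rule nrm2_slice[OF ac[OF i] v])
    also have "\<dots> \<le> c * nrm2 (\<alpha> i)" using opbound_adj[OF c] ac[OF i] by (simp add: opbound_def)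
    finally show "Re (cinner (slice db (\<alpha> i) \<psi>) (s i *\<^sub>v slice db (\<alpha> i) \<psi>)) \<le> c" using onb_nrm2[OF a i] by simp
  qed
  also have "\<dots> = c" using s(2) by (simp add: prob_vec_def flip: sum_distrib_right)
  finally show ?thesis .
qed

lemma sum_gram_quad:
  assumes a: "onb n \<alpha>" and G: "G \<in> carrier_mat n n"
  shows "(\<Sum>i<n. nrm2 (G *\<^sub>v \<alpha> i)) = (fnorm G)\<^sup>2"
proof -
  have ac: "\<alpha> i \<in> carrier_vec n" if "i < n" for i using a that by (auto simp: onb_def)
  have "mtrace (adj G * G) = (\<Sum>i<n. cinner (\<alpha> i) (adj G * G *\<^sub>v \<alpha> i))"
    by (rule trace_onb[OF _ a]) (use G in auto)
  also have "\<dots> = (\<Sum>i<n. of_real (nrm2 (G *\<^sub>v \<alpha> i)))"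
    by (rule sum.cong, simp, subst cinner_gram) (use ac G in \<open>auto simp: cinner_self\<close>)
  finally show ?thesis by (simp add: fnorm_sq)
qed

text \<open>The squared slice norms are the diagonal entries <\<alpha>_i, G \<alpha>_i> of G = M M*,
  and each is at most |G \<alpha>_i|. The bound holds in every orthonormal basis.\<close>

lemma sum_slice_sq_le:
  assumes a: "onb da \<alpha>" and v: "\<psi> \<in> carrier_vec (da * db)"
  defines "M \<equiv> mvec da db \<psi>"
  shows "(\<Sum>i<da. (nrm2 (slice db (\<alpha> i) \<psi>))\<^sup>2) \<le> (fnorm (M * adj M))\<^sup>2"
proof -
  let ?G = "M * adj M"
  have G: "?G \<in> carrier_mat da da" by (rule carrier_matI) (auto simp: M_def)
  have ac: "\<alpha> i \<in> carrier_vec da" if "i < da" for i using a that by (auto simp: onb_def)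
  have "(nrm2 (slice db (\<alpha> i) \<psi>))\<^sup>2 \<le> nrm2 (?G *\<^sub>v \<alpha> i)" if i: "i < da" for i
  proof -
    have e: "cinner (\<alpha> i) (?G *\<^sub>v \<alpha> i) = of_real (nrm2 (slice db (\<alpha> i) \<psi>))"
      unfolding M_def by (rule slice_gram[OF ac[OF i] v])
    have "(nrm2 (slice db (\<alpha> i) \<psi>))\<^sup>2 = (cmod (cinner (\<alpha> i) (?G *\<^sub>v \<alpha> i)))\<^sup>2"
      unfolding e norm_of_real power2_abs by (rule refl)
    also have "\<dots> \<le> nrm2 (\<alpha> i) * nrm2 (?G *\<^sub>v \<alpha> i)"
      by (rule cauchy_schwarz) (use carrier_vecD[OF ac[OF i]] in \<open>simp add: M_def\<close>)
    finally show ?thesis unfolding onb_nrm2[OF a i] mult_1 .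
  qed
  then show ?thesis unfolding sum_gram_quad[OF a G, symmetric] by (intro sum_mono) (simp only: lessThan_iff)
qed

text \<open>Cauchy-Schwarz between the unit vector of the sqrt (p_i) and the vector of squared slice
  norms.\<close>

lemma affinity_pure_upper:
  assumes a: "onb da \<alpha>" and v: "\<psi> \<in> carrier_vec (da * db)" "nrm2 \<psi> = 1" and s: "\<sigma> \<in> cq_states da db \<alpha>"
    and c: "fnorm (adj (mvec da db \<psi>) * mvec da db \<psi>) \<le> c"
  shows "(affinity (proj \<psi>) \<sigma>)\<^sup>2 \<le> c\<^sup>2"
proof -
  obtain p s where s: "\<sigma> = cqm da db \<alpha> p s" "prob_vec da p" "\<And>i. i < da \<Longrightarrow> density db (s i)"
    using s by (auto elim!: cq_statesE)
  have ac: "\<alpha> i \<in> carrier_vec da" if "i < da" for i using a that by (auto simp: onb_def)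
  have p0: "0 \<le> p i" if "i < da" for i using s(2) that by (simp add: prob_vec_def)
  have sp: "psd db (s i)" if "i < da" for i using s(3)[OF that] by simp
  have d: "psd (da * db) \<sigma>" unfolding s(1) by (rule cqm_psd[OF a p0 sp])
  have pd: "psd (da * db) (proj \<psi>)" using psd_proj[of \<psi>] v by simp
  have m: "msqrt (cqm da db \<alpha> p s) = cqm da db \<alpha> (\<lambda>i. sqrt (p i)) (\<lambda>i. msqrt (s i))"
    by (rule msqrt_cqm[OF a p0 sp])
  let ?n = "\<lambda>i. nrm2 (slice db (\<alpha> i) \<psi>)"
  have "affinity (proj \<psi>) \<sigma> = Re (cinner \<psi> (msqrt \<sigma> *\<^sub>v \<psi>))" by (rule affinity_pure[OF v d])
  also have "\<dots> = (\<Sum>i<da. sqrt (p i) * Re (cinner (slice db (\<alpha> i) \<psi>) (msqrt (s i) *\<^sub>v slice db (\<alpha> i) \<psi>)))"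
    unfolding s(1) m by (rule cqm_pure_form[OF a _ v(1)]) (use psd_msqrt[OF sp] in auto)
  also have "\<dots> \<le> (\<Sum>i<da. sqrt (p i) * ?n i)"
    by (intro sum_mono mult_left_mono density_form_le(2)) (use s(3) p0 slice_carrier ac in auto)
  also have "\<dots> = (\<Sum>i<da. \<bar>sqrt (p i)\<bar> * \<bar>?n i\<bar>)" using p0 by (intro sum.cong) auto
  also have "\<dots> \<le> L2_set (\<lambda>i. sqrt (p i)) {..<da} * L2_set ?n {..<da}" by (rule L2_set_mult_ineq)
  also have "L2_set (\<lambda>i. sqrt (p i)) {..<da} = 1" using s(2) p0 by (simp add: L2_set_def prob_vec_def)
  also have "1 * L2_set ?n {..<da} \<le> fnorm (mvec da db \<psi> * adj (mvec da db \<psi>))"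
    unfolding L2_set_def using sum_slice_sq_le[OF a v(1)] by (simp add: real_le_lsqrt sum_nonneg)
  also have "\<dots> \<le> c" using c by (simp add: fnorm_gram_swap)
  finally show ?thesis using affinity_nonneg[OF pd d] by (intro power_mono) auto
qed

text \<open>In an eigenbasis of the reduced state M M* the squared slice norms are its eigenvalues;
  the optimal states below are built from such a basis.\<close>

lemma pure_eigenbasis:
  assumes v: "\<psi> \<in> carrier_vec (da * db)"
  obtains \<alpha> l where "eigenbasis da (ptrace_b da db (proj \<psi>)) \<alpha>" "onb da \<alpha>"
    "mvec da db \<psi> * adj (mvec da db \<psi>) = spec da \<alpha> l"
    "\<And>i. i < da \<Longrightarrow> nrm2 (slice db (\<alpha> i) \<psi>) = l i"
proof -
  let ?M = "mvec da db \<psi>"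
  let ?G = "?M * adj ?M"
  have G: "?G \<in> carrier_mat da da" by (rule carrier_matI) auto
  have "adj ?G = ?G" by (simp add: adj_mult)
  from spectral_theorem[OF G this] obtain \<alpha> l where a: "onb da \<alpha>" and s: "?G = spec da \<alpha> l" by blast
  have ac: "\<alpha> i \<in> carrier_vec da" if "i < da" for i using a that by (auto simp: onb_def)
  have "nrm2 (slice db (\<alpha> i) \<psi>) = l i" if i: "i < da" for i
  proof -
    have "of_real (nrm2 (slice db (\<alpha> i) \<psi>)) = cinner (\<alpha> i) (?G *\<^sub>v \<alpha> i)"
      by (rule slice_gram[OF ac[OF i] v, symmetric])
    also have "\<dots> = of_real (l i)"
      unfolding s spec_apply[OF a i] using onb_cinner[OF a i i] by (simp add: cinner_smult_right)
    finally show ?thesis by (simp only: of_real_eq_iff)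
  qed
  moreover have "eigenbasis da (ptrace_b da db (proj \<psi>)) \<alpha>"
    unfolding eigenbasis_def ptrace_proj[OF v] s using a spec_apply[OF a] by (auto intro!: exI)
  ultimately show ?thesis using that a s by blast
qed

lemma fidelity_pure_attained:
  assumes v: "\<psi> \<in> carrier_vec (da * db)" and pos: "0 < da" "0 < db"
  obtains \<alpha> \<sigma> c where "eigenbasis da (ptrace_b da db (proj \<psi>)) \<alpha>" "\<sigma> \<in> cq_states da db \<alpha>"
    "opbound c (mvec da db \<psi>)" "(fidelity (proj \<psi>) \<sigma>)\<^sup>2 = c"
proof -
  let ?M = "mvec da db \<psi>"
  obtain \<alpha> l where e: "eigenbasis da (ptrace_b da db (proj \<psi>)) \<alpha>" and a: "onb da \<alpha>"
    and G: "?M * adj ?M = spec da \<alpha> l" and l: "\<And>i. i < da \<Longrightarrow> nrm2 (slice db (\<alpha> i) \<psi>) = l i"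
    using pure_eigenbasis[OF v] by blast
  have ac: "\<alpha> i \<in> carrier_vec da" if "i < da" for i using a that by (auto simp: onb_def)
  have l0: "0 \<le> l i" if "i < da" for i using l[OF that, symmetric] by simp
  have "finite (l ` {..<da})" "l ` {..<da} \<noteq> {}" using pos by auto
  then have "Max (l ` {..<da}) \<in> l ` {..<da}" by (rule Max_in)
  then obtain m where m: "m < da" "l m = Max (l ` {..<da})" by auto
  have lm: "l i \<le> l m" if "i < da" for i unfolding m(2) using that by (intro Max_ge) auto
  have "opbound (l m) (adj ?M)"
    unfolding opbound_def
  proof (intro conjI ballI l0 m)
    fix u :: "complex vec" assume u: "u \<in> carrier_vec (dim_col (adj ?M))"
    then have u': "u \<in> carrier_vec da" by simp
    have "nrm2 (adj ?M *\<^sub>v u) = Re (cinner u (?M * adj ?M *\<^sub>v u))"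
      using cinner_gram[of u "adj ?M" u] u' by (simp add: cinner_self)
    also have "\<dots> = (\<Sum>k<da. l k * (cmod (cinner (\<alpha> k) u))\<^sup>2)" unfolding G spec_quad[OF u' a] by simp
    also have "\<dots> \<le> (\<Sum>k<da. l m * (cmod (cinner (\<alpha> k) u))\<^sup>2)" using lm by (intro sum_mono mult_right_mono) auto
    also have "\<dots> = l m * nrm2 u" unfolding parseval[OF u' a, symmetric] by (simp add: sum_distrib_left)
    finally show "nrm2 (adj ?M *\<^sub>v u) \<le> l m * nrm2 u" .
  qed
  from opbound_adj[OF this] have ob: "opbound (l m) ?M" by simp
  \<comment> \<open>All weight on a largest eigenvalue, since the squared fidelity is linear in
    \<open>p\<close>.\<close>
  define p :: "nat \<Rightarrow> real" where "p i = (if i = m then 1 else 0)" for i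
  define s where "s i = proj (slice_state db (slice db (\<alpha> i) \<psi>))" for i
  have p: "prob_vec da p" using m by (simp add: prob_vec_def p_def)
  note st = slice_state[OF slice_carrier[OF ac] pos(2)]
  have s: "density db (s i)" if "i < da" for i
    unfolding s_def by (rule density_proj) (use st that in auto)
  have "(fidelity (proj \<psi>) (cqm da db \<alpha> p s))\<^sup>2 = Re (cinner \<psi> (cqm da db \<alpha> p s *\<^sub>v \<psi>))"
    by (rule fidelity_pure[OF v]) (use cqm_density[OF a p s] in simp)
  also have "\<dots> = (\<Sum>i<da. p i * Re (cinner (slice db (\<alpha> i) \<psi>) (s i *\<^sub>v slice db (\<alpha> i) \<psi>)))"
    by (rule cqm_pure_form[OF a _ v]) (use s in simp)
  also have "\<dots> = (\<Sum>i<da. if i = m then l m else 0)"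
    by (rule sum.cong) (auto simp: p_def s_def st(3) l)
  also have "\<dots> = l m" using m by simp
  finally have f: "(fidelity (proj \<psi>) (cqm da db \<alpha> p s))\<^sup>2 = l m" .
  show ?thesis by (rule that[OF e cq_statesI[OF p s] ob f])
qed

lemma affinity_pure_attained:
  assumes v: "\<psi> \<in> carrier_vec (da * db)" "nrm2 \<psi> = 1" and pos: "0 < da" "0 < db"
  obtains \<alpha> \<sigma> where "eigenbasis da (ptrace_b da db (proj \<psi>)) \<alpha>" "\<sigma> \<in> cq_states da db \<alpha>"
    "affinity (proj \<psi>) \<sigma> = fnorm (adj (mvec da db \<psi>) * mvec da db \<psi>)"
proof -
  let ?M = "mvec da db \<psi>"
  let ?G = "?M * adj ?M"
  obtain \<alpha> l where e: "eigenbasis da (ptrace_b da db (proj \<psi>)) \<alpha>" and a: "onb da \<alpha>"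
    and G: "?G = spec da \<alpha> l" and l: "\<And>i. i < da \<Longrightarrow> nrm2 (slice db (\<alpha> i) \<psi>) = l i"
    using pure_eigenbasis[OF v(1)] by blast
  have ac: "\<alpha> i \<in> carrier_vec da" if "i < da" for i using a that by (auto simp: onb_def)
  have l0: "0 \<le> l i" if "i < da" for i using l[OF that, symmetric] by simp
  define N where "N = fnorm ?G"
  have Gc: "?G \<in> carrier_mat da da" by (rule carrier_matI) auto
  have "N\<^sup>2 = (\<Sum>i<da. nrm2 (?G *\<^sub>v \<alpha> i))" unfolding N_def by (rule sum_gram_quad[OF a Gc, symmetric])
  also have "\<dots> = (\<Sum>i<da. (l i)\<^sup>2)"
    unfolding G by (intro sum.cong refl) (simp add: spec_apply[OF a] nrm2_smult onb_nrm2[OF a])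
  finally have N2: "N\<^sup>2 = (\<Sum>i<da. (l i)\<^sup>2)" .
  have N0: "0 \<le> N" by (simp add: N_def)
  \<comment> \<open>The eigenvalues of the reduced state sum to 1, so they cannot all
    vanish.\<close>
  have "N \<noteq> 0"
  proof
    assume "N = 0"
    then have "\<forall>i<da. l i = 0" using N2 by (simp add: sum_nonneg_eq_0_iff)
    moreover have "(\<Sum>i<da. l i) = 1" using sum_nrm2_slice[OF a v(1)] v(2) l by simp
    ultimately show False by simp
  qed
  \<comment> \<open>The equality case of Cauchy-Schwarz: sqrt (p_i) has to be proportional to l_i,
    and N normalises it.\<close>
  define p where "p i = (l i)\<^sup>2 / N\<^sup>2" for i
  define s where "s i = proj (slice_state db (slice db (\<alpha> i) \<psi>))" for i
  have p0: "0 \<le> p i" for i by (simp add: p_def)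
  have "(\<Sum>i<da. p i) = 1" using \<open>N \<noteq> 0\<close> by (simp add: p_def N2[symmetric] flip: sum_divide_distrib)
  then have p: "prob_vec da p" using p0 by (simp add: prob_vec_def)
  note st = slice_state[OF slice_carrier[OF ac] pos(2)]
  have s: "density db (s i)" if "i < da" for i
    unfolding s_def by (rule density_proj) (use st that in auto)
  have sp: "psd db (s i)" if "i < da" for i using s[OF that] by simp
  have m: "msqrt (cqm da db \<alpha> p s) = cqm da db \<alpha> (\<lambda>i. sqrt (p i)) (\<lambda>i. msqrt (s i))"
    by (rule msqrt_cqm[OF a p0 sp])
  have "affinity (proj \<psi>) (cqm da db \<alpha> p s) = Re (cinner \<psi> (msqrt (cqm da db \<alpha> p s) *\<^sub>v \<psi>))"
    by (rule affinity_pure[OF v cqm_psd[OF a p0 sp]])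
  also have "\<dots> = (\<Sum>i<da. sqrt (p i) * Re (cinner (slice db (\<alpha> i) \<psi>) (msqrt (s i) *\<^sub>v slice db (\<alpha> i) \<psi>)))"
    unfolding m by (rule cqm_pure_form[OF a _ v(1)]) (use psd_msqrt[OF sp] in auto)
  also have "\<dots> = (\<Sum>i<da. (l i)\<^sup>2 / N)"
  proof (rule sum.cong)
    fix i assume "i \<in> {..<da}"
    then have i: "i < da" by simp
    have "msqrt (s i) = s i" unfolding s_def by (rule msqrt_proj_unit[OF st(2)[OF i]])
    then have "Re (cinner (slice db (\<alpha> i) \<psi>) (msqrt (s i) *\<^sub>v slice db (\<alpha> i) \<psi>)) = l i"
      using st(3)[OF i] l[OF i] by (simp add: s_def)
    moreover have "sqrt (p i) = l i / N" using l0[OF i] N0 by (simp add: p_def real_sqrt_divide)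
    ultimately show "sqrt (p i) * Re (cinner (slice db (\<alpha> i) \<psi>) (msqrt (s i) *\<^sub>v slice db (\<alpha> i) \<psi>)) = (l i)\<^sup>2 / N"
      by (simp add: power2_eq_square)
  qed simp
  also have "\<dots> = N\<^sup>2 / N" by (simp add: N2 sum_divide_distrib)
  also have "\<dots> = N" using \<open>N \<noteq> 0\<close> by (simp add: power2_eq_square)
  finally have f: "affinity (proj \<psi>) (cqm da db \<alpha> p s) = fnorm (adj ?M * ?M)" by (simp add: N_def fnorm_gram_swap)
  show ?thesis by (rule that[OF e cq_statesI[OF p s] f])
qed

text \<open>The upper bound at \<psi> holds for every orthonormal basis, and at \<phi> the
  corresponding value is attained in an eigenbasis. It therefore suffices to carry the bound on the
  coefficient matrix from \<phi> back to \<psi>.\<close>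

lemma corr_coh_LOCC:
  assumes X: "X \<in> {fidelity, affinity}" and pos: "0 < da" "0 < db"
    and p: "pure_state (da * db) \<psi>" "pure_state (da * db) \<phi>" and T: "LOCC_transformable da db \<psi> \<phi>"
  shows "corr_coh X da db (proj \<phi>) \<le> corr_coh X da db (proj \<psi>)"
proof -
  have v: "\<psi> \<in> carrier_vec (da * db)" "\<phi> \<in> carrier_vec (da * db)" using p by (auto simp: pure_state_def)
  have n: "nrm2 \<psi> = 1" "nrm2 \<phi> = 1" using p by (auto simp: pure_state_def cinner_self)
  note d = density_proj[OF v(1) n(1)] density_proj[OF v(2) n(2)]
  obtain \<alpha> \<sigma> where a: "eigenbasis da (ptrace_b da db (proj \<phi>)) \<alpha>" "\<sigma> \<in> cq_states da db \<alpha>"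
    and le: "\<And>\<beta> \<tau>. onb da \<beta> \<Longrightarrow> \<tau> \<in> cq_states da db \<beta> \<Longrightarrow> (X (proj \<psi>) \<tau>)\<^sup>2 \<le> (X (proj \<phi>) \<sigma>)\<^sup>2"
  proof (cases "X = fidelity")
    case True
    obtain \<alpha> \<sigma> c where a: "eigenbasis da (ptrace_b da db (proj \<phi>)) \<alpha>" "\<sigma> \<in> cq_states da db \<alpha>"
      "opbound c (mvec da db \<phi>)" "(fidelity (proj \<phi>) \<sigma>)\<^sup>2 = c"
      using fidelity_pure_attained[OF v(2) pos] by blast
    have "opbound c (mvec da db \<psi>)" by (rule opbound.LOCC_transformable_bound[OF p T a(3)])
    then show ?thesis using that[OF a(1,2)] fidelity_pure_upper[OF _ v(1)] a(4) True by blast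
  next
    case False
    then have X: "X = affinity" using X by simp
    obtain \<alpha> \<sigma> where a: "eigenbasis da (ptrace_b da db (proj \<phi>)) \<alpha>" "\<sigma> \<in> cq_states da db \<alpha>"
      "affinity (proj \<phi>) \<sigma> = fnorm (adj (mvec da db \<phi>) * mvec da db \<phi>)"
      using affinity_pure_attained[OF v(2) n(2) pos] by blast
    have "fnorm (adj (mvec da db \<psi>) * mvec da db \<psi>) \<le> fnorm (adj (mvec da db \<phi>) * mvec da db \<phi>)"
      by (rule gram_bound.LOCC_transformable_bound[OF p T]) simp
    then show ?thesis using that[OF a(1,2)] affinity_pure_upper[OF _ v(1) n(1)] a(3) X by metis
  qed
  show ?thesis
  proof (rule corr_coh_greatest[OF X d(1) pos])
    fix \<beta> \<tau> assume b: "eigenbasis da (ptrace_b da db (proj \<psi>)) \<beta>" "\<tau> \<in> cq_states da db \<beta>"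
    have "corr_coh X da db (proj \<phi>) \<le> dist_X X (proj \<phi>) \<sigma>" by (rule corr_coh_le_dist[OF X d(2) pos a])
    also have "\<dots> \<le> dist_X X (proj \<psi>) \<tau>" using le[OF _ b(2)] b(1) by (simp add: dist_X_def eigenbasis_def)
    finally show "corr_coh X da db (proj \<phi>) \<le> dist_X X (proj \<psi>) \<tau>" .
  qed
qed

theorem theorem10:
  fixes X :: "complex mat \<Rightarrow> complex mat \<Rightarrow> real" and da db :: nat
  assumes "X \<in> {fidelity, affinity}" and "0 < da" and "0 < db"
  shows
    "(\<forall>\<rho>. density (da * db) \<rho> \<longrightarrow>
        0 \<le> corr_coh X da db \<rho> \<and>
        (corr_coh X da db \<rho> = 0 \<longleftrightarrow>
           (\<exists>\<alpha> p \<sigma>. onb da \<alpha> \<and> prob_vec da p \<and> (\<forall>i<da. density db (\<sigma> i)) \<and>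
              \<rho> = msum (da * db) (\<lambda>i. complex_of_real (p i) \<cdot>\<^sub>m kron (proj (\<alpha> i)) (\<sigma> i)) {..<da})))
   \<and> (\<forall>\<rho> Ua Ub. density (da * db) \<rho> \<longrightarrow> unitary da Ua \<longrightarrow> unitary db Ub \<longrightarrow>
        corr_coh X da db (kron Ua Ub * \<rho> * adj (kron Ua Ub)) = corr_coh X da db \<rho>)
   \<and> (\<forall>\<rho> db' \<Phi>. density (da * db) \<rho> \<longrightarrow> cptp db db' \<Phi> \<longrightarrow>
        corr_coh X da db' (id_tensor da db db' \<Phi> \<rho>) \<le> corr_coh X da db \<rho>)
   \<and> (\<forall>\<psi> \<phi>. pure_state (da * db) \<psi> \<longrightarrow> pure_state (da * db) \<phi> \<longrightarrow>
        LOCC_transformable da db \<psi> \<phi> \<longrightarrow>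
        corr_coh X da db (proj \<phi>) \<le> corr_coh X da db (proj \<psi>))"
proof -
  have "corr_coh X da db \<rho> = 0 \<longleftrightarrow>
      (\<exists>\<alpha> p \<sigma>. onb da \<alpha> \<and> prob_vec da p \<and> (\<forall>i<da. density db (\<sigma> i)) \<and> \<rho> = cqm da db \<alpha> p \<sigma>)"
    if "density (da * db) \<rho>" for \<rho>
    using corr_coh_zeroD[OF assms(1) that assms(2,3)] corr_coh_cqm[OF assms(1-3)] by blast
  then show ?thesis
    using corr_coh_nonneg[OF assms(1) _ assms(2,3)] corr_coh_conj[OF assms(1) _ assms(2,3)]
      corr_coh_cptp[OF assms(1) _ assms(2,3)] corr_coh_LOCC[OF assms]
    unfolding cqm_def by blast
qed

end
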